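(* ${\rm LZFC}+GC+V=L\vdash \neg(TMA)$. In particular, ${\rm LZFC}+\text{"every set is countable"}+V=L\vdash \neg(TMA)$.
   Context: All theories are in the language $\{\in\}$. BST is the theory with axioms: Empty set, Extensionality, Pair, Union, Cartesian Product, "$\omega$ exists", $\Delta_0$-Separation. $Loc({\rm ZFC})$ is the statement $\forall x\exists y(x\in y\wedge Tr(y)\wedge (y,\in)\models{\rm ZFC})$, where $Tr(y)$ means $y$ is transitive; ${\rm LZFC}={\rm BST}+Loc({\rm ZFC})$. "Model" means a (set) transitive model of ZFC. The expressions $|x|=|y|$, $|x|\leq|y|$, $|x|<|y|$ have their usual meaning in terms of existence of bijections/injections. $GC$ ("there is a greatest cardinality") is the statement $(\exists \kappa)(\forall y)(|y|\leq |\kappa|)$, with $\kappa$ ranging over ordinals. "Every set is countable" is $(\forall x)(|x|\leq\omega)$. $TMA$ (Tall Model Axiom) is the statement $$(\forall \kappa)(\exists \alpha>\kappa)(\forall \delta\geq \alpha)(\exists M)(\delta\in M \wedge M\models |\kappa|<|\alpha|),$$ where $\kappa,\alpha,\delta$ range over ordinals and $M$ over models. $V=L$ says that every set belongs to some $L_\alpha$, $\alpha$ an ordinal (in LZFC each $L_\alpha$ exists, since it can be computed absolutely in any model containing $\alpha$). *)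

theory Defs
  imports Main
begin

section \<open>First-order logic over the language with the single symbol \<open>\<in>\<close>\<close>

text \<open>Variables are de Bruijn indices.\<close>

datatype fm =
    Falsum
  | Member nat nat
  | Equal nat nat
  | Implies fm fm
  | Forall fm

abbreviation Neg :: "fm \<Rightarrow> fm" where
  "Neg p \<equiv> Implies p Falsum"

abbreviation And :: "fm \<Rightarrow> fm \<Rightarrow> fm" where
  "And p q \<equiv> Neg (Implies p (Neg q))"

abbreviation Iff :: "fm \<Rightarrow> fm \<Rightarrow> fm" where
  "Iff p q \<equiv> And (Implies p q) (Implies q p)"

abbreviation Exists :: "fm \<Rightarrow> fm" where
  "Exists p \<equiv> Neg (Forall (Neg p))"

primrec ren :: "(nat \<Rightarrow> nat) \<Rightarrow> fm \<Rightarrow> fm" where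
  "ren r Falsum = Falsum"
| "ren r (Member i j) = Member (r i) (r j)"
| "ren r (Equal i j) = Equal (r i) (r j)"
| "ren r (Implies p q) = Implies (ren r p) (ren r q)"
| "ren r (Forall p) = Forall (ren (case_nat 0 (\<lambda>i. Suc (r i))) p)"

abbreviation lift :: "fm \<Rightarrow> fm" where
  "lift \<equiv> ren Suc"

text \<open>Instantiates index 0 by the variable \<open>i\<close>; the other indices drop by one.\<close>

definition inst :: "fm \<Rightarrow> nat \<Rightarrow> fm" where
  "inst p i = ren (case_nat i (\<lambda>k. k)) p"

text \<open>Classical natural deduction with equality.\<close>

inductive proves :: "fm set \<Rightarrow> fm \<Rightarrow> bool" (infix "\<turnstile>" 50) where
  Assm: "p \<in> T \<Longrightarrow> T \<turnstile> p"
| ImpI: "insert p T \<turnstile> q \<Longrightarrow> T \<turnstile> Implies p q"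
| ImpE: "T \<turnstile> Implies p q \<Longrightarrow> T \<turnstile> p \<Longrightarrow> T \<turnstile> q"
| Classical: "insert (Neg p) T \<turnstile> Falsum \<Longrightarrow> T \<turnstile> p"
| AllI: "lift ` T \<turnstile> p \<Longrightarrow> T \<turnstile> Forall p"
| AllE: "T \<turnstile> Forall p \<Longrightarrow> T \<turnstile> inst p i"
| EqRefl: "T \<turnstile> Equal i i"
| EqSubst: "T \<turnstile> Equal i j \<Longrightarrow> T \<turnstile> inst p i \<Longrightarrow> T \<turnstile> inst p j"

text \<open>The least \<open>n\<close> such that all free indices are below \<open>n\<close>.\<close>

primrec free_bound :: "fm \<Rightarrow> nat" where
  "free_bound Falsum = 0"
| "free_bound (Member i j) = max (Suc i) (Suc j)"
| "free_bound (Equal i j) = max (Suc i) (Suc j)"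
| "free_bound (Implies p q) = max (free_bound p) (free_bound q)"
| "free_bound (Forall p) = free_bound p - 1"

definition universal_closure :: "fm \<Rightarrow> fm" where
  "universal_closure p = (Forall ^^ free_bound p) p"

text \<open>In the bounded quantifier \<open>\<forall>x \<in> v\<^sub>i\<close> the bound \<open>v\<^sub>i\<close> is not the quantified variable itself,
  hence \<open>Suc i\<close>. Bounded existential quantification is obtained by duality.\<close>

inductive Delta0 :: "fm \<Rightarrow> bool" where
  "Delta0 Falsum"
| "Delta0 (Member i j)"
| "Delta0 (Equal i j)"
| "Delta0 p \<Longrightarrow> Delta0 q \<Longrightarrow> Delta0 (Implies p q)"
| "Delta0 p \<Longrightarrow> Delta0 (Forall (Implies (Member 0 (Suc i)) p))"

text \<open>Relativization of all quantifiers to the elements of the variable \<open>a\<close>.\<close>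

primrec rel :: "nat \<Rightarrow> fm \<Rightarrow> fm" where
  "rel a Falsum = Falsum"
| "rel a (Member i j) = Member i j"
| "rel a (Equal i j) = Equal i j"
| "rel a (Implies p q) = Implies (rel a p) (rel a q)"
| "rel a (Forall p) = Forall (Implies (Member 0 (Suc a)) (rel (Suc a) p))"


section \<open>Writing formulas with named variables\<close>

text \<open>A \<open>form\<close> is a formula waiting for the number \<open>n\<close> of quantifiers in whose scope it stands.
  Object variables are represented by de Bruijn levels (the number of quantifiers outside their
  own binder), so inside \<open>n\<close> quantifiers the variable \<open>x < n\<close> has the index \<open>n - Suc x\<close>. A
  quantifier passes its own level to its body; bound names thus become HOL bound variables and
  formulas with parameters are HOL functions. A sentence is obtained by supplying \<open>0\<close>.\<close>

type_synonym form = "nat \<Rightarrow> fm"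

definition fmem :: "nat \<Rightarrow> nat \<Rightarrow> form" (infix "\<^bold>\<in>" 55) where
  "(x \<^bold>\<in> y) = (\<lambda>n. Member (n - Suc x) (n - Suc y))"

definition feq :: "nat \<Rightarrow> nat \<Rightarrow> form" (infix "\<^bold>=" 55) where
  "(x \<^bold>= y) = (\<lambda>n. Equal (n - Suc x) (n - Suc y))"

definition fneg :: "form \<Rightarrow> form" ("\<^bold>\<not> _" [50] 50) where
  "(\<^bold>\<not> p) = (\<lambda>n. Neg (p n))"

definition fimp :: "form \<Rightarrow> form \<Rightarrow> form" (infixr "\<^bold>\<longrightarrow>" 35) where
  "(p \<^bold>\<longrightarrow> q) = (\<lambda>n. Implies (p n) (q n))"

definition fand :: "form \<Rightarrow> form \<Rightarrow> form" (infixr "\<^bold>\<and>" 45) where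
  "(p \<^bold>\<and> q) = (\<lambda>n. And (p n) (q n))"

definition fdisj :: "form \<Rightarrow> form \<Rightarrow> form" (infixr "\<^bold>\<or>" 40) where
  "(p \<^bold>\<or> q) = (\<lambda>n. Implies (Neg (p n)) (q n))"

definition fiff :: "form \<Rightarrow> form \<Rightarrow> form" (infixr "\<^bold>\<longleftrightarrow>" 30) where
  "(p \<^bold>\<longleftrightarrow> q) = (\<lambda>n. Iff (p n) (q n))"

definition fall :: "(nat \<Rightarrow> form) \<Rightarrow> form" (binder "\<^bold>\<forall>" 10) where
  "fall p = (\<lambda>n. Forall (p n (Suc n)))"

definition fex :: "(nat \<Rightarrow> form) \<Rightarrow> form" (binder "\<^bold>\<exists>" 10) where
  "fex p = (\<lambda>n. Exists (p n (Suc n)))"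

definition fball :: "nat \<Rightarrow> (nat \<Rightarrow> form) \<Rightarrow> form" where
  "fball a p = (\<^bold>\<forall>x. x \<^bold>\<in> a \<^bold>\<longrightarrow> p x)"

definition fbex :: "nat \<Rightarrow> (nat \<Rightarrow> form) \<Rightarrow> form" where
  "fbex a p = (\<^bold>\<exists>x. x \<^bold>\<in> a \<^bold>\<and> p x)"

syntax
  "_fball" :: "pttrn \<Rightarrow> nat \<Rightarrow> form \<Rightarrow> form" ("(3\<^bold>\<forall>_\<^bold>\<in>_./ _)" [0, 0, 10] 10)
  "_fbex" :: "pttrn \<Rightarrow> nat \<Rightarrow> form \<Rightarrow> form" ("(3\<^bold>\<exists>_\<^bold>\<in>_./ _)" [0, 0, 10] 10)
translations
  "\<^bold>\<forall>x\<^bold>\<in>a. p" \<rightleftharpoons> "CONST fball a (\<lambda>x. p)"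
  "\<^bold>\<exists>x\<^bold>\<in>a. p" \<rightleftharpoons> "CONST fbex a (\<lambda>x. p)"

definition frel :: "nat \<Rightarrow> form \<Rightarrow> form" where
  "frel A p = (\<lambda>n. rel (n - Suc A) (p n))"


section \<open>Basic notions\<close>

definition is_empty :: "nat \<Rightarrow> form" where
  "is_empty x = (\<^bold>\<forall>z. \<^bold>\<not> z \<^bold>\<in> x)"

definition subset :: "nat \<Rightarrow> nat \<Rightarrow> form" (infix "\<^bold>\<subseteq>" 55) where
  "(x \<^bold>\<subseteq> y) = (\<^bold>\<forall>z\<^bold>\<in>x. z \<^bold>\<in> y)"

text \<open>\<open>y = x \<union> {x}\<close>\<close>

definition is_succ :: "nat \<Rightarrow> nat \<Rightarrow> form" where
  "is_succ y x = (\<^bold>\<forall>z. z \<^bold>\<in> y \<^bold>\<longleftrightarrow> z \<^bold>\<in> x \<^bold>\<or> z \<^bold>= x)"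

definition is_upair :: "nat \<Rightarrow> nat \<Rightarrow> nat \<Rightarrow> form" where
  "is_upair p x y = (\<^bold>\<forall>z. z \<^bold>\<in> p \<^bold>\<longleftrightarrow> z \<^bold>= x \<^bold>\<or> z \<^bold>= y)"

definition is_pair :: "nat \<Rightarrow> nat \<Rightarrow> nat \<Rightarrow> form" where
  "is_pair p x y = (\<^bold>\<exists>u. \<^bold>\<exists>v. is_upair u x x \<^bold>\<and> is_upair v x y \<^bold>\<and> is_upair p u v)"

text \<open>\<open>\<langle>x, y\<rangle> \<in> r\<close>\<close>

definition pair_in :: "nat \<Rightarrow> nat \<Rightarrow> nat \<Rightarrow> form" where
  "pair_in x y r = (\<^bold>\<exists>p\<^bold>\<in>r. is_pair p x y)"

definition Tr :: "nat \<Rightarrow> form" where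
  "Tr x = (\<^bold>\<forall>y\<^bold>\<in>x. y \<^bold>\<subseteq> x)"

text \<open>BST has no axiom of foundation, so well-foundedness is part of the definition.\<close>

definition Ord :: "nat \<Rightarrow> form" where
  "Ord x = (Tr x \<^bold>\<and> (\<^bold>\<forall>y\<^bold>\<in>x. \<^bold>\<forall>z\<^bold>\<in>x. y \<^bold>\<in> z \<^bold>\<or> y \<^bold>= z \<^bold>\<or> z \<^bold>\<in> y) \<^bold>\<and>
     (\<^bold>\<forall>s. s \<^bold>\<subseteq> x \<^bold>\<and> \<^bold>\<not> is_empty s \<^bold>\<longrightarrow> (\<^bold>\<exists>m\<^bold>\<in>s. \<^bold>\<forall>z\<^bold>\<in>s. \<^bold>\<not> z \<^bold>\<in> m)))"

definition is_omega :: "nat \<Rightarrow> form" where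
  "is_omega w = (Ord w \<^bold>\<and> \<^bold>\<not> is_empty w \<^bold>\<and> (\<^bold>\<forall>x\<^bold>\<in>w. \<^bold>\<exists>y\<^bold>\<in>w. is_succ y x) \<^bold>\<and>
     (\<^bold>\<forall>x\<^bold>\<in>w. is_empty x \<^bold>\<or> (\<^bold>\<exists>y\<^bold>\<in>w. is_succ x y)))"

primrec is_num :: "nat \<Rightarrow> nat \<Rightarrow> form" where
  "is_num 0 x = is_empty x"
| "is_num (Suc k) x = (\<^bold>\<exists>y. is_num k y \<^bold>\<and> is_succ x y)"

definition fun_on :: "nat \<Rightarrow> nat \<Rightarrow> form" where
  "fun_on f d = ((\<^bold>\<forall>p\<^bold>\<in>f. \<^bold>\<exists>x\<^bold>\<in>d. \<^bold>\<exists>y. is_pair p x y) \<^bold>\<and>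
     (\<^bold>\<forall>x\<^bold>\<in>d. \<^bold>\<exists>y. pair_in x y f \<^bold>\<and> (\<^bold>\<forall>z. pair_in x z f \<^bold>\<longrightarrow> z \<^bold>= y)))"

definition fun_into :: "nat \<Rightarrow> nat \<Rightarrow> nat \<Rightarrow> form" where
  "fun_into f d c = (fun_on f d \<^bold>\<and> (\<^bold>\<forall>x. \<^bold>\<forall>y. pair_in x y f \<^bold>\<longrightarrow> y \<^bold>\<in> c))"

definition injection :: "nat \<Rightarrow> nat \<Rightarrow> nat \<Rightarrow> form" where
  "injection f x y = (fun_into f x y \<^bold>\<and>
     (\<^bold>\<forall>u. \<^bold>\<forall>v. \<^bold>\<forall>z. pair_in u z f \<^bold>\<and> pair_in v z f \<^bold>\<longrightarrow> u \<^bold>= v))"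

definition bijection :: "nat \<Rightarrow> nat \<Rightarrow> nat \<Rightarrow> form" where
  "bijection f x y = (injection f x y \<^bold>\<and> (\<^bold>\<forall>z\<^bold>\<in>y. \<^bold>\<exists>u\<^bold>\<in>x. pair_in u z f))"

definition card_le :: "nat \<Rightarrow> nat \<Rightarrow> form" where
  "card_le x y = (\<^bold>\<exists>f. injection f x y)"

definition card_eq :: "nat \<Rightarrow> nat \<Rightarrow> form" where
  "card_eq x y = (\<^bold>\<exists>f. bijection f x y)"

definition card_less :: "nat \<Rightarrow> nat \<Rightarrow> form" where
  "card_less x y = (card_le x y \<^bold>\<and> \<^bold>\<not> card_eq x y)"


section \<open>Internal formulas and satisfaction\<close>

text \<open>Internal formulas are sets, coded by
  \<open>\<langle>0,\<langle>i,j\<rangle>\<rangle>\<close> for \<open>v\<^sub>i \<in> v\<^sub>j\<close>, \<open>\<langle>1,\<langle>i,j\<rangle>\<rangle>\<close> for \<open>v\<^sub>i = v\<^sub>j\<close>,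
  \<open>\<langle>2,\<langle>\<phi>,\<psi>\<rangle>\<rangle>\<close> for \<open>\<not> (\<phi> \<and> \<psi>)\<close> and \<open>\<langle>3,\<langle>i,\<phi>\<rangle>\<rangle>\<close> for \<open>\<forall>v\<^sub>i \<phi>\<close>.\<close>

definition is_code :: "nat \<Rightarrow> nat \<Rightarrow> nat \<Rightarrow> nat \<Rightarrow> form" where
  "is_code k c x y = (\<^bold>\<exists>t. \<^bold>\<exists>q. is_num k t \<^bold>\<and> is_pair q x y \<^bold>\<and> is_pair c t q)"

definition closed_under_formation :: "nat \<Rightarrow> nat \<Rightarrow> form" where
  "closed_under_formation n G =
     ((\<^bold>\<forall>i\<^bold>\<in>n. \<^bold>\<forall>j\<^bold>\<in>n. \<^bold>\<forall>c. is_code 0 c i j \<^bold>\<or> is_code 1 c i j \<^bold>\<longrightarrow> c \<^bold>\<in> G) \<^bold>\<and>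
      (\<^bold>\<forall>x\<^bold>\<in>G. \<^bold>\<forall>y\<^bold>\<in>G. \<^bold>\<forall>c. is_code 2 c x y \<^bold>\<longrightarrow> c \<^bold>\<in> G) \<^bold>\<and>
      (\<^bold>\<forall>i\<^bold>\<in>n. \<^bold>\<forall>x\<^bold>\<in>G. \<^bold>\<forall>c. is_code 3 c i x \<^bold>\<longrightarrow> c \<^bold>\<in> G))"

text \<open>\<open>F\<close> is the set of formulas all of whose variables, free or bound, are among
  \<open>v\<^sub>0, \<dots>, v\<^bsub>n-1\<^esub>\<close>.\<close>

definition is_formulas :: "nat \<Rightarrow> nat \<Rightarrow> form" where
  "is_formulas n F = (closed_under_formation n F \<^bold>\<and>
     (\<^bold>\<forall>G. closed_under_formation n G \<^bold>\<longrightarrow> F \<^bold>\<subseteq> G))"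

text \<open>\<open>P\<close> is the set of all functions from \<open>n\<close> to \<open>A\<close>.\<close>

definition is_assignments :: "nat \<Rightarrow> nat \<Rightarrow> nat \<Rightarrow> form" where
  "is_assignments n A P = (\<^bold>\<forall>s. s \<^bold>\<in> P \<^bold>\<longleftrightarrow> fun_into s n A)"

text \<open>For \<open>s, t : n \<rightarrow> A\<close>: \<open>t\<close> is \<open>s\<close> with the value at \<open>i\<close> changed to \<open>a\<close>.\<close>

definition is_update :: "nat \<Rightarrow> nat \<Rightarrow> nat \<Rightarrow> nat \<Rightarrow> nat \<Rightarrow> form" where
  "is_update n t s i a = (pair_in i a t \<^bold>\<and>
     (\<^bold>\<forall>j\<^bold>\<in>n. \<^bold>\<not> j \<^bold>= i \<^bold>\<longrightarrow> (\<^bold>\<forall>x. pair_in j x t \<^bold>\<longleftrightarrow> pair_in j x s)))"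

text \<open>\<open>S\<close> is Tarski's satisfaction relation of \<open>(A, \<in>)\<close> for the formulas in \<open>n\<close> variables:
  \<open>\<langle>\<phi>, s\<rangle> \<in> S\<close> iff \<open>(A, \<in>) \<Turnstile> \<phi>[s]\<close>.\<close>

definition is_sat :: "nat \<Rightarrow> nat \<Rightarrow> nat \<Rightarrow> nat \<Rightarrow> nat \<Rightarrow> form" where
  "is_sat n A F P S = (is_formulas n F \<^bold>\<and> is_assignments n A P \<^bold>\<and>
     (\<^bold>\<forall>z\<^bold>\<in>S. \<^bold>\<exists>c\<^bold>\<in>F. \<^bold>\<exists>s\<^bold>\<in>P. is_pair z c s) \<^bold>\<and>
     (\<^bold>\<forall>s\<^bold>\<in>P.
       (\<^bold>\<forall>i\<^bold>\<in>n. \<^bold>\<forall>j\<^bold>\<in>n. \<^bold>\<forall>c. is_code 0 c i j \<^bold>\<longrightarrow>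
          (pair_in c s S \<^bold>\<longleftrightarrow> (\<^bold>\<exists>x. \<^bold>\<exists>y. pair_in i x s \<^bold>\<and> pair_in j y s \<^bold>\<and> x \<^bold>\<in> y))) \<^bold>\<and>
       (\<^bold>\<forall>i\<^bold>\<in>n. \<^bold>\<forall>j\<^bold>\<in>n. \<^bold>\<forall>c. is_code 1 c i j \<^bold>\<longrightarrow>
          (pair_in c s S \<^bold>\<longleftrightarrow> (\<^bold>\<exists>x. pair_in i x s \<^bold>\<and> pair_in j x s))) \<^bold>\<and>
       (\<^bold>\<forall>d\<^bold>\<in>F. \<^bold>\<forall>e\<^bold>\<in>F. \<^bold>\<forall>c. is_code 2 c d e \<^bold>\<longrightarrow>
          (pair_in c s S \<^bold>\<longleftrightarrow> \<^bold>\<not> (pair_in d s S \<^bold>\<and> pair_in e s S))) \<^bold>\<and>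
       (\<^bold>\<forall>i\<^bold>\<in>n. \<^bold>\<forall>d\<^bold>\<in>F. \<^bold>\<forall>c. is_code 3 c i d \<^bold>\<longrightarrow>
          (pair_in c s S \<^bold>\<longleftrightarrow>
            (\<^bold>\<forall>a\<^bold>\<in>A. \<^bold>\<forall>t\<^bold>\<in>P. is_update n t s i a \<^bold>\<longrightarrow> pair_in d t S)))))"

text \<open>\<open>(A, \<in>) \<Turnstile> \<phi>[s, x]\<close> for a formula \<open>\<phi>\<close> in \<open>n + 1\<close> variables and \<open>s : n \<rightarrow> A\<close>, where \<open>P\<close> and
  \<open>S\<close> are as above for \<open>n + 1\<close>; respectively \<open>(A, \<in>) \<Turnstile> \<phi>[s, x, y]\<close> for \<open>n + 2\<close> variables and
  \<open>m = n + 1\<close>. Those \<open>v\<^sub>i\<close> with \<open>i < n\<close> which are not free in \<open>\<phi>\<close> are available as bound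
  variables, so that taking \<open>n\<close> large allows for every formula.\<close>

definition holds1 :: "nat \<Rightarrow> nat \<Rightarrow> nat \<Rightarrow> nat \<Rightarrow> nat \<Rightarrow> nat \<Rightarrow> form" where
  "holds1 P S c n s x = (\<^bold>\<exists>t\<^bold>\<in>P. s \<^bold>\<subseteq> t \<^bold>\<and> pair_in n x t \<^bold>\<and> pair_in c t S)"

definition holds2 :: "nat \<Rightarrow> nat \<Rightarrow> nat \<Rightarrow> nat \<Rightarrow> nat \<Rightarrow> nat \<Rightarrow> nat \<Rightarrow> nat \<Rightarrow> form" where
  "holds2 P S c n m s x y =
     (\<^bold>\<exists>t\<^bold>\<in>P. s \<^bold>\<subseteq> t \<^bold>\<and> pair_in n x t \<^bold>\<and> pair_in m y t \<^bold>\<and> pair_in c t S)"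


section \<open>Transitive models of ZFC\<close>

definition Ax_empty :: form where
  "Ax_empty = (\<^bold>\<exists>x. is_empty x)"

definition Ax_extensionality :: form where
  "Ax_extensionality = (\<^bold>\<forall>x. \<^bold>\<forall>y. (\<^bold>\<forall>z. z \<^bold>\<in> x \<^bold>\<longleftrightarrow> z \<^bold>\<in> y) \<^bold>\<longrightarrow> x \<^bold>= y)"

definition Ax_pair :: form where
  "Ax_pair = (\<^bold>\<forall>x. \<^bold>\<forall>y. \<^bold>\<exists>p. is_upair p x y)"

definition Ax_union :: form where
  "Ax_union = (\<^bold>\<forall>x. \<^bold>\<exists>u. \<^bold>\<forall>z. z \<^bold>\<in> u \<^bold>\<longleftrightarrow> (\<^bold>\<exists>y\<^bold>\<in>x. z \<^bold>\<in> y))"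

definition Ax_foundation :: form where
  "Ax_foundation = (\<^bold>\<forall>x. \<^bold>\<not> is_empty x \<^bold>\<longrightarrow> (\<^bold>\<exists>y\<^bold>\<in>x. \<^bold>\<forall>z\<^bold>\<in>x. \<^bold>\<not> z \<^bold>\<in> y))"

definition Ax_power :: form where
  "Ax_power = (\<^bold>\<forall>x. \<^bold>\<exists>y. \<^bold>\<forall>z. z \<^bold>\<in> y \<^bold>\<longleftrightarrow> z \<^bold>\<subseteq> x)"

definition Ax_infinity :: form where
  "Ax_infinity = (\<^bold>\<exists>x. (\<^bold>\<exists>y\<^bold>\<in>x. is_empty y) \<^bold>\<and> (\<^bold>\<forall>y\<^bold>\<in>x. \<^bold>\<exists>z\<^bold>\<in>x. is_succ z y))"

definition Ax_choice :: form where
  "Ax_choice = (\<^bold>\<forall>x. (\<^bold>\<forall>y\<^bold>\<in>x. \<^bold>\<not> is_empty y) \<^bold>\<and>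
     (\<^bold>\<forall>y\<^bold>\<in>x. \<^bold>\<forall>z\<^bold>\<in>x. \<^bold>\<not> y \<^bold>= z \<^bold>\<longrightarrow> \<^bold>\<not> (\<^bold>\<exists>u\<^bold>\<in>y. u \<^bold>\<in> z)) \<^bold>\<longrightarrow>
     (\<^bold>\<exists>c. \<^bold>\<forall>y\<^bold>\<in>x. \<^bold>\<exists>u\<^bold>\<in>y. u \<^bold>\<in> c \<^bold>\<and> (\<^bold>\<forall>v\<^bold>\<in>y. v \<^bold>\<in> c \<^bold>\<longrightarrow> v \<^bold>= u)))"

text \<open>\<open>A \<Turnstile> ZFC\<close> is a single formula: the two schemata are quantified over the internal formulas.
  The satisfaction relations are required to exist, so that truth in \<open>A\<close> is meaningful.\<close>

definition sat_separation :: "nat \<Rightarrow> form" where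
  "sat_separation A = (\<^bold>\<exists>w. is_omega w \<^bold>\<and> (\<^bold>\<forall>n\<^bold>\<in>w. \<^bold>\<forall>m\<^bold>\<in>w. is_succ m n \<^bold>\<longrightarrow>
     (\<^bold>\<exists>F. \<^bold>\<exists>P. \<^bold>\<exists>S. is_sat m A F P S \<^bold>\<and>
       (\<^bold>\<forall>c\<^bold>\<in>F. \<^bold>\<forall>s. fun_into s n A \<^bold>\<longrightarrow>
         (\<^bold>\<forall>a\<^bold>\<in>A. \<^bold>\<exists>b\<^bold>\<in>A. \<^bold>\<forall>x\<^bold>\<in>A. x \<^bold>\<in> b \<^bold>\<longleftrightarrow> x \<^bold>\<in> a \<^bold>\<and> holds1 P S c n s x)))))"

definition sat_replacement :: "nat \<Rightarrow> form" where
  "sat_replacement A = (\<^bold>\<exists>w. is_omega w \<^bold>\<and>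
     (\<^bold>\<forall>n\<^bold>\<in>w. \<^bold>\<forall>m\<^bold>\<in>w. \<^bold>\<forall>k\<^bold>\<in>w. is_succ m n \<^bold>\<and> is_succ k m \<^bold>\<longrightarrow>
     (\<^bold>\<exists>F. \<^bold>\<exists>P. \<^bold>\<exists>S. is_sat k A F P S \<^bold>\<and>
       (\<^bold>\<forall>c\<^bold>\<in>F. \<^bold>\<forall>s. fun_into s n A \<^bold>\<longrightarrow>
         (\<^bold>\<forall>a\<^bold>\<in>A.
           (\<^bold>\<forall>x\<^bold>\<in>A. x \<^bold>\<in> a \<^bold>\<longrightarrow> (\<^bold>\<forall>y\<^bold>\<in>A. \<^bold>\<forall>z\<^bold>\<in>A.
             holds2 P S c n m s x y \<^bold>\<and> holds2 P S c n m s x z \<^bold>\<longrightarrow> y \<^bold>= z)) \<^bold>\<longrightarrow>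
           (\<^bold>\<exists>b\<^bold>\<in>A. \<^bold>\<forall>y\<^bold>\<in>A.
             y \<^bold>\<in> b \<^bold>\<longleftrightarrow> (\<^bold>\<exists>x\<^bold>\<in>A. x \<^bold>\<in> a \<^bold>\<and> holds2 P S c n m s x y)))))))"

definition sat_ZFC :: "nat \<Rightarrow> form" where
  "sat_ZFC A = (frel A (Ax_extensionality \<^bold>\<and> Ax_foundation \<^bold>\<and> Ax_empty \<^bold>\<and> Ax_pair \<^bold>\<and> Ax_union \<^bold>\<and>
       Ax_power \<^bold>\<and> Ax_infinity \<^bold>\<and> Ax_choice) \<^bold>\<and>
     sat_separation A \<^bold>\<and> sat_replacement A)"

definition model :: "nat \<Rightarrow> form" where
  "model A = (Tr A \<^bold>\<and> sat_ZFC A)"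


section \<open>The constructible hierarchy\<close>

text \<open>\<open>D\<close> is the set of all subsets of \<open>A\<close> which are definable over \<open>(A, \<in>)\<close> with parameters.\<close>

definition definable :: "nat \<Rightarrow> nat \<Rightarrow> form" where
  "definable A X = (\<^bold>\<exists>w. is_omega w \<^bold>\<and> (\<^bold>\<exists>n\<^bold>\<in>w. \<^bold>\<exists>m\<^bold>\<in>w. is_succ m n \<^bold>\<and>
     (\<^bold>\<exists>F. \<^bold>\<exists>P. \<^bold>\<exists>S. is_sat m A F P S \<^bold>\<and>
       (\<^bold>\<exists>c\<^bold>\<in>F. \<^bold>\<exists>s. fun_into s n A \<^bold>\<and>
         (\<^bold>\<forall>x. x \<^bold>\<in> X \<^bold>\<longleftrightarrow> x \<^bold>\<in> A \<^bold>\<and> holds1 P S c n s x)))))"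

definition is_Def :: "nat \<Rightarrow> nat \<Rightarrow> form" where
  "is_Def A D = (\<^bold>\<forall>X. X \<^bold>\<in> D \<^bold>\<longleftrightarrow> definable A X)"

text \<open>\<open>f = (L\<^sub>\<beta>)\<^bsub>\<beta>\<le>\<alpha>\<^esub>\<close>: \<open>L\<^sub>0 = \<emptyset>\<close>, \<open>L\<^bsub>\<gamma>+1\<^esub> = Def(L\<^sub>\<gamma>)\<close>, and \<open>L\<^sub>\<beta> = \<Union>\<^bsub>\<gamma><\<beta>\<^esub> L\<^sub>\<gamma>\<close> for limit \<open>\<beta>\<close>.\<close>

definition is_L_sequence :: "nat \<Rightarrow> nat \<Rightarrow> form" where
  "is_L_sequence f a = (\<^bold>\<exists>d. is_succ d a \<^bold>\<and> fun_on f d \<^bold>\<and>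
     (\<^bold>\<forall>b\<^bold>\<in>d. \<^bold>\<forall>y. pair_in b y f \<^bold>\<longrightarrow>
       (is_empty b \<^bold>\<longrightarrow> is_empty y) \<^bold>\<and>
       (\<^bold>\<forall>c\<^bold>\<in>b. is_succ b c \<^bold>\<longrightarrow> (\<^bold>\<forall>z. pair_in c z f \<^bold>\<longrightarrow> is_Def z y)) \<^bold>\<and>
       (\<^bold>\<not> is_empty b \<^bold>\<and> \<^bold>\<not> (\<^bold>\<exists>c\<^bold>\<in>b. is_succ b c) \<^bold>\<longrightarrow>
         (\<^bold>\<forall>x. x \<^bold>\<in> y \<^bold>\<longleftrightarrow> (\<^bold>\<exists>c\<^bold>\<in>b. \<^bold>\<exists>z. pair_in c z f \<^bold>\<and> x \<^bold>\<in> z)))))"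

definition in_L :: "nat \<Rightarrow> nat \<Rightarrow> form" where
  "in_L a x = (\<^bold>\<exists>f. \<^bold>\<exists>y. is_L_sequence f a \<^bold>\<and> pair_in a y f \<^bold>\<and> x \<^bold>\<in> y)"


section \<open>The theory LZFC and the statements involved\<close>

definition Ax_cartesian_product :: form where
  "Ax_cartesian_product = (\<^bold>\<forall>x. \<^bold>\<forall>y. \<^bold>\<exists>z. \<^bold>\<forall>p. p \<^bold>\<in> z \<^bold>\<longleftrightarrow> (\<^bold>\<exists>u\<^bold>\<in>x. \<^bold>\<exists>v\<^bold>\<in>y. is_pair p u v))"

definition Ax_omega :: form where
  "Ax_omega = (\<^bold>\<exists>w. is_omega w)"

text \<open>\<open>\<forall>a \<exists>b \<forall>x (x \<in> b \<longleftrightarrow> x \<in> a \<and> \<phi>)\<close>, universally closed. In \<open>\<phi>\<close> the index 0 is \<open>x\<close>, the index 1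
  is \<open>a\<close> and all further indices are parameters; the renaming skips \<open>b\<close>.\<close>

definition separation_instance :: "fm \<Rightarrow> fm" where
  "separation_instance p = universal_closure
     (Forall (Exists (Forall (Iff (Member 0 1)
       (And (Member 0 2) (ren (case_nat 0 (\<lambda>i. i + 2)) p))))))"

definition BST :: "fm set" where
  "BST = (\<lambda>p. p 0) ` {Ax_empty, Ax_extensionality, Ax_pair, Ax_union, Ax_cartesian_product, Ax_omega}
     \<union> separation_instance ` {p. Delta0 p}"

definition Loc_ZFC :: form where
  "Loc_ZFC = (\<^bold>\<forall>x. \<^bold>\<exists>y. x \<^bold>\<in> y \<^bold>\<and> Tr y \<^bold>\<and> sat_ZFC y)"

definition LZFC :: "fm set" where
  "LZFC = BST \<union> {Loc_ZFC 0}"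

definition GC :: form where
  "GC = (\<^bold>\<exists>k. Ord k \<^bold>\<and> (\<^bold>\<forall>y. card_le y k))"

definition every_set_countable :: form where
  "every_set_countable = (\<^bold>\<exists>w. is_omega w \<^bold>\<and> (\<^bold>\<forall>x. card_le x w))"

definition V_eq_L :: form where
  "V_eq_L = (\<^bold>\<forall>x. \<^bold>\<exists>a. Ord a \<^bold>\<and> in_L a x)"

text \<open>The satisfaction \<open>M \<Turnstile> |\<kappa>| < |\<alpha>|\<close> of a concrete formula is its relativization to \<open>M\<close>.\<close>

definition TMA :: form where
  "TMA = (\<^bold>\<forall>k. Ord k \<^bold>\<longrightarrow> (\<^bold>\<exists>a. Ord a \<^bold>\<and> k \<^bold>\<in> a \<^bold>\<and>
     (\<^bold>\<forall>d. Ord d \<^bold>\<and> (a \<^bold>\<in> d \<^bold>\<or> a \<^bold>= d) \<^bold>\<longrightarrow>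
       (\<^bold>\<exists>M. model M \<^bold>\<and> d \<^bold>\<in> M \<^bold>\<and> frel M (card_less k a)))))"

end

theory Submission
  imports Defs "HOL-Library.Countable" "HOL-Library.Infinite_Set"
begin

text \<open>By completeness it suffices to argue in a structure \<open>V\<close> satisfying the axioms. Let \<open>\<kappa>\<close> be a
  greatest cardinality and \<open>\<alpha> > \<kappa>\<close> the ordinal given by TMA. An injection of \<open>\<alpha>\<close> into \<open>\<kappa>\<close> yields a
  bijection \<open>g\<close> between them, and \<open>g \<in> L\<^sub>\<gamma>\<close> for some \<open>\<gamma>\<close> by \<open>V = L\<close>. A transitive model \<open>M\<close> of ZFC
  containing \<open>max(\<gamma>, \<alpha>)\<close> includes \<open>L\<^sub>\<gamma>\<close>, because definability over a set is absolute and \<open>M\<close> can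
  carry out the recursion along \<open>\<gamma>\<close>. Hence \<open>g \<in> M\<close>, so \<open>M\<close> does not satisfy \<open>|\<kappa>| < |\<alpha>|\<close>.

  Separation in \<open>V\<close> is never used: any finitely many sets lie in a transitive model, and every set
  definable over that model by a formula of the metalanguage can be separated there. For this, each
  such formula is translated into an internal code.\<close>

section \<open>Completeness of the natural deduction calculus\<close>

text \<open>The structure \<open>V\<close> may be nonstandard: seen from outside, its omega can have
  infinite elements, and its internal formulas and ordinals can be ill-founded. No induction of the
  metalanguage reaches them, and BST has neither Replacement nor Separation beyond Delta0 formulas.
  Every internal induction therefore takes place in a transitive model that contains the sets
  involved, for a predicate shown to be definable over that model. This explains why the
  absoluteness proofs use two models. The model \<open>M\<close> constructs an object by recursion:
  the set of formulas, a satisfaction relation, the levels of L. The object of \<open>V\<close> with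
  which it is to be compared need not belong to \<open>M\<close>, so the comparison is an induction
  in a second model \<open>N\<close> that contains \<open>M\<close> as well as this object.\<close>

instance fm :: countable
  by countable_datatype

primrec fv :: "fm \<Rightarrow> nat set" where
  "fv Falsum = {}"
| "fv (Member i j) = {i, j}"
| "fv (Equal i j) = {i, j}"
| "fv (Implies p q) = fv p \<union> fv q"
| "fv (Forall p) = {i. Suc i \<in> fv p}"

lemma finite_fv: "finite (fv p)"
proof (induction p)
  case (Forall p)
  have "Suc ` {i. Suc i \<in> fv p} \<subseteq> fv p" by auto
  then have "finite (Suc ` {i. Suc i \<in> fv p})" using Forall finite_subset by blast
  then show ?case by (simp add: finite_image_iff)
qed auto

lemma ren_cong: "(\<And>i. i \<in> fv p \<Longrightarrow> r i = s i) \<Longrightarrow> ren r p = ren s p"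
proof (induction p arbitrary: r s)
  case (Forall p)
  show ?case using Forall.prems by (auto intro!: Forall.IH split: nat.split)
next
  case (Implies p q)
  show ?case using Implies.prems by (simp add: Implies.IH(1)[of r s] Implies.IH(2)[of r s])
qed simp_all

lemma ren_ren: "ren r (ren s p) = ren (\<lambda>i. r (s i)) p"
proof (induction p arbitrary: r s)
  case (Forall p)
  show ?case by (auto simp: Forall intro!: ren_cong split: nat.split)
qed auto

lemma ren_id: "ren (\<lambda>i. i) p = p"
proof (induction p)
  case (Forall p)
  have "case_nat 0 (\<lambda>i. Suc i) = (\<lambda>i. i)" by (auto split: nat.split)
  then show ?case by (simp add: Forall)
qed auto

lemma ren_inst: "ren r (inst p i) = inst (ren (case_nat 0 (\<lambda>i. Suc (r i))) p) (r i)"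
  by (auto simp: inst_def ren_ren intro!: ren_cong split: nat.split)

lemma proves_mono: "T \<turnstile> p \<Longrightarrow> T \<subseteq> T' \<Longrightarrow> T' \<turnstile> p"
proof (induction arbitrary: T' rule: proves.induct)
  case (ImpI p T q) then show ?case by (metis insert_mono proves.ImpI)
next
  case (Classical p T) then show ?case by (metis insert_mono proves.Classical)
next
  case (AllI T p) then show ?case by (metis image_mono proves.AllI)
qed (blast intro: proves.intros)+

text \<open>Below a quantifier the shifted renaming commutes with \<open>lift\<close>, so the
  eigenvariable condition of \<open>AllI\<close> survives every renaming, injective or not.
  Completeness applies this to the non-injective \<open>i div 2\<close>.\<close>

lemma proves_ren: "T \<turnstile> p \<Longrightarrow> ren r ` T \<turnstile> ren r p"
proof (induction arbitrary: r rule: proves.induct)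
  case (ImpI p T q) then show ?case by (auto intro: proves.ImpI)
next
  case (Classical p T) then show ?case by (auto intro: proves.Classical)
next
  case (AllI T p)
  have "ren (case_nat 0 (\<lambda>i. Suc (r i))) ` lift ` T = lift ` ren r ` T"
    by (auto simp: image_iff ren_ren)
  then show ?case using AllI.IH[of "case_nat 0 (\<lambda>i. Suc (r i))"]
    by (auto intro: proves.AllI)
next
  case (AllE T p i) then show ?case
    unfolding ren_inst by (auto intro: proves.AllE)
next
  case (EqSubst T i j p) then show ?case
    unfolding ren_inst by (metis proves.EqSubst ren.simps(3))
qed (auto intro: proves.intros)

lemma proves_finite: "T \<turnstile> p \<Longrightarrow> \<exists>S\<subseteq>T. finite S \<and> S \<turnstile> p"
proof (induction rule: proves.induct)
  case (Assm p T) then show ?case by (intro exI[of _ "{p}"]) (auto intro: proves.Assm)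
next
  case (ImpI p T q)
  then obtain S where S: "S \<subseteq> insert p T" "finite S" "S \<turnstile> q" by blast
  have "insert p (S - {p}) \<turnstile> q" by (rule proves_mono[OF S(3)]) auto
  then show ?case using S by (intro exI[of _ "S - {p}"]) (auto intro: proves.ImpI)
next
  case (ImpE T p q)
  then obtain S S' where "S \<subseteq> T" "finite S" "S \<turnstile> Implies p q" "S' \<subseteq> T" "finite S'" "S' \<turnstile> p"
    by blast
  then show ?case by (intro exI[of _ "S \<union> S'"]) (auto intro: proves.ImpE proves_mono)
next
  case (Classical p T)
  then obtain S where S: "S \<subseteq> insert (Neg p) T" "finite S" "S \<turnstile> Falsum" by blast
  have "insert (Neg p) (S - {Neg p}) \<turnstile> Falsum" by (rule proves_mono[OF S(3)]) auto
  then show ?case using S by (intro exI[of _ "S - {Neg p}"]) (auto intro: proves.Classical)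
next
  case (AllI T p)
  then obtain S where S: "S \<subseteq> lift ` T" "finite S" "S \<turnstile> p" by blast
  then obtain S' where "S' \<subseteq> T" "finite S'" "S = lift ` S'" by (metis finite_subset_image)
  then show ?case using S by (auto intro: proves.AllI)
next
  case (AllE T p i) then show ?case by (blast intro: proves.AllE)
next
  case (EqRefl T i) then show ?case by (blast intro: proves.EqRefl)
next
  case (EqSubst T i j p)
  then obtain S S' where "S \<subseteq> T" "finite S" "S \<turnstile> Equal i j" "S' \<subseteq> T" "finite S'" "S' \<turnstile> inst p i"
    by blast
  then show ?case
    by (intro exI[of _ "S \<union> S'"]) (auto intro!: proves.EqSubst[of _ i j] elim: proves_mono)
qed

definition consistent :: "fm set \<Rightarrow> bool" where
  "consistent T \<longleftrightarrow> \<not> T \<turnstile> Falsum"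

lemma consistent_insert_Neg: "consistent T \<Longrightarrow> \<not> consistent (insert p T) \<Longrightarrow> consistent (insert (Neg p) T)"
  unfolding consistent_def by (metis proves.Classical proves.ImpE proves.ImpI)

text \<open>The variable \<open>i\<close> acts as a fresh constant: a renaming turns a proof of
  \<open>inst q i\<close> into a proof of \<open>q\<close> from lifted assumptions, to which
  \<open>AllI\<close> applies. The resulting \<open>Forall q\<close> contradicts the assumption
  \<open>Neg (Forall q)\<close>.\<close>

lemma consistent_witness:
  assumes con: "consistent (insert (Neg (Forall q)) T)"
    and fresh: "\<And>p. p \<in> T \<Longrightarrow> i \<notin> fv p" "i \<notin> fv (Forall q)"
  shows "consistent (insert (Neg (inst q i)) (insert (Neg (Forall q)) T))" (is "consistent (insert _ ?T)")
  unfolding consistent_def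
proof
  assume "insert (Neg (inst q i)) ?T \<turnstile> Falsum"
  then have "?T \<turnstile> inst q i" by (rule proves.Classical)
  \<comment> \<open>\<open>r\<close> sends \<open>i\<close> to the new bound index 0 and lifts every
    other index; as \<open>i\<close> does not occur in \<open>?T\<close>, it coincides with
    \<open>lift\<close> there.\<close>
  define r where "r j = (if j = i then 0 else Suc j)" for j
  have "ren r ` ?T \<turnstile> ren r (inst q i)" using \<open>?T \<turnstile> inst q i\<close> by (rule proves_ren)
  moreover have "ren r p = lift p" if "p \<in> ?T" for p
  proof (rule ren_cong)
    fix j assume "j \<in> fv p"
    then have "j \<noteq> i" using that fresh by auto
    then show "r j = Suc j" by (simp add: r_def)
  qed
  then have "ren r ` ?T = lift ` ?T" by (metis image_cong)
  moreover have "ren r (inst q i) = ren (\<lambda>j. j) q"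
    unfolding inst_def ren_ren
  proof (rule ren_cong)
    fix j assume "j \<in> fv q"
    then show "r (case j of 0 \<Rightarrow> i | Suc k \<Rightarrow> k) = j"
      using fresh(2) by (cases j) (auto simp: r_def)
  qed
  ultimately have "?T \<turnstile> Forall q" by (metis proves.AllI ren_id)
  then show False using con unfolding consistent_def
    by (meson insertI1 proves.Assm proves.ImpE)
qed

definition extendable :: "fm set \<Rightarrow> bool" where
  "extendable T \<longleftrightarrow> consistent T \<and> infinite {i. \<forall>p\<in>T. i \<notin> fv p}"

lemma infinite_fresh_insert:
  assumes "infinite {i. \<forall>p\<in>T. i \<notin> fv p}"
  shows "infinite {i. \<forall>p\<in>insert q T. i \<notin> fv p}"
proof -
  have "{i. \<forall>p\<in>insert q T. i \<notin> fv p} = {i. \<forall>p\<in>T. i \<notin> fv p} - fv q" by auto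
  then show ?thesis using assms finite_fv by simp
qed

text \<open>If \<open>p\<close> cannot be added consistently, then \<open>Neg p\<close> can; for
  \<open>p = Forall q\<close> a fresh variable is still available on which \<open>q\<close> may be
  made to fail.\<close>

lemma extendable_step:
  assumes "extendable T"
  shows "\<exists>T'. T \<subseteq> T' \<and> extendable T' \<and> (p \<in> T' \<or> Neg p \<in> T') \<and>
    (\<forall>q. p = Forall q \<longrightarrow> p \<in> T' \<or> (\<exists>i. Neg (inst q i) \<in> T'))"
proof (cases "consistent (insert p T)")
  case True
  then show ?thesis using assms infinite_fresh_insert
    by (intro exI[of _ "insert p T"]) (auto simp: extendable_def)
next
  case False
  then have con: "consistent (insert (Neg p) T)"
    using assms consistent_insert_Neg extendable_def by blast
  have inf: "infinite {i. \<forall>q\<in>insert (Neg p) T. i \<notin> fv q}"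
    using assms infinite_fresh_insert unfolding extendable_def by blast
  show ?thesis
  proof (cases "\<exists>q. p = Forall q")
    case True
    then obtain q where q: "p = Forall q" by blast
    obtain i where i: "\<forall>q\<in>insert (Neg p) T. i \<notin> fv q"
      using inf by (metis (mono_tags, lifting) finite.emptyI mem_Collect_eq subsetI subset_empty)
    then have "consistent (insert (Neg (inst q i)) (insert (Neg p) T))"
      using con q by (auto intro!: consistent_witness)
    then have "extendable (insert (Neg (inst q i)) (insert (Neg p) T))"
      using infinite_fresh_insert[OF inf] unfolding extendable_def by blast
    then show ?thesis
      using q by (intro exI[of _ "insert (Neg (inst q i)) (insert (Neg p) T)"]) auto
  qed (use con inf in \<open>auto simp: extendable_def\<close>)
qed

text \<open>The language has no constants, so variables serve as Henkin witnesses.\<close>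

lemma henkin_extension:
  assumes "extendable T"
  obtains H where "T \<subseteq> H" "consistent H" "\<And>p. p \<in> H \<or> Neg p \<in> H"
    "\<And>q. Forall q \<in> H \<or> (\<exists>i. Neg (inst q i) \<in> H)"
proof -
  \<comment> \<open>Stage \<open>n\<close> decides the formula coded by \<open>n\<close>;
    countability of \<open>fm\<close> makes every formula come up.\<close>
  have "\<exists>C :: nat \<Rightarrow> fm set. \<forall>n. (extendable (C n) \<and> (n = 0 \<longrightarrow> C n = T)) \<and>
      (C n \<subseteq> C (Suc n) \<and> (from_nat n \<in> C (Suc n) \<or> Neg (from_nat n) \<in> C (Suc n)) \<and>
       (\<forall>q. from_nat n = Forall q \<longrightarrow> from_nat n \<in> C (Suc n) \<or> (\<exists>i. Neg (inst q i) \<in> C (Suc n))))"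
  proof (rule dependent_nat_choice, goal_cases)
    case 1
    show ?case using assms by blast
  next
    case (2 x n)
    then show ?case using extendable_step[of x "from_nat n"] by auto
  qed
  then obtain C :: "nat \<Rightarrow> fm set" where C: "\<And>n. extendable (C n)" "C 0 = T"
      "\<And>n. C n \<subseteq> C (Suc n)" "\<And>n. from_nat n \<in> C (Suc n) \<or> Neg (from_nat n) \<in> C (Suc n)"
      "\<And>n q. from_nat n = Forall q \<Longrightarrow> from_nat n \<in> C (Suc n) \<or> (\<exists>i. Neg (inst q i) \<in> C (Suc n))"
    by auto
  show thesis
  proof
    show "T \<subseteq> (\<Union>n. C n)" using C(2) by blast
    show "consistent (\<Union>n. C n)" unfolding consistent_def
    proof
      assume "(\<Union>n. C n) \<turnstile> Falsum"
      then obtain S where S: "S \<subseteq> (\<Union>n. C n)" "finite S" "S \<turnstile> Falsum"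
        using proves_finite by blast
      have "mono C" using C(3) by (simp add: mono_iff_le_Suc)
      have "\<exists>n. S \<subseteq> C n" using S(2,1)
      proof (induction rule: finite_induct)
        case (insert x F)
        then obtain n m where "F \<subseteq> C n" "x \<in> C m" by auto
        then have "insert x F \<subseteq> C (max n m)"
          using \<open>mono C\<close> by (metis insert_subset max.cobounded1 max.cobounded2 monoD subset_iff)
        then show ?case by blast
      qed auto
      then show False using S(3) C(1) proves_mono unfolding extendable_def consistent_def by blast
    qed
    show "p \<in> (\<Union>n. C n) \<or> Neg p \<in> (\<Union>n. C n)" for p
      using C(4)[of "to_nat p"] by auto
    show "Forall q \<in> (\<Union>n. C n) \<or> (\<exists>i. Neg (inst q i) \<in> (\<Union>n. C n))" for q
      using C(5)[of "to_nat (Forall q)" q] by auto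
  qed
qed

section \<open>Tarski semantics and the term model of a Henkin theory\<close>

primrec sat :: "'a set \<Rightarrow> ('a \<Rightarrow> 'a \<Rightarrow> bool) \<Rightarrow> (nat \<Rightarrow> 'a) \<Rightarrow> fm \<Rightarrow> bool" where
  "sat U E e Falsum \<longleftrightarrow> False"
| "sat U E e (Member i j) \<longleftrightarrow> E (e i) (e j)"
| "sat U E e (Equal i j) \<longleftrightarrow> e i = e j"
| "sat U E e (Implies p q) \<longleftrightarrow> (sat U E e p \<longrightarrow> sat U E e q)"
| "sat U E e (Forall p) \<longleftrightarrow> (\<forall>x\<in>U. sat U E (case_nat x e) p)"

lemma sat_fv_cong: "(\<And>i. i \<in> fv p \<Longrightarrow> e i = e' i) \<Longrightarrow> sat U E e p = sat U E e' p"
proof (induction p arbitrary: e e')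
  case (Forall p)
  have "sat U E (case_nat x e) p = sat U E (case_nat x e') p" for x
    using Forall.prems by (intro Forall.IH) (auto split: nat.split)
  then show ?case by simp
next
  case (Implies p q)
  then show ?case by (metis Un_iff fv.simps(4) sat.simps(4))
qed auto

lemma sat_ren: "sat U E e (ren r p) = sat U E (\<lambda>i. e (r i)) p"
proof (induction p arbitrary: e r)
  case (Forall p)
  show ?case by (auto simp: Forall intro!: sat_fv_cong ball_cong split: nat.split)
qed auto

text \<open>The domain consists of the variables modulo the equalities in \<open>H\<close>.
  Maximality settles implication, and \<open>wit\<close> settles the universal quantifier, since
  every element is named by a variable.\<close>

lemma henkin_model:
  assumes "consistent H" and max: "\<And>p. p \<in> H \<or> Neg p \<in> H"
    and wit: "\<And>q. Forall q \<in> H \<or> (\<exists>i. Neg (inst q i) \<in> H)"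
  obtains U :: "nat set" and E e where "range e \<subseteq> U" "\<And>p. sat U E e p \<longleftrightarrow> p \<in> H"
proof -
  have Neg: "Neg p \<in> H \<longleftrightarrow> p \<notin> H" for p
    using max[of p] assms(1) unfolding consistent_def by (meson proves.Assm proves.ImpE)
  have closed: "p \<in> H" if "H \<turnstile> p" for p
    using Neg[of p] that assms(1) unfolding consistent_def by (meson proves.Assm proves.ImpE)
  have Falsum: "Falsum \<notin> H" using assms(1) unfolding consistent_def by (meson proves.Assm)
  have Imp: "Implies p q \<in> H \<longleftrightarrow> (p \<in> H \<longrightarrow> q \<in> H)" for p q
  proof
    assume "Implies p q \<in> H"
    then show "p \<in> H \<longrightarrow> q \<in> H" by (meson closed proves.Assm proves.ImpE)
  next
    assume *: "p \<in> H \<longrightarrow> q \<in> H"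
    show "Implies p q \<in> H"
    proof (cases "q \<in> H")
      case True
      then show ?thesis by (meson closed proves.Assm proves.ImpI insertI2)
    next
      case False
      then have "Neg p \<in> H" using * Neg by blast
      then have "insert (Neg q) (insert p H) \<turnstile> Falsum"
        by (meson insertI1 insertI2 proves.Assm proves.ImpE)
      then show ?thesis by (meson closed proves.Classical proves.ImpI)
    qed
  qed
  have All: "Forall q \<in> H \<longleftrightarrow> (\<forall>i. inst q i \<in> H)" for q
    using wit[of q] Neg by (meson closed proves.AllE proves.Assm)
  define Q where "Q i j \<longleftrightarrow> Equal i j \<in> H" for i j
  have Q_subst: "inst p j \<in> H" if "Q i j" "inst p i \<in> H" for p i j
    using that unfolding Q_def by (meson closed proves.EqSubst proves.Assm)
  have Q_refl: "Q i i" for i unfolding Q_def by (meson closed proves.EqRefl)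
  \<comment> \<open>Replacing \<open>i\<close> by \<open>j\<close> at index 0 turns
    \<open>Equal i i\<close> into \<open>Equal j i\<close>; the other side is written
    \<open>Suc i\<close> because \<open>inst\<close> lowers it to \<open>i\<close>.\<close>
  have Q_sym: "Q j i" if "Q i j" for i j
    using Q_subst[OF that, of "Equal 0 (Suc i)"] Q_refl unfolding Q_def inst_def by simp
  have Q_trans: "Q i k" if "Q i j" "Q j k" for i j k
    using Q_subst[OF that(2), of "Equal (Suc i) 0"] that(1) unfolding Q_def inst_def by simp
  have Q_mem: "Member i' j' \<in> H" if "Q i i'" "Q j j'" "Member i j \<in> H" for i i' j j'
    using Q_subst[OF that(1), of "Member 0 (Suc j)"] Q_subst[OF that(2), of "Member (Suc i') 0"]
      that(3) unfolding inst_def by simp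
  \<comment> \<open>The least variable of a class stands for the class, so the domain is a plain set
    of natural numbers rather than a quotient.\<close>
  define rep where "rep i = (LEAST j. Q i j)" for i
  have rep: "Q i (rep i)" for i unfolding rep_def using Q_refl by (rule LeastI)
  have rep_eq: "rep i = rep j \<longleftrightarrow> Q i j" for i j
  proof
    assume "rep i = rep j" then show "Q i j" using rep by (metis Q_sym Q_trans)
  next
    assume "Q i j" then have "Q i = Q j" using Q_sym Q_trans by blast
    then show "rep i = rep j" unfolding rep_def by simp
  qed
  define E where "E i j \<longleftrightarrow> Member i j \<in> H" for i j
  have E: "E (rep i) (rep j) \<longleftrightarrow> Member i j \<in> H" for i j
    unfolding E_def using Q_mem rep Q_sym by blast
  have truth: "sat (range rep) E (\<lambda>i. rep (s i)) p \<longleftrightarrow> ren s p \<in> H" for s p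
  proof (induction p arbitrary: s)
    case (Forall p)
    have "sat (range rep) E (case_nat (rep i) (\<lambda>i. rep (s i))) p
        \<longleftrightarrow> inst (ren (case_nat 0 (\<lambda>i. Suc (s i))) p) i \<in> H" for i
    proof -
      have "case_nat (rep i) (\<lambda>i. rep (s i)) = (\<lambda>j. rep (case_nat i s j))"
        by (auto split: nat.split)
      moreover have "inst (ren (case_nat 0 (\<lambda>i. Suc (s i))) p) i = ren (case_nat i s) p"
        unfolding inst_def ren_ren by (intro ren_cong) (auto split: nat.split)
      ultimately show ?thesis using Forall by simp
    qed
    then show ?case by (simp add: All)
  qed (auto simp: Falsum Imp E rep_eq Q_def)
  show thesis
    by (rule that[of rep "range rep" E]) (use truth[of "\<lambda>i. i"] ren_id in auto)
qed

theorem completeness: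
  assumes "\<not> T \<turnstile> p"
  obtains U :: "nat set" and E e where "range e \<subseteq> U" "\<And>q. q \<in> T \<Longrightarrow> sat U E e q" "\<not> sat U E e p"
proof -
  \<comment> \<open>Doubling the indices leaves the odd variables as witnesses, whatever occurs free in \<open>T\<close>.\<close>
  let ?d = "ren (\<lambda>i. 2 * i)"
  have half: "ren (\<lambda>i. i div 2) (?d q) = q" for q by (simp add: ren_ren ren_id)
  have con: "consistent (?d ` insert (Neg p) T)" unfolding consistent_def
  proof
    assume "?d ` insert (Neg p) T \<turnstile> Falsum"
    from proves_ren[OF this, of "\<lambda>i. i div 2"] have "insert (Neg p) T \<turnstile> Falsum"
      by (simp add: image_image half ren_ren ren_id)
    then show False using assms proves.Classical by blast
  qed
  have fv: "fv (ren r q) \<subseteq> range r" for r q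
  proof (induction q arbitrary: r)
    case (Forall q)
    show ?case using Forall[of "case_nat 0 (\<lambda>i. Suc (r i))"]
      by (auto split: nat.split_asm dest!: subsetD)
  qed auto
  have inf: "infinite {i. \<forall>q\<in>?d ` insert (Neg p) T. i \<notin> fv q}"
  proof -
    have "range (\<lambda>i. 2 * i + 1) \<subseteq> {i. \<forall>q\<in>?d ` insert (Neg p) T. i \<notin> fv q}"
    proof -
      have "2 * i + 1 \<notin> fv (?d q)" for i :: nat and q
      proof
        assume "2 * i + 1 \<in> fv (?d q)"
        then obtain k where "2 * i + 1 = 2 * k" using fv by blast
        then show False by presburger
      qed
      then show ?thesis by auto
    qed
    moreover have "infinite (range (\<lambda>i::nat. 2 * i + 1))"
      by (simp add: finite_image_iff inj_on_def)
    ultimately show ?thesis using infinite_super by blast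
  qed
  from con inf have "extendable (?d ` insert (Neg p) T)" by (simp only: extendable_def) simp
  then obtain H where H: "?d ` insert (Neg p) T \<subseteq> H" "consistent H" "\<And>p. p \<in> H \<or> Neg p \<in> H"
      "\<And>q. Forall q \<in> H \<or> (\<exists>i. Neg (inst q i) \<in> H)"
    by (rule henkin_extension) (rule that)
  obtain U :: "nat set" and E e where M: "range e \<subseteq> U" "\<And>p. sat U E e p \<longleftrightarrow> p \<in> H"
    using H(2-4) by (rule henkin_model) (rule that)
  have sat: "sat U E (\<lambda>i. e (2 * i)) q" if "q \<in> insert (Neg p) T" for q
  proof -
    have "?d q \<in> H" using that H(1) by blast
    then show ?thesis using M(2)[of "?d q"] sat_ren[of U E e "\<lambda>i. 2 * i" q] by simp
  qed
  show thesis
  proof (rule that)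
    show "range (\<lambda>i. e (2 * i)) \<subseteq> U" using M(1) by auto
    show "sat U E (\<lambda>i. e (2 * i)) q" if "q \<in> T" for q using sat that by blast
    show "\<not> sat U E (\<lambda>i. e (2 * i)) p" using sat[of "Neg p"] by simp
  qed
qed

section \<open>Semantics of formulas with named variables\<close>

text \<open>Bounding every quantifier by the elements of one set amounts to shrinking the domain to
  them. Truth of a concrete formula in a model is thereby read as satisfaction in a
  substructure.\<close>

lemma sat_rel: "sat UNIV E e (rel a p) \<longleftrightarrow> sat {x. E x (e a)} E e p"
  by (induction p arbitrary: a e) auto

text \<open>Indices pointing beyond the \<open>n\<close> enclosing quantifiers are read off \<open>e\<close>; hence no lemma below
  needs to know that the sentences involved are closed.\<close>

definition holds :: "'a set \<Rightarrow> ('a \<Rightarrow> 'a \<Rightarrow> bool) \<Rightarrow> (nat \<Rightarrow> 'a) \<Rightarrow> (nat \<Rightarrow> 'a) \<Rightarrow> nat \<Rightarrow> form \<Rightarrow> bool" where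
  "holds U E e r n p \<longleftrightarrow> sat U E (\<lambda>i. if i < n then r (n - Suc i) else e (i - n)) (p n)"

lemma holds_0: "holds U E e r 0 p \<longleftrightarrow> sat U E e (p 0)"
  by (simp add: holds_def)

lemma holds_fneg [simp]: "holds U E e r n (\<^bold>\<not> p) \<longleftrightarrow> \<not> holds U E e r n p"
  and holds_fimp [simp]: "holds U E e r n (p \<^bold>\<longrightarrow> q) \<longleftrightarrow> (holds U E e r n p \<longrightarrow> holds U E e r n q)"
  and holds_fand [simp]: "holds U E e r n (p \<^bold>\<and> q) \<longleftrightarrow> holds U E e r n p \<and> holds U E e r n q"
  and holds_fdisj [simp]: "holds U E e r n (p \<^bold>\<or> q) \<longleftrightarrow> holds U E e r n p \<or> holds U E e r n q"
  and holds_fiff [simp]: "holds U E e r n (p \<^bold>\<longleftrightarrow> q) \<longleftrightarrow> (holds U E e r n p \<longleftrightarrow> holds U E e r n q)"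
  by (auto simp: holds_def fneg_def fimp_def fand_def fdisj_def fiff_def)

lemma holds_feq [simp]: "x < n \<Longrightarrow> y < n \<Longrightarrow> holds U E e r n (x \<^bold>= y) \<longleftrightarrow> r x = r y"
  by (simp add: holds_def feq_def Suc_diff_Suc)

lemma holds_fall [simp]: "holds U E e r n (fall p) \<longleftrightarrow> (\<forall>a\<in>U. holds U E e (r(n := a)) (Suc n) (p n))"
proof -
  \<comment> \<open>Levels count from the outermost binder, indices from the innermost: pushing
    \<open>a\<close> in front of the index environment is an update of the level environment at
    \<open>n\<close>.\<close>
  have "case_nat a (\<lambda>i. if i < n then r (n - Suc i) else e (i - n)) =
      (\<lambda>i. if i < Suc n then (r(n := a)) (Suc n - Suc i) else e (i - Suc n))" for a
    by (rule ext) (auto split: nat.split)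
  then show ?thesis by (simp add: holds_def fall_def)
qed

lemma holds_fex [simp]: "holds U E e r n (fex p) \<longleftrightarrow> (\<exists>a\<in>U. holds U E e (r(n := a)) (Suc n) (p n))"
  using holds_fall[of U E e r n "\<lambda>x. \<^bold>\<not> p x"] by (simp add: holds_def fex_def fall_def fneg_def)

lemma holds_frel:
  assumes "A < n"
  shows "holds UNIV E e r n (frel A p) \<longleftrightarrow> holds {x. E x (r A)} E e r n p"
  using assms by (simp add: holds_def frel_def sat_rel Suc_diff_Suc)

locale membership =
  fixes E :: "'a \<Rightarrow> 'a \<Rightarrow> bool"
begin

definition ext :: "'a \<Rightarrow> 'a set" where
  "ext a = {x. E x a}"

text \<open>Where no element has extension \<open>S\<close>, the description denotes an arbitrary
  element; every computation of \<open>ext (col S)\<close> therefore first exhibits such an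
  element.\<close>

definition col :: "'a set \<Rightarrow> 'a" where
  "col S = (THE a. ext a = S)"

abbreviation holdsE where "holdsE U \<equiv> holds U E"

lemma holds_fmem [simp]: "x < n \<Longrightarrow> y < n \<Longrightarrow> holdsE U e r n (x \<^bold>\<in> y) \<longleftrightarrow> r x \<in> ext (r y)"
  by (simp add: holds_def fmem_def ext_def Suc_diff_Suc)

lemma holds_frel_ext [simp]:
  "A < n \<Longrightarrow> holdsE UNIV e r n (frel A p) \<longleftrightarrow> holdsE (ext (r A)) e r n p"
  by (simp add: ext_def holds_frel)

lemma holds_fball [simp]:
  "a < n \<Longrightarrow> holdsE U e r n (fball a p) \<longleftrightarrow> (\<forall>x\<in>U. x \<in> ext (r a) \<longrightarrow> holdsE U e (r(n := x)) (Suc n) (p n))"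
  by (simp add: fball_def)

lemma holds_fbex [simp]:
  "a < n \<Longrightarrow> holdsE U e r n (fbex a p) \<longleftrightarrow> (\<exists>x\<in>U. x \<in> ext (r a) \<and> holdsE U e (r(n := x)) (Suc n) (p n))"
  by (simp add: fbex_def)

end

locale pair_union = membership +
  assumes extensional: "ext a = ext b \<Longrightarrow> a = b"
    and empty_ex: "\<exists>a. ext a = {}"
    and upair_ex: "\<exists>a. ext a = {x, y}"
    and union_ex: "\<exists>a. ext a = (\<Union>y\<in>ext x. ext y)"
begin

lemma col_eq: "ext a = S \<Longrightarrow> col S = a"
  unfolding col_def by (rule the_equality) (simp_all add: extensional)

lemma ext_col: "ext a = S \<Longrightarrow> ext (col S) = S"
  by (simp add: col_eq)

lemma col_ext [simp]: "col (ext a) = a"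
  by (simp add: col_eq)

definition emp :: 'a where "emp = col {}"

definition upair :: "'a \<Rightarrow> 'a \<Rightarrow> 'a" where "upair x y = col {x, y}"

definition opair :: "'a \<Rightarrow> 'a \<Rightarrow> 'a" where "opair x y = upair (upair x x) (upair x y)"

definition Uni :: "'a \<Rightarrow> 'a" where "Uni x = col (\<Union>y\<in>ext x. ext y)"

definition succ :: "'a \<Rightarrow> 'a" where "succ x = Uni (upair x (upair x x))"

primrec num :: "nat \<Rightarrow> 'a" where
  "num 0 = emp"
| "num (Suc k) = succ (num k)"

lemma ext_emp [simp]: "ext emp = {}"
  unfolding emp_def using empty_ex by (metis ext_col)

lemma ext_upair [simp]: "ext (upair x y) = {x, y}"
  unfolding upair_def using upair_ex by (metis ext_col)

lemma ext_Uni [simp]: "ext (Uni x) = (\<Union>y\<in>ext x. ext y)"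
proof -
  obtain a where "ext a = (\<Union>y\<in>ext x. ext y)" using union_ex by blast
  then show ?thesis unfolding Uni_def by (rule ext_col)
qed

lemma ext_succ [simp]: "ext (succ x) = insert x (ext x)"
  unfolding succ_def by auto

lemma upair_eq_iff: "upair a b = upair c d \<longleftrightarrow> {a, b} = {c, d}"
  by (metis ext_upair extensional)

lemma opair_inject [simp]: "opair a b = opair c d \<longleftrightarrow> a = c \<and> b = d"
  unfolding opair_def by (simp add: upair_eq_iff doubleton_eq_iff) blast

lemma eq_emp_iff: "a = emp \<longleftrightarrow> ext a = {}"
  by (metis ext_emp extensional)

lemma eq_succ_iff: "y = succ x \<longleftrightarrow> ext y = insert x (ext x)"
  by (metis ext_succ extensional)

section \<open>Absoluteness of elementary notions for transitive sets closed under pairing\<close>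

definition transU :: "'a set \<Rightarrow> bool" where
  "transU U \<longleftrightarrow> (\<forall>x\<in>U. ext x \<subseteq> U) \<and> (\<forall>x\<in>U. \<forall>y\<in>U. upair x y \<in> U)"

lemma transU_UNIV [simp]: "transU UNIV"
  by (simp add: transU_def)

lemma transU_ext: "transU U \<Longrightarrow> a \<in> U \<Longrightarrow> x \<in> ext a \<Longrightarrow> x \<in> U"
  by (auto simp: transU_def)

lemma transU_upair: "transU U \<Longrightarrow> x \<in> U \<Longrightarrow> y \<in> U \<Longrightarrow> upair x y \<in> U"
  by (auto simp: transU_def)

lemma opair_in_iff [simp]: "transU U \<Longrightarrow> opair x y \<in> U \<longleftrightarrow> x \<in> U \<and> y \<in> U"
  unfolding opair_def
  by (metis ext_upair insertI1 insertI2 transU_ext transU_upair)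

definition isfun :: "'a \<Rightarrow> 'a \<Rightarrow> bool" where
  "isfun f d \<longleftrightarrow> (\<forall>p\<in>ext f. \<exists>x\<in>ext d. \<exists>y. p = opair x y) \<and>
     (\<forall>x\<in>ext d. \<exists>y. opair x y \<in> ext f \<and> (\<forall>z. opair x z \<in> ext f \<longrightarrow> z = y))"

definition isfunto :: "'a \<Rightarrow> 'a \<Rightarrow> 'a \<Rightarrow> bool" where
  "isfunto f d c \<longleftrightarrow> isfun f d \<and> (\<forall>x y. opair x y \<in> ext f \<longrightarrow> y \<in> ext c)"

definition isinj :: "'a \<Rightarrow> 'a \<Rightarrow> 'a \<Rightarrow> bool" where
  "isinj f x y \<longleftrightarrow> isfunto f x y \<and> (\<forall>u v z. opair u z \<in> ext f \<and> opair v z \<in> ext f \<longrightarrow> u = v)"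

definition isbij :: "'a \<Rightarrow> 'a \<Rightarrow> 'a \<Rightarrow> bool" where
  "isbij f x y \<longleftrightarrow> isinj f x y \<and> (\<forall>z\<in>ext y. \<exists>u\<in>ext x. opair u z \<in> ext f)"

context
  fixes U :: "'a set"
  assumes U: "transU U"
begin

lemma ext_subU: "a \<in> U \<Longrightarrow> ext a \<subseteq> U"
  using U transU_ext by blast

lemma holds_is_empty: "x < n \<Longrightarrow> r x \<in> U \<Longrightarrow> holdsE U e r n (is_empty x) \<longleftrightarrow> r x = emp"
  unfolding is_empty_def eq_emp_iff using ext_subU by (auto simp: fun_upd_def)

lemma holds_subset: "x < n \<Longrightarrow> y < n \<Longrightarrow> r x \<in> U \<Longrightarrow> holdsE U e r n (x \<^bold>\<subseteq> y) \<longleftrightarrow> ext (r x) \<subseteq> ext (r y)"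
  unfolding subset_def using ext_subU by (auto simp: fun_upd_def)

lemma holds_is_succ: "x < n \<Longrightarrow> y < n \<Longrightarrow> r x \<in> U \<Longrightarrow> r y \<in> U \<Longrightarrow>
    holdsE U e r n (is_succ y x) \<longleftrightarrow> r y = succ (r x)"
  unfolding is_succ_def eq_succ_iff using ext_subU by (auto simp: fun_upd_def)

lemma holds_is_upair: "x < n \<Longrightarrow> y < n \<Longrightarrow> p < n \<Longrightarrow> r x \<in> U \<Longrightarrow> r y \<in> U \<Longrightarrow> r p \<in> U \<Longrightarrow>
    holdsE U e r n (is_upair p x y) \<longleftrightarrow> r p = upair (r x) (r y)"
proof -
  assume a: "x < n" "y < n" "p < n" "r x \<in> U" "r y \<in> U" "r p \<in> U"
  have "holdsE U e r n (is_upair p x y) \<longleftrightarrow> ext (r p) = {r x, r y}"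
    unfolding is_upair_def using a ext_subU[of "r p"] by (auto simp: fun_upd_def)
  then show ?thesis by (metis ext_upair extensional)
qed

text \<open>\<open>is_pair\<close> quantifies over the two components of a Kuratowski pair; closure
  of \<open>U\<close> under \<open>upair\<close> supplies both, so restricting the quantifiers to
  \<open>U\<close> changes nothing.\<close>

lemma holds_is_pair: "x < n \<Longrightarrow> y < n \<Longrightarrow> p < n \<Longrightarrow> r x \<in> U \<Longrightarrow> r y \<in> U \<Longrightarrow> r p \<in> U \<Longrightarrow>
    holdsE U e r n (is_pair p x y) \<longleftrightarrow> r p = opair (r x) (r y)"
  unfolding is_pair_def opair_def using transU_upair[OF U]
  by (auto simp: holds_is_upair fun_upd_def)

lemma holds_pair_in: "x < n \<Longrightarrow> y < n \<Longrightarrow> f < n \<Longrightarrow> r x \<in> U \<Longrightarrow> r y \<in> U \<Longrightarrow> r f \<in> U \<Longrightarrow>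
    holdsE U e r n (pair_in x y f) \<longleftrightarrow> opair (r x) (r y) \<in> ext (r f)"
  unfolding pair_in_def using U by (auto simp: holds_is_pair fun_upd_def)

lemma holds_fun_on: "f < n \<Longrightarrow> d < n \<Longrightarrow> r f \<in> U \<Longrightarrow> r d \<in> U \<Longrightarrow>
    holdsE U e r n (fun_on f d) \<longleftrightarrow> isfun (r f) (r d)"
  unfolding fun_on_def isfun_def using ext_subU[of "r f"] ext_subU[of "r d"] U
  apply (simp add: holds_is_pair holds_pair_in fun_upd_def)
  apply (intro conj_cong)
   apply (metis opair_in_iff subset_iff)
  apply (metis opair_in_iff subset_iff)
  done

lemma holds_fun_into: "f < n \<Longrightarrow> d < n \<Longrightarrow> c < n \<Longrightarrow> r f \<in> U \<Longrightarrow> r d \<in> U \<Longrightarrow> r c \<in> U \<Longrightarrow>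
    holdsE U e r n (fun_into f d c) \<longleftrightarrow> isfunto (r f) (r d) (r c)"
  unfolding fun_into_def isfunto_def using ext_subU[of "r f"] U
  apply (simp add: holds_fun_on holds_pair_in fun_upd_def)
  apply (metis opair_in_iff subset_iff)
  done

lemma holds_injection: "f < n \<Longrightarrow> d < n \<Longrightarrow> c < n \<Longrightarrow> r f \<in> U \<Longrightarrow> r d \<in> U \<Longrightarrow> r c \<in> U \<Longrightarrow>
    holdsE U e r n (injection f d c) \<longleftrightarrow> isinj (r f) (r d) (r c)"
  unfolding injection_def isinj_def using ext_subU[of "r f"] U
  apply (simp add: holds_fun_into holds_pair_in fun_upd_def)
  apply (metis opair_in_iff subset_iff)
  done

lemma holds_bijection: "f < n \<Longrightarrow> d < n \<Longrightarrow> c < n \<Longrightarrow> r f \<in> U \<Longrightarrow> r d \<in> U \<Longrightarrow> r c \<in> U \<Longrightarrow>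
    holdsE U e r n (bijection f d c) \<longleftrightarrow> isbij (r f) (r d) (r c)"
  unfolding bijection_def isbij_def using ext_subU[of "r f"] ext_subU[of "r c"] U
  apply (simp add: holds_injection holds_pair_in fun_upd_def)
  apply (metis opair_in_iff subset_iff)
  done

lemma holds_card_eq: "x < n \<Longrightarrow> y < n \<Longrightarrow> r x \<in> U \<Longrightarrow> r y \<in> U \<Longrightarrow>
    holdsE U e r n (card_eq x y) \<longleftrightarrow> (\<exists>f\<in>U. isbij f (r x) (r y))"
  unfolding card_eq_def by (simp add: holds_bijection fun_upd_def)

end

lemmas holds_UNIV [simp] =
  holds_is_empty[OF transU_UNIV] holds_subset[OF transU_UNIV] holds_is_succ[OF transU_UNIV]
  holds_is_pair[OF transU_UNIV] holds_pair_in[OF transU_UNIV]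
  holds_fun_on[OF transU_UNIV] holds_fun_into[OF transU_UNIV] holds_injection[OF transU_UNIV]
  holds_bijection[OF transU_UNIV]

section \<open>The formulas about omega, satisfaction and L, evaluated in the full structure\<close>

definition code :: "nat \<Rightarrow> 'a \<Rightarrow> 'a \<Rightarrow> 'a" where
  "code k x y = opair (num k) (opair x y)"

definition transv :: "'a \<Rightarrow> bool" where
  "transv x \<longleftrightarrow> (\<forall>y\<in>ext x. ext y \<subseteq> ext x)"

definition linear :: "'a \<Rightarrow> bool" where
  "linear x \<longleftrightarrow> (\<forall>y\<in>ext x. \<forall>z\<in>ext x. y \<in> ext z \<or> y = z \<or> z \<in> ext y)"

definition isord :: "'a \<Rightarrow> bool" where
  "isord x \<longleftrightarrow> transv x \<and> linear x \<and>
     (\<forall>s. ext s \<subseteq> ext x \<and> s \<noteq> emp \<longrightarrow> (\<exists>m\<in>ext s. \<forall>z\<in>ext s. z \<notin> ext m))"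

definition isomega :: "'a \<Rightarrow> bool" where
  "isomega w \<longleftrightarrow> isord w \<and> w \<noteq> emp \<and> (\<forall>x\<in>ext w. succ x \<in> ext w) \<and>
     (\<forall>x\<in>ext w. x = emp \<or> (\<exists>y\<in>ext w. x = succ y))"

definition fclosed :: "'a \<Rightarrow> 'a set \<Rightarrow> bool" where
  "fclosed n G \<longleftrightarrow> (\<forall>i\<in>ext n. \<forall>j\<in>ext n. code 0 i j \<in> G \<and> code 1 i j \<in> G) \<and>
     (\<forall>x\<in>G. \<forall>y\<in>G. code 2 x y \<in> G) \<and> (\<forall>i\<in>ext n. \<forall>x\<in>G. code 3 i x \<in> G)"

definition isF :: "'a \<Rightarrow> 'a \<Rightarrow> bool" where
  "isF n F \<longleftrightarrow> fclosed n (ext F) \<and> (\<forall>G. fclosed n (ext G) \<longrightarrow> ext F \<subseteq> ext G)"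

definition isP :: "'a \<Rightarrow> 'a \<Rightarrow> 'a \<Rightarrow> bool" where
  "isP n A P \<longleftrightarrow> ext P = {s. isfunto s n A}"

definition isupd :: "'a \<Rightarrow> 'a \<Rightarrow> 'a \<Rightarrow> 'a \<Rightarrow> 'a \<Rightarrow> bool" where
  "isupd n t s i a \<longleftrightarrow> opair i a \<in> ext t \<and>
     (\<forall>j\<in>ext n. j \<noteq> i \<longrightarrow> (\<forall>x. opair j x \<in> ext t \<longleftrightarrow> opair j x \<in> ext s))"

definition tarski :: "'a \<Rightarrow> 'a \<Rightarrow> 'a \<Rightarrow> 'a \<Rightarrow> 'a \<Rightarrow> bool" where
  "tarski n A F P S \<longleftrightarrow> (\<forall>z\<in>ext S. \<exists>c\<in>ext F. \<exists>s\<in>ext P. z = opair c s) \<and>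
     (\<forall>s\<in>ext P.
       (\<forall>i\<in>ext n. \<forall>j\<in>ext n. opair (code 0 i j) s \<in> ext S \<longleftrightarrow>
          (\<exists>x y. opair i x \<in> ext s \<and> opair j y \<in> ext s \<and> x \<in> ext y)) \<and>
       (\<forall>i\<in>ext n. \<forall>j\<in>ext n. opair (code 1 i j) s \<in> ext S \<longleftrightarrow>
          (\<exists>x. opair i x \<in> ext s \<and> opair j x \<in> ext s)) \<and>
       (\<forall>d\<in>ext F. \<forall>c\<in>ext F. opair (code 2 d c) s \<in> ext S \<longleftrightarrow>
          \<not> (opair d s \<in> ext S \<and> opair c s \<in> ext S)) \<and>
       (\<forall>i\<in>ext n. \<forall>d\<in>ext F. opair (code 3 i d) s \<in> ext S \<longleftrightarrow>
          (\<forall>a\<in>ext A. \<forall>t\<in>ext P. isupd n t s i a \<longrightarrow> opair d t \<in> ext S)))"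

definition issat :: "'a \<Rightarrow> 'a \<Rightarrow> 'a \<Rightarrow> 'a \<Rightarrow> 'a \<Rightarrow> bool" where
  "issat n A F P S \<longleftrightarrow> isF n F \<and> isP n A P \<and> tarski n A F P S"

definition sat1 :: "'a \<Rightarrow> 'a \<Rightarrow> 'a \<Rightarrow> 'a \<Rightarrow> 'a \<Rightarrow> 'a \<Rightarrow> bool" where
  "sat1 P S c n s x \<longleftrightarrow> (\<exists>t\<in>ext P. ext s \<subseteq> ext t \<and> opair n x \<in> ext t \<and> opair c t \<in> ext S)"

definition sat2 :: "'a \<Rightarrow> 'a \<Rightarrow> 'a \<Rightarrow> 'a \<Rightarrow> 'a \<Rightarrow> 'a \<Rightarrow> 'a \<Rightarrow> bool" where
  "sat2 P S c n s x y \<longleftrightarrow> (\<exists>t\<in>ext P. ext s \<subseteq> ext t \<and> opair n x \<in> ext t \<and>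
     opair (succ n) y \<in> ext t \<and> opair c t \<in> ext S)"

lemma holds_Tr [simp]: "x < n \<Longrightarrow> holdsE UNIV e r n (Tr x) \<longleftrightarrow> transv (r x)"
  unfolding Tr_def transv_def by auto

lemma holds_Ord [simp]: "x < n \<Longrightarrow> holdsE UNIV e r n (Ord x) \<longleftrightarrow> isord (r x)"
  unfolding Ord_def isord_def linear_def by (simp add: Ball_def Bex_def)

lemma holds_is_omega [simp]: "x < n \<Longrightarrow> holdsE UNIV e r n (is_omega x) \<longleftrightarrow> isomega (r x)"
  unfolding is_omega_def isomega_def by auto

lemma holds_is_num [simp]: "x < n \<Longrightarrow> holdsE UNIV e r n (is_num k x) \<longleftrightarrow> r x = num k"
  by (induction k arbitrary: x n r) auto

lemma holds_is_code [simp]: "c < n \<Longrightarrow> x < n \<Longrightarrow> y < n \<Longrightarrow>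
    holdsE UNIV e r n (is_code k c x y) \<longleftrightarrow> r c = code k (r x) (r y)"
  unfolding is_code_def code_def by auto

lemma holds_closed_under_formation [simp]: "x < n \<Longrightarrow> y < n \<Longrightarrow>
    holdsE UNIV e r n (closed_under_formation x y) \<longleftrightarrow> fclosed (r x) (ext (r y))"
  unfolding closed_under_formation_def fclosed_def by auto

lemma holds_is_formulas [simp]: "x < n \<Longrightarrow> y < n \<Longrightarrow>
    holdsE UNIV e r n (is_formulas x y) \<longleftrightarrow> isF (r x) (r y)"
  unfolding is_formulas_def isF_def by auto

lemma holds_is_assignments [simp]: "x < n \<Longrightarrow> y < n \<Longrightarrow> p < n \<Longrightarrow>
    holdsE UNIV e r n (is_assignments x y p) \<longleftrightarrow> isP (r x) (r y) (r p)"
  unfolding is_assignments_def isP_def by auto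

lemma holds_is_update [simp]: "x < n \<Longrightarrow> t < n \<Longrightarrow> s < n \<Longrightarrow> i < n \<Longrightarrow> a < n \<Longrightarrow>
    holdsE UNIV e r n (is_update x t s i a) \<longleftrightarrow> isupd (r x) (r t) (r s) (r i) (r a)"
  unfolding is_update_def isupd_def by (simp add: Ball_def)

lemma holds_is_sat [simp]: "x < n \<Longrightarrow> A < n \<Longrightarrow> F < n \<Longrightarrow> P < n \<Longrightarrow> S < n \<Longrightarrow>
    holdsE UNIV e r n (is_sat x A F P S) \<longleftrightarrow> issat (r x) (r A) (r F) (r P) (r S)"
  unfolding is_sat_def issat_def tarski_def by (simp add: Ball_def Bex_def)

lemma holds_holds1 [simp]: "P < n \<Longrightarrow> S < n \<Longrightarrow> c < n \<Longrightarrow> k < n \<Longrightarrow> s < n \<Longrightarrow> x < n \<Longrightarrow>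
    holdsE UNIV e r n (holds1 P S c k s x) \<longleftrightarrow> sat1 (r P) (r S) (r c) (r k) (r s) (r x)"
  unfolding holds1_def sat1_def by auto

lemma holds_holds2: "P < n \<Longrightarrow> S < n \<Longrightarrow> c < n \<Longrightarrow> k < n \<Longrightarrow> s < n \<Longrightarrow> x < n \<Longrightarrow> m < n \<Longrightarrow> y < n \<Longrightarrow>
    r m = succ (r k) \<Longrightarrow>
    holdsE UNIV e r n (holds2 P S c k m s x y) \<longleftrightarrow> sat2 (r P) (r S) (r c) (r k) (r s) (r x) (r y)"
  unfolding holds2_def sat2_def by auto

definition defin :: "'a \<Rightarrow> 'a \<Rightarrow> bool" where
  "defin A X \<longleftrightarrow> (\<exists>w. isomega w \<and> (\<exists>n\<in>ext w. succ n \<in> ext w \<and> (\<exists>F P S. issat (succ n) A F P S \<and>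
     (\<exists>c\<in>ext F. \<exists>s. isfunto s n A \<and> ext X = {x \<in> ext A. sat1 P S c n s x}))))"

lemma holds_definable [simp]: "A < n \<Longrightarrow> X < n \<Longrightarrow>
    holdsE UNIV e r n (definable A X) \<longleftrightarrow> defin (r A) (r X)"
  unfolding definable_def defin_def by (simp add: set_eq_iff) blast

lemma holds_is_Def [simp]: "A < n \<Longrightarrow> D < n \<Longrightarrow>
    holdsE UNIV e r n (is_Def A D) \<longleftrightarrow> ext (r D) = {X. defin (r A) X}"
  unfolding is_Def_def by auto

definition isLseq :: "'a \<Rightarrow> 'a \<Rightarrow> bool" where
  "isLseq f a \<longleftrightarrow> isfun f (succ a) \<and> (\<forall>b\<in>ext (succ a). \<forall>y. opair b y \<in> ext f \<longrightarrow>
     (b = emp \<longrightarrow> y = emp) \<and>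
     (\<forall>c\<in>ext b. b = succ c \<longrightarrow> (\<forall>z. opair c z \<in> ext f \<longrightarrow> ext y = {X. defin z X})) \<and>
     (b \<noteq> emp \<and> \<not> (\<exists>c\<in>ext b. b = succ c) \<longrightarrow>
        (\<forall>x. x \<in> ext y \<longleftrightarrow> (\<exists>c\<in>ext b. \<exists>z. opair c z \<in> ext f \<and> x \<in> ext z))))"

lemma holds_is_L_sequence [simp]: "f < n \<Longrightarrow> a < n \<Longrightarrow>
    holdsE UNIV e r n (is_L_sequence f a) \<longleftrightarrow> isLseq (r f) (r a)"
  unfolding is_L_sequence_def isLseq_def by (simp add: Ball_def Bex_def)

lemma holds_in_L [simp]: "a < n \<Longrightarrow> x < n \<Longrightarrow>
    holdsE UNIV e r n (in_L a x) \<longleftrightarrow> (\<exists>f y. isLseq f (r a) \<and> opair (r a) y \<in> ext f \<and> r x \<in> ext y)"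
  unfolding in_L_def by auto

end

section \<open>Internal codes of standard formulas\<close>

locale regular = pair_union +
  assumes regularity: "ext a \<noteq> {} \<Longrightarrow> \<exists>y\<in>ext a. \<forall>z\<in>ext a. z \<notin> ext y"
begin

lemma mem_asym: "x \<in> ext y \<Longrightarrow> y \<notin> ext x"
  using regularity[of "upair x y"] by auto

lemma mem_irrefl [simp]: "x \<notin> ext x"
  using mem_asym by blast

lemma succ_inject [simp]: "succ x = succ y \<longleftrightarrow> x = y"
  by (metis eq_succ_iff ext_succ insert_iff mem_asym)

lemma ext_num: "ext (num k) = num ` {..<k}"
  by (induction k) (auto simp: lessThan_Suc)

lemma num_inject [simp]: "num i = num j \<longleftrightarrow> i = j"
  by (metis ext_num imageI lessThan_iff mem_irrefl nat_neq_iff)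

lemma code_inject [simp]: "code k x y = code l u v \<longleftrightarrow> k = l \<and> x = u \<and> y = v"
  by (simp add: code_def)

definition join :: "'a \<Rightarrow> 'a \<Rightarrow> 'a" where "join a b = Uni (upair a b)"

lemma ext_join [simp]: "ext (join a b) = ext a \<union> ext b"
  by (simp add: join_def)

lemma emp_in_omega: "isomega w \<Longrightarrow> emp \<in> ext w"
proof -
  assume w: "isomega w"
  then have "ext w \<noteq> {}" by (metis eq_emp_iff isomega_def)
  then obtain m where m: "m \<in> ext w" "\<forall>z\<in>ext w. z \<notin> ext m" using regularity by blast
  then have "m = emp" using w by (metis ext_succ insertI1 isomega_def)
  then show ?thesis using m by simp
qed

lemma num_in_omega: "isomega w \<Longrightarrow> num k \<in> ext w"
  by (induction k) (auto simp: emp_in_omega isomega_def)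

text \<open>The recursion runs in the metalanguage, so pairing and union alone produce this sequence
  of standard length.\<close>

primrec fin :: "(nat \<Rightarrow> 'a) \<Rightarrow> nat \<Rightarrow> 'a" where
  "fin g 0 = emp"
| "fin g (Suc m) = join (fin g m) (upair (opair (num m) (g m)) (opair (num m) (g m)))"

lemma ext_fin: "ext (fin g m) = (\<lambda>i. opair (num i) (g i)) ` {..<m}"
  by (induction m) (auto simp: lessThan_Suc)

lemma isfunto_fin: "(\<And>i. i < m \<Longrightarrow> g i \<in> ext A) \<Longrightarrow> isfunto (fin g m) (num m) A"
  unfolding isfunto_def isfun_def by (auto simp: ext_fin ext_num)

lemma isfunto_eq_fin:
  assumes t: "isfunto t (num m) A" and g: "\<And>i. i < m \<Longrightarrow> opair (num i) (g i) \<in> ext t"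
  shows "t = fin g m"
proof (rule extensional, rule set_eqI)
  fix p
  have "p \<in> ext t \<longleftrightarrow> (\<exists>i<m. p = opair (num i) (g i))"
  proof
    assume p: "p \<in> ext t"
    then obtain x y where xy: "x \<in> ext (num m)" "p = opair x y"
      using t unfolding isfunto_def isfun_def by blast
    then obtain i where i: "i < m" "x = num i" by (auto simp: ext_num)
    then have "y = g i" using t p xy g[OF i(1)] unfolding isfunto_def isfun_def by metis
    then show "\<exists>i<m. p = opair (num i) (g i)" using i xy by blast
  qed (use g in blast)
  then show "p \<in> ext t \<longleftrightarrow> p \<in> ext (fin g m)" by (auto simp: ext_fin)
qed

text \<open>Counts the internal variables that a code needs for its quantifiers: a nested quantifier
  takes a new one, while the two sides of an implication share theirs.\<close>

primrec depth :: "fm \<Rightarrow> nat" where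
  "depth Falsum = 0"
| "depth (Member i j) = 0"
| "depth (Equal i j) = 0"
| "depth (Implies p q) = max (depth p) (depth q)"
| "depth (Forall p) = Suc (depth p)"

lemma
  assumes "issat n A F P S"
  shows issat_F0: "i \<in> ext n \<Longrightarrow> j \<in> ext n \<Longrightarrow> code 0 i j \<in> ext F"
    and issat_F1: "i \<in> ext n \<Longrightarrow> j \<in> ext n \<Longrightarrow> code 1 i j \<in> ext F"
    and issat_F2: "x \<in> ext F \<Longrightarrow> y \<in> ext F \<Longrightarrow> code 2 x y \<in> ext F"
    and issat_F3: "i \<in> ext n \<Longrightarrow> x \<in> ext F \<Longrightarrow> code 3 i x \<in> ext F"
    and issat_P: "t \<in> ext P \<longleftrightarrow> isfunto t n A"
    and issat_T0: "s \<in> ext P \<Longrightarrow> i \<in> ext n \<Longrightarrow> j \<in> ext n \<Longrightarrow> opair (code 0 i j) s \<in> ext S \<longleftrightarrow>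
          (\<exists>x y. opair i x \<in> ext s \<and> opair j y \<in> ext s \<and> x \<in> ext y)"
    and issat_T1: "s \<in> ext P \<Longrightarrow> i \<in> ext n \<Longrightarrow> j \<in> ext n \<Longrightarrow> opair (code 1 i j) s \<in> ext S \<longleftrightarrow>
          (\<exists>x. opair i x \<in> ext s \<and> opair j x \<in> ext s)"
    and issat_T2: "s \<in> ext P \<Longrightarrow> x \<in> ext F \<Longrightarrow> y \<in> ext F \<Longrightarrow> opair (code 2 x y) s \<in> ext S \<longleftrightarrow>
          \<not> (opair x s \<in> ext S \<and> opair y s \<in> ext S)"
    and issat_T3: "s \<in> ext P \<Longrightarrow> i \<in> ext n \<Longrightarrow> x \<in> ext F \<Longrightarrow> opair (code 3 i x) s \<in> ext S \<longleftrightarrow>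
          (\<forall>a\<in>ext A. \<forall>t\<in>ext P. isupd n t s i a \<longrightarrow> opair x t \<in> ext S)"
proof -
  have F: "fclosed n (ext F)" and P: "isP n A P" and T: "tarski n A F P S"
    using assms unfolding issat_def isF_def by blast+
  show "i \<in> ext n \<Longrightarrow> j \<in> ext n \<Longrightarrow> code 0 i j \<in> ext F"
    and "i \<in> ext n \<Longrightarrow> j \<in> ext n \<Longrightarrow> code 1 i j \<in> ext F"
    and "x \<in> ext F \<Longrightarrow> y \<in> ext F \<Longrightarrow> code 2 x y \<in> ext F"
    and "i \<in> ext n \<Longrightarrow> x \<in> ext F \<Longrightarrow> code 3 i x \<in> ext F"
    using F unfolding fclosed_def by simp_all
  show "t \<in> ext P \<longleftrightarrow> isfunto t n A" using P unfolding isP_def by simp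
  show "s \<in> ext P \<Longrightarrow> i \<in> ext n \<Longrightarrow> j \<in> ext n \<Longrightarrow> opair (code 0 i j) s \<in> ext S \<longleftrightarrow>
          (\<exists>x y. opair i x \<in> ext s \<and> opair j y \<in> ext s \<and> x \<in> ext y)"
    and "s \<in> ext P \<Longrightarrow> i \<in> ext n \<Longrightarrow> j \<in> ext n \<Longrightarrow> opair (code 1 i j) s \<in> ext S \<longleftrightarrow>
          (\<exists>x. opair i x \<in> ext s \<and> opair j x \<in> ext s)"
    and "s \<in> ext P \<Longrightarrow> x \<in> ext F \<Longrightarrow> y \<in> ext F \<Longrightarrow> opair (code 2 x y) s \<in> ext S \<longleftrightarrow>
          \<not> (opair x s \<in> ext S \<and> opair y s \<in> ext S)"
    and "s \<in> ext P \<Longrightarrow> i \<in> ext n \<Longrightarrow> x \<in> ext F \<Longrightarrow> opair (code 3 i x) s \<in> ext S \<longleftrightarrow>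
          (\<forall>a\<in>ext A. \<forall>t\<in>ext P. isupd n t s i a \<longrightarrow> opair x t \<in> ext S)"
    using T unfolding tarski_def by simp_all
qed

text \<open>The indices \<open>k, \<dots>, n - 1\<close> are the variables kept free for the quantifiers of \<open>p\<close>.\<close>

lemma code_exists:
  assumes S: "issat (num m) M F P S" and nm: "n < m"
  shows "k + depth p \<le> n \<Longrightarrow> (\<And>i. \<sigma> i < k \<or> n \<le> \<sigma> i \<and> \<sigma> i < m) \<Longrightarrow>
    \<exists>c\<in>ext F. \<forall>g. (\<forall>i<m. g i \<in> ext M) \<longrightarrow>
      (opair c (fin g m) \<in> ext S \<longleftrightarrow> sat (ext M) E (\<lambda>i. g (\<sigma> i)) p)"
proof (induction p arbitrary: k \<sigma>)
  case Falsum
  have P: "fin g m \<in> ext P" if "\<forall>i<m. g i \<in> ext M" for g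
    using that isfunto_fin by (simp add: issat_P[OF S])
  have z: "num 0 \<in> ext (num m)" using nm by (auto simp: ext_num simp del: num.simps)
  \<comment> \<open>\<open>?d\<close> codes \<open>v_0 = v_0\<close>, so the code of its negated
    conjunction with itself serves as falsity.\<close>
  let ?d = "code 1 (num 0) (num 0)"
  have d: "?d \<in> ext F" "code 2 ?d ?d \<in> ext F"
    using z issat_F1[OF S] issat_F2[OF S] by blast+
  have "opair (num 0) (g 0) \<in> ext (fin g m)" for g using nm by (auto simp: ext_fin simp del: num.simps)
  then have "opair ?d (fin g m) \<in> ext S" if "\<forall>i<m. g i \<in> ext M" for g
    using z P[OF that] issat_T1[OF S] by blast
  then have "opair (code 2 ?d ?d) (fin g m) \<notin> ext S" if "\<forall>i<m. g i \<in> ext M" for g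
    using d P[OF that] that issat_T2[OF S] by blast
  then show ?case using d by auto
next
  case (Member i j)
  have lt: "\<sigma> l < m" for l using Member(2)[of l] Member(1) nm by auto
  have z: "num (\<sigma> l) \<in> ext (num m)" for l using lt by (auto simp: ext_num simp del: num.simps)
  have *: "opair (num (\<sigma> l)) x \<in> ext (fin g m) \<longleftrightarrow> x = g (\<sigma> l)" for g l x
    using lt by (auto simp: ext_fin)
  have "opair (code 0 (num (\<sigma> i)) (num (\<sigma> j))) (fin g m) \<in> ext S \<longleftrightarrow> g (\<sigma> i) \<in> ext (g (\<sigma> j))"
    if "\<forall>i<m. g i \<in> ext M" for g
  proof -
    have "fin g m \<in> ext P" using that isfunto_fin by (simp add: issat_P[OF S])
    then show ?thesis using z * by (simp add: issat_T0[OF S] issat_T1[OF S] del: One_nat_def)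
  qed
  moreover have "code 0 (num (\<sigma> i)) (num (\<sigma> j)) \<in> ext F"
    using z issat_F0[OF S] issat_F1[OF S] by blast
  ultimately show ?case by (auto simp: ext_def)
next
  case (Equal i j)
  have lt: "\<sigma> l < m" for l using Equal(2)[of l] Equal(1) nm by auto
  have z: "num (\<sigma> l) \<in> ext (num m)" for l using lt by (auto simp: ext_num simp del: num.simps)
  have *: "opair (num (\<sigma> l)) x \<in> ext (fin g m) \<longleftrightarrow> x = g (\<sigma> l)" for g l x
    using lt by (auto simp: ext_fin)
  have "opair (code 1 (num (\<sigma> i)) (num (\<sigma> j))) (fin g m) \<in> ext S \<longleftrightarrow> g (\<sigma> i) = g (\<sigma> j)"
    if "\<forall>i<m. g i \<in> ext M" for g
  proof -
    have "fin g m \<in> ext P" using that isfunto_fin by (simp add: issat_P[OF S])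
    then show ?thesis using z * by (simp add: issat_T0[OF S] issat_T1[OF S] del: One_nat_def)
  qed
  moreover have "code 1 (num (\<sigma> i)) (num (\<sigma> j)) \<in> ext F"
    using z issat_F0[OF S] issat_F1[OF S] by blast
  ultimately show ?case by auto
next
  case (Implies p q)
  have kp: "k + depth p \<le> n" "k + depth q \<le> n" using Implies.prems(1) by auto
  obtain c where c: "c \<in> ext F" "\<forall>g. (\<forall>i<m. g i \<in> ext M) \<longrightarrow>
      (opair c (fin g m) \<in> ext S \<longleftrightarrow> sat (ext M) E (\<lambda>i. g (\<sigma> i)) p)"
    using Implies.IH(1)[of k \<sigma>, OF kp(1) Implies.prems(2)] by (elim bexE) (rule that)
  obtain d where d: "d \<in> ext F" "\<forall>g. (\<forall>i<m. g i \<in> ext M) \<longrightarrow>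
      (opair d (fin g m) \<in> ext S \<longleftrightarrow> sat (ext M) E (\<lambda>i. g (\<sigma> i)) q)"
    using Implies.IH(2)[of k \<sigma>, OF kp(2) Implies.prems(2)] by (elim bexE) (rule that)
  \<comment> \<open>With negated conjunction as the only connective, the implication from
    \<open>c\<close> to \<open>d\<close> is the negation of \<open>c\<close> and not
    (\<open>d\<close> and \<open>d\<close>).\<close>
  have F: "code 2 d d \<in> ext F" "code 2 c (code 2 d d) \<in> ext F"
    using c(1) d(1) issat_F2[OF S] by blast+
  have "opair (code 2 c (code 2 d d)) (fin g m) \<in> ext S \<longleftrightarrow>
      (opair c (fin g m) \<in> ext S \<longrightarrow> opair d (fin g m) \<in> ext S)" if "\<forall>i<m. g i \<in> ext M" for g
  proof -
    have "fin g m \<in> ext P" using that isfunto_fin by (simp add: issat_P[OF S])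
    then have "opair (code 2 x y) (fin g m) \<in> ext S \<longleftrightarrow>
        \<not> (opair x (fin g m) \<in> ext S \<and> opair y (fin g m) \<in> ext S)" if "x \<in> ext F" "y \<in> ext F" for x y
      using that issat_T2[OF S] by blast
    then show ?thesis using c(1) d(1) F by simp
  qed
  then show ?case using c d F by (intro bexI[of _ "code 2 c (code 2 d d)"]) auto
next
  case (Forall p)
  \<comment> \<open>The bound variable is stored in \<open>v_k\<close>, and \<open>k\<close> is
    raised for the body, so an inner quantifier never overwrites it.\<close>
  obtain c where c: "c \<in> ext F" "\<And>g. (\<forall>i<m. g i \<in> ext M) \<Longrightarrow>
      (opair c (fin g m) \<in> ext S \<longleftrightarrow> sat (ext M) E (\<lambda>i. g (case_nat k \<sigma> i)) p)"
  proof -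
    have "\<exists>c\<in>ext F. \<forall>g. (\<forall>i<m. g i \<in> ext M) \<longrightarrow>
      (opair c (fin g m) \<in> ext S \<longleftrightarrow> sat (ext M) E (\<lambda>i. g (case_nat k \<sigma> i)) p)"
    proof (rule Forall.IH[of "Suc k"])
      show "Suc k + depth p \<le> n" using Forall.prems by simp
      show "case_nat k \<sigma> i < Suc k \<or> n \<le> case_nat k \<sigma> i \<and> case_nat k \<sigma> i < m" for i
        using Forall.prems(2)[of "i - 1"] by (cases i) auto
    qed
    then show thesis using that by blast
  qed
  have km: "k < m" "k < n" using Forall.prems nm by auto
  then have z: "num k \<in> ext (num m)" by (auto simp: ext_num simp del: num.simps)
  have F: "code 3 (num k) c \<in> ext F"
    using c(1) z issat_F3[OF S] by blast
  have "opair (code 3 (num k) c) (fin g m) \<in> ext S \<longleftrightarrow> sat (ext M) E (\<lambda>i. g (\<sigma> i)) (Forall p)"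
    if g: "\<forall>i<m. g i \<in> ext M" for g
  proof -
    have ga: "\<forall>i<m. (g(k := a)) i \<in> ext M" if "a \<in> ext M" for a using g that by auto
    have P: "fin g m \<in> ext P" "\<And>a. a \<in> ext M \<Longrightarrow> fin (g(k := a)) m \<in> ext P"
      using g ga isfunto_fin by (simp_all add: issat_P[OF S] del: fun_upd_apply)
    have upd: "isupd (num m) t (fin g m) (num k) a \<longleftrightarrow> t = fin (g(k := a)) m"
      if "t \<in> ext P" for t a
    proof
      assume u: "isupd (num m) t (fin g m) (num k) a"
      show "t = fin (g(k := a)) m"
      proof (rule isfunto_eq_fin)
        show "isfunto t (num m) M" using that by (simp add: issat_P[OF S])
        fix i assume "i < m"
        then show "opair (num i) ((g(k := a)) i) \<in> ext t"
          using u unfolding isupd_def by (auto simp: ext_fin ext_num)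
      qed
    next
      assume t: "t = fin (g(k := a)) m"
      have "opair (num k) a \<in> ext t" using km unfolding t ext_fin by force
      moreover have "opair (num i) x \<in> ext t \<longleftrightarrow> opair (num i) x \<in> ext (fin g m)" if "i \<noteq> k" for i x
        using that unfolding t ext_fin by auto
      ultimately show "isupd (num m) t (fin g m) (num k) a"
        unfolding isupd_def by (auto simp: ext_num)
    qed
    have "opair (code 3 (num k) c) (fin g m) \<in> ext S \<longleftrightarrow>
        (\<forall>a\<in>ext M. \<forall>t\<in>ext P. isupd (num m) t (fin g m) (num k) a \<longrightarrow> opair c t \<in> ext S)"
      using z c(1) P(1) issat_T3[OF S] by blast
    also have "\<dots> \<longleftrightarrow> (\<forall>a\<in>ext M. opair c (fin (g(k := a)) m) \<in> ext S)"
      using upd P(2) by (metis (full_types))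
    also have "\<dots> \<longleftrightarrow> (\<forall>a\<in>ext M. sat (ext M) E (\<lambda>i. (g(k := a)) (case_nat k \<sigma> i)) p)"
    proof (rule ball_cong[OF refl])
      fix a assume "a \<in> ext M"
      show "(opair c (fin (g(k := a)) m) \<in> ext S) =
          sat (ext M) E (\<lambda>i. (g(k := a)) (case_nat k \<sigma> i)) p"
        by (rule c(2)[of "g(k := a)", OF ga[OF \<open>a \<in> ext M\<close>]])
    qed
    also have "\<dots> \<longleftrightarrow> (\<forall>a\<in>ext M. sat (ext M) E (case_nat a (\<lambda>i. g (\<sigma> i))) p)"
    proof -
      \<comment> \<open>Free variables sit below \<open>k\<close> or from \<open>n\<close> on, hence
        changing \<open>v_k\<close> affects none of them.\<close>
      have "\<sigma> i \<noteq> k" for i using Forall.prems(2)[of i] km by auto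
      then have "(\<lambda>i. (g(k := a)) (case_nat k \<sigma> i)) = case_nat a (\<lambda>i. g (\<sigma> i))" for a
        by (auto split: nat.split)
      then show ?thesis by simp
    qed
    finally show ?thesis by simp
  qed
  then show ?case using F by blast
qed

section \<open>The schemata of a model applied to formulas of the metalanguage\<close>

lemma fv_bound: "\<exists>K. \<forall>i\<in>fv p. i < K"
  using finite_fv[of p] by (metis bounded_nat_set_is_finite finite_nat_set_iff_bounded)

definition sep_holds :: "'a \<Rightarrow> bool" where
  "sep_holds M \<longleftrightarrow> (\<exists>w. isomega w \<and> (\<forall>n\<in>ext w. succ n \<in> ext w \<longrightarrow>
     (\<exists>F P S. issat (succ n) M F P S \<and> (\<forall>c\<in>ext F. \<forall>s. isfunto s n M \<longrightarrow>
       (\<forall>a\<in>ext M. \<exists>b\<in>ext M. \<forall>x\<in>ext M. x \<in> ext b \<longleftrightarrow> x \<in> ext a \<and> sat1 P S c n s x)))))"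

definition repl_holds :: "'a \<Rightarrow> bool" where
  "repl_holds M \<longleftrightarrow> (\<exists>w. isomega w \<and> (\<forall>n\<in>ext w. succ n \<in> ext w \<and> succ (succ n) \<in> ext w \<longrightarrow>
     (\<exists>F P S. issat (succ (succ n)) M F P S \<and> (\<forall>c\<in>ext F. \<forall>s. isfunto s n M \<longrightarrow>
       (\<forall>a\<in>ext M. (\<forall>x\<in>ext M. x \<in> ext a \<longrightarrow> (\<forall>y\<in>ext M. \<forall>z\<in>ext M.
           sat2 P S c n s x y \<and> sat2 P S c n s x z \<longrightarrow> y = z)) \<longrightarrow>
         (\<exists>b\<in>ext M. \<forall>y\<in>ext M. y \<in> ext b \<longleftrightarrow> (\<exists>x\<in>ext M. x \<in> ext a \<and> sat2 P S c n s x y)))))))"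

lemma holds_sat_separation: "A < n \<Longrightarrow> holdsE UNIV e r n (sat_separation A) \<longleftrightarrow> sep_holds (r A)"
  unfolding sat_separation_def sep_holds_def by (simp add: Ball_def Bex_def)

lemma holds_sat_replacement: "A < n \<Longrightarrow> holdsE UNIV e r n (sat_replacement A) \<longleftrightarrow> repl_holds (r A)"
  unfolding sat_replacement_def repl_holds_def
  by (simp add: Ball_def Bex_def holds_holds2 cong: conj_cong imp_cong) blast

text \<open>The internal schema holds for all codes, and \<open>code_exists\<close> supplies one for
  \<open>p\<close>. It is applied at a standard length \<open>n\<close>: the parameters form the
  sequence \<open>fin e n\<close>, and the element under test is \<open>v_n\<close>.\<close>

lemma fm_separation:
  assumes M: "sep_holds M" "transv M" and e: "\<forall>i. e i \<in> ext M" and a: "a \<in> ext M"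
  shows "\<exists>b\<in>ext M. ext b = {x \<in> ext a. sat (ext M) E (case_nat x e) p}"
proof -
  obtain K where K: "\<forall>i\<in>fv p. i < K" using fv_bound by blast
  \<comment> \<open>The variables up to \<open>v_K\<close> are set aside for parameters, the next
    \<open>depth p\<close> ones for the quantifiers of \<open>p\<close>.\<close>
  define n where "n = Suc K + depth p"
  \<comment> \<open>Index 0 of \<open>p\<close> is the tested element, and index \<open>i\<close>
    with \<open>0 < i < K\<close> is the parameter \<open>e (i - 1)\<close>. Indices from
    \<open>K\<close> on do not occur in \<open>p\<close>; the dummy value 0 keeps them in
    range.\<close>
  define \<sigma> where "\<sigma> i = (if i = 0 then n else if i < K then i - 1 else 0)" for i
  obtain F P S where S: "issat (num (Suc n)) M F P S" and
    sep: "\<And>c s. c \<in> ext F \<Longrightarrow> isfunto s (num n) M \<Longrightarrow>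
       \<exists>b\<in>ext M. \<forall>x\<in>ext M. x \<in> ext b \<longleftrightarrow> x \<in> ext a \<and> sat1 P S c (num n) s x"
    using M(1) a num_in_omega[of _ n] num_in_omega[of _ "Suc n"] unfolding sep_holds_def
    by (metis num.simps(2))
  have "\<exists>c\<in>ext F. \<forall>g. (\<forall>i<Suc n. g i \<in> ext M) \<longrightarrow>
      (opair c (fin g (Suc n)) \<in> ext S \<longleftrightarrow> sat (ext M) E (\<lambda>i. g (\<sigma> i)) p)"
    by (rule code_exists[OF S, of n "Suc K"]) (auto simp: n_def \<sigma>_def)
  then obtain c where c: "c \<in> ext F" "\<And>g. (\<forall>i<Suc n. g i \<in> ext M) \<Longrightarrow>
      (opair c (fin g (Suc n)) \<in> ext S \<longleftrightarrow> sat (ext M) E (\<lambda>i. g (\<sigma> i)) p)" by blast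
  have s: "isfunto (fin e n) (num n) M" using e isfunto_fin by blast
  have *: "sat1 P S c (num n) (fin e n) x \<longleftrightarrow> sat (ext M) E (case_nat x e) p" if x: "x \<in> ext M" for x
  proof -
    define g where "g = e(n := x)"
    have g: "\<forall>i<Suc n. g i \<in> ext M" using e x by (simp add: g_def)
    have P: "t \<in> ext P \<longleftrightarrow> isfunto t (num (Suc n)) M" for t
      by (rule issat_P[OF S])
    \<comment> \<open>\<open>sat1\<close> asks for some assignment extending the parameters; its
      length \<open>n + 1\<close> leaves exactly one with \<open>x\<close> at
      \<open>n\<close>.\<close>
    have "t \<in> ext P \<and> ext (fin e n) \<subseteq> ext t \<and> opair (num n) x \<in> ext t \<longleftrightarrow> t = fin g (Suc n)" for t
    proof
      assume t: "t \<in> ext P \<and> ext (fin e n) \<subseteq> ext t \<and> opair (num n) x \<in> ext t"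
      show "t = fin g (Suc n)"
        by (rule isfunto_eq_fin[of _ _ M]) (use t in \<open>auto simp: P g_def ext_fin image_subset_iff less_Suc_eq\<close>)
    next
      assume t: "t = fin g (Suc n)"
      have "ext (fin e n) \<subseteq> ext t" unfolding t ext_fin by (force simp: g_def)
      moreover have "opair (num n) (g n) \<in> ext t"
        unfolding t ext_fin by (intro image_eqI[of _ _ n]) simp_all
      ultimately show "t \<in> ext P \<and> ext (fin e n) \<subseteq> ext t \<and> opair (num n) x \<in> ext t"
        using g isfunto_fin[of "Suc n" g M] t unfolding P by (simp add: g_def)
    qed
    then have "sat1 P S c (num n) (fin e n) x \<longleftrightarrow> opair c (fin g (Suc n)) \<in> ext S"
      unfolding sat1_def by metis
    also have "\<dots> \<longleftrightarrow> sat (ext M) E (\<lambda>i. g (\<sigma> i)) p" using c(2) g by blast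
    also have "\<dots> \<longleftrightarrow> sat (ext M) E (case_nat x e) p"
      by (rule sat_fv_cong) (use K in \<open>auto simp: g_def \<sigma>_def n_def split: nat.split\<close>)
    finally show ?thesis .
  qed
  obtain b where b: "b \<in> ext M" "\<forall>x\<in>ext M. x \<in> ext b \<longleftrightarrow> x \<in> ext a \<and> sat1 P S c (num n) (fin e n) x"
    using sep[OF c(1) s] by blast
  have "ext a \<subseteq> ext M" "ext b \<subseteq> ext M" using a b(1) M(2) unfolding transv_def by blast+
  then have "ext b = {x \<in> ext a. sat (ext M) E (case_nat x e) p}"
    using b(2) by (auto simp: *)
  then show ?thesis using b(1) by blast
qed

lemma fm_replacement:
  assumes M: "repl_holds M" "transv M" and e: "\<forall>i. e i \<in> ext M" and a: "a \<in> ext M"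
    and fn: "\<And>x y z. x \<in> ext a \<Longrightarrow> y \<in> ext M \<Longrightarrow> z \<in> ext M \<Longrightarrow>
      sat (ext M) E (case_nat y (case_nat x e)) p \<Longrightarrow> sat (ext M) E (case_nat z (case_nat x e)) p \<Longrightarrow> y = z"
  shows "\<exists>b\<in>ext M. ext b = {y \<in> ext M. \<exists>x\<in>ext a. sat (ext M) E (case_nat y (case_nat x e)) p}"
proof -
  obtain K where K: "\<forall>i\<in>fv p. i < K" using fv_bound by blast
  define n where "n = Suc K + depth p"
  \<comment> \<open>Index 0 is the value \<open>y\<close>, stored in the last variable; index 1 is
    the argument \<open>x\<close> in \<open>v_n\<close>; the parameters move down by two.\<close>
  define \<sigma> where "\<sigma> i = (if i = 0 then Suc n else if i = 1 then n else if i < K then i - 2 else 0)" for i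
  obtain w where w: "isomega w" and *: "\<forall>n\<in>ext w. succ n \<in> ext w \<and> succ (succ n) \<in> ext w \<longrightarrow>
     (\<exists>F P S. issat (succ (succ n)) M F P S \<and> (\<forall>c\<in>ext F. \<forall>s. isfunto s n M \<longrightarrow>
       (\<forall>a\<in>ext M. (\<forall>x\<in>ext M. x \<in> ext a \<longrightarrow> (\<forall>y\<in>ext M. \<forall>z\<in>ext M.
           sat2 P S c n s x y \<and> sat2 P S c n s x z \<longrightarrow> y = z)) \<longrightarrow>
         (\<exists>b\<in>ext M. \<forall>y\<in>ext M. y \<in> ext b \<longleftrightarrow> (\<exists>x\<in>ext M. x \<in> ext a \<and> sat2 P S c n s x y)))))"
    using M(1) unfolding repl_holds_def by (elim exE conjE)
  obtain F P S where S: "issat (num (Suc (Suc n))) M F P S" and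
    rep: "\<And>c s. c \<in> ext F \<Longrightarrow> isfunto s (num n) M \<Longrightarrow>
       (\<forall>x\<in>ext M. x \<in> ext a \<longrightarrow> (\<forall>y\<in>ext M. \<forall>z\<in>ext M.
           sat2 P S c (num n) s x y \<and> sat2 P S c (num n) s x z \<longrightarrow> y = z)) \<Longrightarrow>
         (\<exists>b\<in>ext M. \<forall>y\<in>ext M. y \<in> ext b \<longleftrightarrow> (\<exists>x\<in>ext M. x \<in> ext a \<and> sat2 P S c (num n) s x y))"
    using *[rule_format, of "num n"] num_in_omega[OF w, of n] num_in_omega[OF w, of "Suc n"]
      num_in_omega[OF w, of "Suc (Suc n)"] a by auto
  have "\<exists>c\<in>ext F. \<forall>g. (\<forall>i<Suc (Suc n). g i \<in> ext M) \<longrightarrow>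
      (opair c (fin g (Suc (Suc n))) \<in> ext S \<longleftrightarrow> sat (ext M) E (\<lambda>i. g (\<sigma> i)) p)"
    by (rule code_exists[OF S, of n "Suc K"]) (auto simp: n_def \<sigma>_def)
  then obtain c where c: "c \<in> ext F" "\<And>g. (\<forall>i<Suc (Suc n). g i \<in> ext M) \<Longrightarrow>
      (opair c (fin g (Suc (Suc n))) \<in> ext S \<longleftrightarrow> sat (ext M) E (\<lambda>i. g (\<sigma> i)) p)" by blast
  have s: "isfunto (fin e n) (num n) M" using e isfunto_fin by blast
  have *: "sat2 P S c (num n) (fin e n) x y \<longleftrightarrow> sat (ext M) E (case_nat y (case_nat x e)) p"
    if x: "x \<in> ext M" and y: "y \<in> ext M" for x y
  proof -
    define g where "g = e(n := x, Suc n := y)"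
    have g: "\<forall>i<Suc (Suc n). g i \<in> ext M" using e x y by (simp add: g_def)
    have P: "t \<in> ext P \<longleftrightarrow> isfunto t (num (Suc (Suc n))) M" for t
      by (rule issat_P[OF S])
    have "t \<in> ext P \<and> ext (fin e n) \<subseteq> ext t \<and> opair (num n) x \<in> ext t \<and>
        opair (num (Suc n)) y \<in> ext t \<longleftrightarrow> t = fin g (Suc (Suc n))" for t
    proof
      assume t: "t \<in> ext P \<and> ext (fin e n) \<subseteq> ext t \<and> opair (num n) x \<in> ext t \<and>
        opair (num (Suc n)) y \<in> ext t"
      show "t = fin g (Suc (Suc n))"
        by (rule isfunto_eq_fin[of _ _ M]) (use t in \<open>auto simp: P g_def ext_fin image_subset_iff less_Suc_eq\<close>)
    next
      assume t: "t = fin g (Suc (Suc n))"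
      have "ext (fin e n) \<subseteq> ext t" unfolding t ext_fin by (force simp: g_def)
      moreover have "opair (num i) (g i) \<in> ext t" if "i < Suc (Suc n)" for i
        unfolding t ext_fin using that by (intro image_eqI[of _ _ i]) simp_all
      from this[of n] this[of "Suc n"]
      have "opair (num n) (g n) \<in> ext t" "opair (num (Suc n)) (g (Suc n)) \<in> ext t"
        by simp_all
      ultimately show "t \<in> ext P \<and> ext (fin e n) \<subseteq> ext t \<and> opair (num n) x \<in> ext t \<and>
        opair (num (Suc n)) y \<in> ext t"
        using g isfunto_fin[of "Suc (Suc n)" g M] t unfolding P by (simp add: g_def)
    qed
    then have "sat2 P S c (num n) (fin e n) x y \<longleftrightarrow> opair c (fin g (Suc (Suc n))) \<in> ext S"
      unfolding sat2_def by (metis num.simps(2))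
    also have "\<dots> \<longleftrightarrow> sat (ext M) E (\<lambda>i. g (\<sigma> i)) p" using c(2) g by blast
    also have "\<dots> \<longleftrightarrow> sat (ext M) E (case_nat y (case_nat x e)) p"
      by (rule sat_fv_cong) (use K in \<open>auto simp: g_def \<sigma>_def n_def split: nat.split\<close>)
    finally show ?thesis .
  qed
  have aM: "x \<in> ext M" if "x \<in> ext a" for x using that a M(2) unfolding transv_def by blast
  have "\<exists>b\<in>ext M. \<forall>y\<in>ext M. y \<in> ext b \<longleftrightarrow> (\<exists>x\<in>ext M. x \<in> ext a \<and> sat2 P S c (num n) (fin e n) x y)"
  proof (rule rep[OF c(1) s], intro ballI impI)
    fix x y z
    assume "x \<in> ext M" "x \<in> ext a" "y \<in> ext M" "z \<in> ext M"
      "sat2 P S c (num n) (fin e n) x y \<and> sat2 P S c (num n) (fin e n) x z"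
    then show "y = z" using fn[of x y z] by (simp add: *)
  qed
  then obtain b where b: "b \<in> ext M" "\<forall>y\<in>ext M. y \<in> ext b \<longleftrightarrow>
      (\<exists>x\<in>ext M. x \<in> ext a \<and> sat2 P S c (num n) (fin e n) x y)" by blast
  have "ext b \<subseteq> ext M" using b(1) M(2) unfolding transv_def by blast
  then have "ext b = {y \<in> ext M. \<exists>x\<in>ext a. sat (ext M) E (case_nat y (case_nat x e)) p}"
    using b(2) aM by (auto simp: *)
  then show ?thesis using b(1) by blast
qed

end

section \<open>Definability over transitive models\<close>

text \<open>Arguments and parameters occupy disjoint infinite sets of indices, so neither list needs
  a bound and every rearrangement of them is a renaming.\<close>

definition mix :: "(nat \<Rightarrow> 'a) \<Rightarrow> (nat \<Rightarrow> 'a) \<Rightarrow> nat \<Rightarrow> 'a" where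
  "mix e c i = (if even i then e (i div 2) else c (i div 2))"

lemma mix_simps [simp]: "mix e c 0 = e 0" "mix e c (2 * i) = e i" "mix e c (Suc (2 * i)) = c i"
  by (simp_all add: mix_def)

text \<open>A quantifier shifts all indices by one, whereas a new argument in front of
  \<open>e\<close> shifts only the even ones, by two; this renaming mediates between both.\<close>

definition skip :: "nat \<Rightarrow> nat" where
  "skip j = (if j = 0 then 0 else if even j then j - 1 else j + 1)"

lemma mix_case_nat: "mix (case_nat x e) c = (\<lambda>j. case_nat x (mix e c) (skip j))"
proof
  fix j
  consider "j = 0" | i where "j = 2 * Suc i" | i where "j = Suc (2 * i)"
    by (metis evenE not0_implies_Suc oddE Suc_eq_plus1 mult_0_right)
  then show "mix (case_nat x e) c j = case_nat x (mix e c) (skip j)"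
    by cases (simp_all add: mix_def skip_def)
qed

context regular
begin

definition env :: "'a \<Rightarrow> (nat \<Rightarrow> 'a) set" where
  "env M = {e. \<forall>i. e i \<in> ext M}"

text \<open>Definability with parameters: the variables with odd index are interpreted by the parameters \<open>c\<close>.\<close>

definition dfn :: "'a \<Rightarrow> ((nat \<Rightarrow> 'a) \<Rightarrow> bool) \<Rightarrow> bool" where
  "dfn M P \<longleftrightarrow> (\<exists>p. \<exists>c\<in>env M. \<forall>e\<in>env M. P e \<longleftrightarrow> sat (ext M) E (mix e c) p)"

text \<open>Plays the role of a term. Index 0 of the graph is the value, so the arguments are read
  one place further on; totality on \<open>M\<close> permits substitution into definable
  predicates.\<close>

definition Fdef :: "'a \<Rightarrow> ((nat \<Rightarrow> 'a) \<Rightarrow> 'a) \<Rightarrow> bool" where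
  "Fdef M t \<longleftrightarrow> (\<forall>e\<in>env M. t e \<in> ext M) \<and> dfn M (\<lambda>e. e 0 = t (\<lambda>i. e (Suc i)))"

definition tmod :: "'a \<Rightarrow> bool" where
  "tmod M \<longleftrightarrow> transv M \<and> emp \<in> ext M \<and> (\<forall>x\<in>ext M. \<forall>y\<in>ext M. upair x y \<in> ext M) \<and>
     (\<forall>x\<in>ext M. Uni x \<in> ext M) \<and> (\<forall>x\<in>ext M. \<exists>y\<in>ext M. ext y = {z \<in> ext M. ext z \<subseteq> ext x}) \<and>
     (\<exists>x\<in>ext M. emp \<in> ext x \<and> (\<forall>y\<in>ext x. succ y \<in> ext x)) \<and>
     sep_holds M \<and> repl_holds M"

lemma case_nat_env: "x \<in> ext M \<Longrightarrow> e \<in> env M \<Longrightarrow> case_nat x e \<in> env M"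
  by (auto simp: env_def split: nat.split)

lemma Suc_env: "e \<in> env M \<Longrightarrow> (\<lambda>i. e (f i)) \<in> env M"
  by (auto simp: env_def)

lemma dfn_cong: "(\<And>e. e \<in> env M \<Longrightarrow> P e = Q e) \<Longrightarrow> dfn M Q \<Longrightarrow> dfn M P"
  unfolding dfn_def by metis

lemma dfn_imp:
  assumes "dfn M P" "dfn M Q"
  shows "dfn M (\<lambda>e. P e \<longrightarrow> Q e)"
proof -
  obtain p c where p: "c \<in> env M" "\<forall>e\<in>env M. P e \<longleftrightarrow> sat (ext M) E (mix e c) p"
    using assms(1) unfolding dfn_def by blast
  obtain q d where q: "d \<in> env M" "\<forall>e\<in>env M. Q e \<longleftrightarrow> sat (ext M) E (mix e d) q"
    using assms(2) unfolding dfn_def by blast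
  \<comment> \<open>The two parameter lists are interleaved: \<open>c\<close> moves to the indices
    \<open>4 * k + 1\<close> and \<open>d\<close> to the indices \<open>4 * k + 3\<close>.\<close>
  have 1: "mix e c = (\<lambda>i. mix e (mix c d) (if even i then i else 2 * i - 1))" for e
  proof
    fix i show "mix e c i = mix e (mix c d) (if even i then i else 2 * i - 1)"
    proof (cases "even i")
      case False
      then obtain k where k: "i = Suc (2 * k)" by (metis oddE Suc_eq_plus1)
      then have "2 * i - 1 = Suc (2 * (2 * k))" by simp
      then show ?thesis using False k by (simp only: mix_simps if_False)
    qed (simp add: mix_def)
  qed
  have 2: "mix e d = (\<lambda>i. mix e (mix c d) (if even i then i else 2 * i + 1))" for e
  proof
    fix i show "mix e d i = mix e (mix c d) (if even i then i else 2 * i + 1)"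
    proof (cases "even i")
      case False
      then obtain k where k: "i = Suc (2 * k)" by (metis oddE Suc_eq_plus1)
      then have "2 * i + 1 = Suc (2 * Suc (2 * k))" by simp
      then show ?thesis using False k by (simp only: mix_simps if_False)
    qed (simp add: mix_def)
  qed
  have "mix c d \<in> env M" using p(1) q(1) by (auto simp: env_def mix_def)
  moreover have "\<forall>e\<in>env M. (P e \<longrightarrow> Q e) \<longleftrightarrow> sat (ext M) E (mix e (mix c d))
      (Implies (ren (\<lambda>i. if even i then i else 2 * i - 1) p) (ren (\<lambda>i. if even i then i else 2 * i + 1) q))"
    using p(2) q(2) by (simp add: sat_ren 1[symmetric] 2[symmetric])
  ultimately show ?thesis unfolding dfn_def by blast
qed

lemma dfn_ren:
  assumes "dfn M P"
  shows "dfn M (\<lambda>e. P (\<lambda>i. e (f i)))"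
proof -
  obtain p c where p: "c \<in> env M" "\<forall>e\<in>env M. P e \<longleftrightarrow> sat (ext M) E (mix e c) p"
    using assms(1) unfolding dfn_def by blast
  have 1: "mix (\<lambda>i. e (f i)) c = (\<lambda>i. mix e c (if even i then 2 * f (i div 2) else i))" for e
    by (rule HOL.ext) (auto simp: mix_def)
  have "\<forall>e\<in>env M. P (\<lambda>i. e (f i)) \<longleftrightarrow> sat (ext M) E (mix e c)
      (ren (\<lambda>i. if even i then 2 * f (i div 2) else i) p)"
    using p(2) Suc_env by (simp add: sat_ren 1[symmetric])
  then show ?thesis unfolding dfn_def using p(1) by blast
qed

lemma dfn_all:
  assumes "dfn M (\<lambda>e. Q (e 0) (\<lambda>i. e (Suc i)))"
  shows "dfn M (\<lambda>e. \<forall>x\<in>ext M. Q x e)"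
proof -
  obtain p c where p: "c \<in> env M" "\<And>e. e \<in> env M \<Longrightarrow>
      Q (e 0) (\<lambda>i. e (Suc i)) \<longleftrightarrow> sat (ext M) E (mix e c) p"
    using assms(1) unfolding dfn_def by blast
  have "Q x e \<longleftrightarrow> sat (ext M) E (case_nat x (mix e c)) (ren skip p)"
    if "x \<in> ext M" "e \<in> env M" for x e
    using p(2)[OF case_nat_env[OF that]] by (simp add: sat_ren mix_case_nat)
  then have "\<forall>e\<in>env M. (\<forall>x\<in>ext M. Q x e) \<longleftrightarrow> sat (ext M) E (mix e c) (Forall (ren skip p))"
    by simp
  then show ?thesis unfolding dfn_def using p(1) by blast
qed

lemma dfn_var_mem: "ext M \<noteq> {} \<Longrightarrow> dfn M (\<lambda>e. e i \<in> ext (e j))"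
proof -
  assume "ext M \<noteq> {}"
  then obtain a where "a \<in> ext M" by blast
  then have "(\<lambda>i. a) \<in> env M" by (simp add: env_def)
  moreover have "e i \<in> ext (e j) \<longleftrightarrow> sat (ext M) E (mix e d) (Member (2 * i) (2 * j))" for e d
    by (simp add: ext_def)
  ultimately show ?thesis unfolding dfn_def by blast
qed

lemma dfn_var_eq: "ext M \<noteq> {} \<Longrightarrow> dfn M (\<lambda>e. e i = e j)"
proof -
  assume "ext M \<noteq> {}"
  then obtain a where "a \<in> ext M" by blast
  then have "(\<lambda>i. a) \<in> env M" by (simp add: env_def)
  moreover have "e i = e j \<longleftrightarrow> sat (ext M) E (mix e d) (Equal (2 * i) (2 * j))" for e d
    by simp
  ultimately show ?thesis unfolding dfn_def by blast
qed

lemma dfn_param_eq: "a \<in> ext M \<Longrightarrow> dfn M (\<lambda>e. e i = a)"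
proof -
  assume "a \<in> ext M"
  then have "(\<lambda>i. a) \<in> env M" by (auto simp: env_def)
  moreover have "e i = a \<longleftrightarrow> sat (ext M) E (mix e (\<lambda>i. a)) (Equal (2 * i) 1)" for e
    by (simp add: mix_def)
  ultimately show ?thesis unfolding dfn_def by blast
qed

lemma dfn_const: "ext M \<noteq> {} \<Longrightarrow> dfn M (\<lambda>e. b)"
proof -
  assume "ext M \<noteq> {}"
  then obtain a where "a \<in> ext M" by blast
  then have "(\<lambda>i. a) \<in> env M" by (simp add: env_def)
  moreover have "b \<longleftrightarrow> sat (ext M) E e (if b then Neg Falsum else Falsum)" for e
    by simp
  ultimately show ?thesis unfolding dfn_def by blast
qed

lemma dfn_not: "dfn M P \<Longrightarrow> dfn M (\<lambda>e. \<not> P e)"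
proof -
  assume "dfn M P"
  moreover have "ext M \<noteq> {}" using \<open>dfn M P\<close> by (auto simp: dfn_def env_def)
  then have "dfn M (\<lambda>e. False)" by (rule dfn_const)
  ultimately show ?thesis using dfn_imp[of M P "\<lambda>e. False"] by simp
qed

lemma dfn_conj: "dfn M P \<Longrightarrow> dfn M Q \<Longrightarrow> dfn M (\<lambda>e. P e \<and> Q e)"
  using dfn_not[OF dfn_imp[OF _ dfn_not], of M P Q] by simp

lemma dfn_disj: "dfn M P \<Longrightarrow> dfn M Q \<Longrightarrow> dfn M (\<lambda>e. P e \<or> Q e)"
  using dfn_not[OF dfn_conj[OF dfn_not dfn_not], of M P Q] by simp

lemma dfn_iff: "dfn M P \<Longrightarrow> dfn M Q \<Longrightarrow> dfn M (\<lambda>e. P e = Q e)"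
  using dfn_conj[OF dfn_imp dfn_imp, of M P Q Q P] by (simp add: iff_conv_conj_imp)

lemma dfn_ex:
  assumes "dfn M (\<lambda>e. Q (e 0) (\<lambda>i. e (Suc i)))"
  shows "dfn M (\<lambda>e. \<exists>x\<in>ext M. Q x e)"
  using dfn_not[OF dfn_all[of M "\<lambda>x e. \<not> Q x e", OF dfn_not[OF assms]]] by simp

text \<open>Function symbols are eliminated as usual: an existential quantifier introduces the
  value, and the definable graph pins it down.\<close>

lemma dfn_subst:
  assumes Q: "dfn M (\<lambda>e. Q (e 0) (\<lambda>i. e (Suc i)))" and t: "Fdef M t"
  shows "dfn M (\<lambda>e. Q (t e) e)"
proof -
  have "dfn M (\<lambda>e. \<exists>x\<in>ext M. x = t e \<and> Q x e)"
    by (rule dfn_ex[of M "\<lambda>x e. x = t e \<and> Q x e"], rule dfn_conj)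
      (use Q t in \<open>auto simp: Fdef_def\<close>)
  then show ?thesis
    by (rule dfn_cong[rotated]) (use t in \<open>auto simp: Fdef_def\<close>)
qed

lemma Fdef_ren: "Fdef M t \<Longrightarrow> Fdef M (\<lambda>e. t (\<lambda>i. e (f i)))"
  unfolding Fdef_def using dfn_ren[of M "\<lambda>e. e 0 = t (\<lambda>i. e (Suc i))" "case_nat 0 (\<lambda>i. Suc (f i))"]
  by (simp add: Suc_env)

lemma dfn_rel2:
  assumes R: "dfn M (\<lambda>e. R (e 0) (e (Suc 0)))" and t: "Fdef M t" and u: "Fdef M u"
  shows "dfn M (\<lambda>e. R (t e) (u e))"
proof (rule dfn_subst[of M "\<lambda>x e. R x (u e)", OF _ t])
  have "dfn M (\<lambda>e. R (e (Suc 0)) (e 0))"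
    using dfn_ren[OF R, of "\<lambda>i. if i = 0 then 1 else 0"] by simp
  then show "dfn M (\<lambda>e. R (e 0) (u (\<lambda>i. e (Suc i))))"
    by (intro dfn_subst[of M "\<lambda>y e. R (e 0) y"] Fdef_ren[OF u])
qed

lemma Fdef_comp2:
  assumes G: "Fdef M (\<lambda>e. G (e 0) (e (Suc 0)))" and t: "Fdef M t" and u: "Fdef M u"
  shows "Fdef M (\<lambda>e. G (t e) (u e))"
proof -
  have "dfn M (\<lambda>e. e 0 = G (e (Suc 0)) (e (Suc (Suc 0))))" using G by (simp add: Fdef_def)
  \<comment> \<open>Exchanging the indices 0 and 2 brings the second argument to the front, where
    \<open>dfn_subst\<close> replaces it by \<open>u\<close>; the same is then done with
    \<open>t\<close>.\<close>
  from dfn_ren[OF this, of "\<lambda>i. 2 - i"]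
  have "dfn M (\<lambda>e. e (Suc (Suc 0)) = G (e (Suc 0)) (e 0))" by (simp add: numeral_2_eq_2)
  then have "dfn M (\<lambda>e. e (Suc 0) = G (e 0) (u (\<lambda>i. e (Suc (Suc i)))))"
    by (intro dfn_subst[of M "\<lambda>y e. e (Suc 0) = G (e 0) y"] Fdef_ren[OF u])
  then have "dfn M (\<lambda>e. e 0 = G (t (\<lambda>i. e (Suc i))) (u (\<lambda>i. e (Suc i))))"
    by (intro dfn_subst[of M "\<lambda>x e. e 0 = G x (u (\<lambda>i. e (Suc i)))"] Fdef_ren[OF t])
  moreover have "G (t e) (u e) \<in> ext M" if "e \<in> env M" for e
  proof -
    have "t e \<in> ext M" "u e \<in> ext M" using t u that unfolding Fdef_def by blast+
    then have "case_nat (t e) (\<lambda>i. u e) \<in> env M" by (auto simp: env_def split: nat.split)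
    then show ?thesis using G unfolding Fdef_def by fastforce
  qed
  ultimately show ?thesis unfolding Fdef_def by blast
qed

lemma Fdef_cong:
  assumes eq: "\<And>e. e \<in> env M \<Longrightarrow> t e = u e" and u: "Fdef M u"
  shows "Fdef M t"
proof -
  have "dfn M (\<lambda>e. e 0 = t (\<lambda>i. e (Suc i)))"
    by (rule dfn_cong[of M _ "\<lambda>e. e 0 = u (\<lambda>i. e (Suc i))"])
      (use u in \<open>simp_all add: eq Suc_env Fdef_def\<close>)
  then show ?thesis using u eq unfolding Fdef_def by simp
qed

lemma Fdef_in: "Fdef M t \<Longrightarrow> e \<in> env M \<Longrightarrow> t e \<in> ext M"
  unfolding Fdef_def by blast

section \<open>Definable operations over a fixed model\<close>

context
  fixes M :: 'a
  assumes tm: "tmod M"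
begin

lemma tmod_trans: "a \<in> ext M \<Longrightarrow> x \<in> ext a \<Longrightarrow> x \<in> ext M"
  using tm unfolding tmod_def transv_def by blast

lemma tmod_transU: "transU (ext M)"
  using tm unfolding tmod_def transU_def transv_def by blast

lemma tmod_ne: "ext M \<noteq> {}"
  using tm unfolding tmod_def by blast

lemma Fdef_var: "Fdef M (\<lambda>e. e i)"
  unfolding Fdef_def using dfn_var_eq[OF tmod_ne, of 0 "Suc i"] by (auto simp: env_def)

lemma Fdef_const: "a \<in> ext M \<Longrightarrow> Fdef M (\<lambda>e. a)"
  unfolding Fdef_def using dfn_param_eq by auto

lemma dfn_mem: "Fdef M t \<Longrightarrow> Fdef M u \<Longrightarrow> dfn M (\<lambda>e. t e \<in> ext (u e))"
  by (rule dfn_rel2[of M "\<lambda>x y. x \<in> ext y"]) (simp_all add: dfn_var_mem tmod_ne)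

lemma dfn_eq: "Fdef M t \<Longrightarrow> Fdef M u \<Longrightarrow> dfn M (\<lambda>e. t e = u e)"
  by (rule dfn_rel2[of M "\<lambda>x y. x = y"]) (simp_all add: dfn_var_eq tmod_ne)

lemma dfn_ball:
  assumes "Fdef M t" "dfn M (\<lambda>e. Q (e 0) (\<lambda>i. e (Suc i)))"
  shows "dfn M (\<lambda>e. \<forall>x\<in>ext (t e). Q x e)"
proof -
  have "dfn M (\<lambda>e. \<forall>x\<in>ext M. x \<in> ext (t e) \<longrightarrow> Q x e)"
    using dfn_all[of M "\<lambda>x e. x \<in> ext (t e) \<longrightarrow> Q x e"] assms
      dfn_imp[OF dfn_mem[OF Fdef_var[of 0] Fdef_ren[OF assms(1), of Suc]] assms(2)] by simp
  then show ?thesis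
    by (rule dfn_cong[rotated]) (use Fdef_in[OF assms(1)] tmod_trans in blast)
qed

lemma dfn_bex:
  assumes "Fdef M t" "dfn M (\<lambda>e. Q (e 0) (\<lambda>i. e (Suc i)))"
  shows "dfn M (\<lambda>e. \<exists>x\<in>ext (t e). Q x e)"
  using dfn_not[OF dfn_ball[of t "\<lambda>x e. \<not> Q x e", OF assms(1) dfn_not[OF assms(2)]]] by simp

lemma dfn_subset:
  assumes "Fdef M t" "Fdef M u" shows "dfn M (\<lambda>e. ext (t e) \<subseteq> ext (u e))"
proof -
  have "dfn M (\<lambda>e. \<forall>x\<in>ext (t e). x \<in> ext (u e))"
    by (intro dfn_ball dfn_mem Fdef_var assms(1) Fdef_ren[OF assms(2)])
  then show ?thesis by (simp add: subset_eq)
qed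

text \<open>By transitivity all elements of a value lie in \<open>M\<close>, so
  \<open>y = t e\<close> can be expressed as agreement of membership in \<open>y\<close> with
  \<open>Q\<close> on all of \<open>M\<close>. Operations given by set comprehensions become
  definable in this way.\<close>

lemma Fdef_ext:
  assumes t: "\<And>e. e \<in> env M \<Longrightarrow> t e \<in> ext M"
    and eq: "\<And>e. e \<in> env M \<Longrightarrow> ext (t e) = {x \<in> ext M. Q x e}"
    and Q: "dfn M (\<lambda>e. Q (e 0) (\<lambda>i. e (Suc i)))"
  shows "Fdef M t"
proof -
  have "dfn M (\<lambda>e. e 0 \<in> ext (e 1) \<longleftrightarrow> Q (e 0) (\<lambda>i. e (Suc (Suc i))))"
    using dfn_iff[OF dfn_var_mem[OF tmod_ne] dfn_ren[OF Q, of "case_nat 0 (\<lambda>i. Suc (Suc i))"]]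
    by simp
  then have "dfn M (\<lambda>e. \<forall>x\<in>ext M. x \<in> ext (e 0) \<longleftrightarrow> Q x (\<lambda>i. e (Suc i)))"
    using dfn_all[of M "\<lambda>x e. x \<in> ext (e 0) \<longleftrightarrow> Q x (\<lambda>i. e (Suc i))"] by simp
  then have "dfn M (\<lambda>e. e 0 = t (\<lambda>i. e (Suc i)))"
  proof (rule dfn_cong[rotated])
    fix e assume e: "e \<in> env M"
    then have sub: "ext (e 0) \<subseteq> ext M" using tmod_trans by (auto simp: env_def)
    have "e 0 = t (\<lambda>i. e (Suc i)) \<longleftrightarrow> ext (e 0) = {x \<in> ext M. Q x (\<lambda>i. e (Suc i))}"
      unfolding eq[OF Suc_env[OF e, of Suc], symmetric] using extensional by metis
    also have "\<dots> \<longleftrightarrow> (\<forall>x\<in>ext M. x \<in> ext (e 0) \<longleftrightarrow> Q x (\<lambda>i. e (Suc i)))"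
      using sub by blast
    finally show "(e 0 = t (\<lambda>i. e (Suc i))) = (\<forall>x\<in>ext M. x \<in> ext (e 0) \<longleftrightarrow> Q x (\<lambda>i. e (Suc i)))" .
  qed
  then show ?thesis unfolding Fdef_def using t by blast
qed

lemma Fdef_upair:
  assumes t: "Fdef M t" and u: "Fdef M u" shows "Fdef M (\<lambda>e. upair (t e) (u e))"
proof (rule Fdef_ext[where Q = "\<lambda>x e. x = t e \<or> x = u e"])
  show "dfn M (\<lambda>e. e 0 = t (\<lambda>i. e (Suc i)) \<or> e 0 = u (\<lambda>i. e (Suc i)))"
    by (intro dfn_disj dfn_eq Fdef_var Fdef_ren[OF t] Fdef_ren[OF u])
next
  fix e assume "e \<in> env M"
  then have "t e \<in> ext M" "u e \<in> ext M" using Fdef_in t u by blast+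
  then show "upair (t e) (u e) \<in> ext M" "ext (upair (t e) (u e)) = {x \<in> ext M. x = t e \<or> x = u e}"
    using tm by (auto simp: tmod_def)
qed

lemma Fdef_opair: "Fdef M t \<Longrightarrow> Fdef M u \<Longrightarrow> Fdef M (\<lambda>e. opair (t e) (u e))"
  unfolding opair_def by (intro Fdef_upair)

lemma Fdef_Uni:
  assumes "Fdef M t" shows "Fdef M (\<lambda>e. Uni (t e))"
proof (rule Fdef_ext[where Q = "\<lambda>x e. \<exists>y\<in>ext (t e). x \<in> ext y"])
  show "dfn M (\<lambda>e. \<exists>y\<in>ext (t (\<lambda>i. e (Suc i))). e 0 \<in> ext y)"
    by (intro dfn_bex Fdef_ren[OF assms] dfn_mem Fdef_var)
next
  fix e assume "e \<in> env M"
  then have "t e \<in> ext M" using Fdef_in assms by blast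
  then show "Uni (t e) \<in> ext M" using tm unfolding tmod_def by blast
  show "ext (Uni (t e)) = {x \<in> ext M. \<exists>y\<in>ext (t e). x \<in> ext y}"
    unfolding ext_Uni using tmod_trans[OF tmod_trans[OF \<open>t e \<in> ext M\<close>]] by blast
qed

lemma Fdef_succ: "Fdef M t \<Longrightarrow> Fdef M (\<lambda>e. succ (t e))"
  unfolding succ_def by (intro Fdef_Uni Fdef_upair)

lemma Fdef_join: "Fdef M t \<Longrightarrow> Fdef M u \<Longrightarrow> Fdef M (\<lambda>e. join (t e) (u e))"
  unfolding join_def by (intro Fdef_Uni Fdef_upair)

lemma tmod_upair [simp]: "x \<in> ext M \<Longrightarrow> y \<in> ext M \<Longrightarrow> upair x y \<in> ext M"
  using tm unfolding tmod_def by blast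

lemma tmod_Uni [simp]: "x \<in> ext M \<Longrightarrow> Uni x \<in> ext M"
  using tm unfolding tmod_def by blast

lemma tmod_emp [simp]: "emp \<in> ext M"
  using tm unfolding tmod_def by blast

lemma tmod_opair [simp]: "opair x y \<in> ext M \<longleftrightarrow> x \<in> ext M \<and> y \<in> ext M"
  using tmod_transU by simp

lemma tmod_succ [simp]: "x \<in> ext M \<Longrightarrow> succ x \<in> ext M"
  by (simp add: succ_def)

lemma tmod_join [simp]: "x \<in> ext M \<Longrightarrow> y \<in> ext M \<Longrightarrow> join x y \<in> ext M"
  by (simp add: join_def)

lemma tmod_num [simp]: "num k \<in> ext M"
  by (induction k) simp_all

lemma Fdef_num: "Fdef M (\<lambda>e. num k)" and Fdef_emp: "Fdef M (\<lambda>e. emp)"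
  by (simp_all add: Fdef_const)

lemma Fdef_code: "Fdef M t \<Longrightarrow> Fdef M u \<Longrightarrow> Fdef M (\<lambda>e. code k (t e) (u e))"
  unfolding code_def by (intro Fdef_opair Fdef_num)

lemma sep_ex:
  assumes a: "a \<in> ext M" and e: "e \<in> env M" and Q: "dfn M (\<lambda>e. Q (e 0) (\<lambda>i. e (Suc i)))"
  shows "\<exists>b\<in>ext M. ext b = {x \<in> ext a. Q x e}"
proof -
  obtain p c where p: "c \<in> env M" "\<And>e. e \<in> env M \<Longrightarrow>
      Q (e 0) (\<lambda>i. e (Suc i)) \<longleftrightarrow> sat (ext M) E (mix e c) p"
    using Q unfolding dfn_def by blast
  have eq: "Q x e \<longleftrightarrow> sat (ext M) E (case_nat x (mix e c)) (ren skip p)" if "x \<in> ext a" for x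
    using p(2)[OF case_nat_env[OF tmod_trans[OF a that] e]] by (simp add: sat_ren mix_case_nat)
  have "\<exists>b\<in>ext M. ext b = {x \<in> ext a. sat (ext M) E (case_nat x (mix e c)) (ren skip p)}"
    using tm e p(1) a by (intro fm_separation) (auto simp: tmod_def env_def mix_def)
  then show ?thesis using eq by (simp cong: conj_cong)
qed

lemma repl_ex:
  assumes a: "a \<in> ext M" and e: "e \<in> env M" and g: "Fdef M (\<lambda>e. g (e 0) (\<lambda>i. e (Suc i)))"
  shows "\<exists>b\<in>ext M. ext b = (\<lambda>x. g x e) ` ext a"
proof -
  obtain p c where p: "c \<in> env M" "\<And>e. e \<in> env M \<Longrightarrow>
      e 0 = g (e (Suc 0)) (\<lambda>i. e (Suc (Suc i))) \<longleftrightarrow> sat (ext M) E (mix e c) p"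
    using g unfolding dfn_def Fdef_def by blast
  \<comment> \<open>\<open>r\<close> applies \<open>skip\<close> once for each of the two variables
    placed in front of the parameters.\<close>
  define r where "r i = (case skip i of 0 \<Rightarrow> 0 | Suc j \<Rightarrow> Suc (skip j))" for i
  have mix2: "mix (case_nat y (case_nat x e)) c = (\<lambda>i. case_nat y (case_nat x (mix e c)) (r i))" for x y
    unfolding mix_case_nat r_def by (auto split: nat.split)
  have eq: "y = g x e \<longleftrightarrow> sat (ext M) E (case_nat y (case_nat x (mix e c))) (ren r p)"
    if "x \<in> ext a" "y \<in> ext M" for x y
    using p(2)[OF case_nat_env[OF that(2) case_nat_env[OF tmod_trans[OF a that(1)] e]]]
    by (simp add: sat_ren mix2)
  have "\<exists>b\<in>ext M. ext b = {y \<in> ext M. \<exists>x\<in>ext a.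
      sat (ext M) E (case_nat y (case_nat x (mix e c))) (ren r p)}"
    using tm e p(1) a by (intro fm_replacement) (auto simp: tmod_def env_def mix_def eq[symmetric])
  moreover have "g x e \<in> ext M" if "x \<in> ext a" for x
    using Fdef_in[OF g case_nat_env[OF tmod_trans[OF a that] e]] by simp
  then have "{y \<in> ext M. \<exists>x\<in>ext a. sat (ext M) E (case_nat y (case_nat x (mix e c))) (ren r p)}
      = (\<lambda>x. g x e) ` ext a"
    by (auto simp: eq[symmetric])
  ultimately show ?thesis by simp
qed

lemma Fdef_sep:
  assumes a: "Fdef M a" and Q: "dfn M (\<lambda>e. Q (e 0) (\<lambda>i. e (Suc i)))"
  shows "Fdef M (\<lambda>e. col {x \<in> ext (a e). Q x e})"
proof (rule Fdef_ext[where Q = "\<lambda>x e. x \<in> ext (a e) \<and> Q x e"])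
  fix e assume e: "e \<in> env M"
  obtain b where b: "b \<in> ext M" "ext b = {x \<in> ext (a e). Q x e}"
    using sep_ex[OF Fdef_in[OF a e] e Q] by blast
  show "col {x \<in> ext (a e). Q x e} \<in> ext M" using b by (simp add: col_eq)
  show "ext (col {x \<in> ext (a e). Q x e}) = {x \<in> ext M. x \<in> ext (a e) \<and> Q x e}"
    unfolding ext_col[OF b(2)] using tmod_trans[OF Fdef_in[OF a e]] by blast
qed (intro dfn_conj dfn_mem Fdef_var Fdef_ren[OF a] Q)

lemma Fdef_repl:
  assumes a: "Fdef M a" and g: "Fdef M (\<lambda>e. g (e 0) (\<lambda>i. e (Suc i)))"
  shows "Fdef M (\<lambda>e. col ((\<lambda>x. g x e) ` ext (a e)))"
proof (rule Fdef_ext[where Q = "\<lambda>y e. \<exists>x\<in>ext (a e). y = g x e"])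
  fix e assume e: "e \<in> env M"
  obtain b where b: "b \<in> ext M" "ext b = (\<lambda>x. g x e) ` ext (a e)"
    using repl_ex[OF Fdef_in[OF a e] e g] by blast
  show "col ((\<lambda>x. g x e) ` ext (a e)) \<in> ext M" using b by (simp add: col_eq)
  have "(\<lambda>x. g x e) ` ext (a e) \<subseteq> ext M" using tmod_trans[OF b(1)] b(2) by blast
  then show "ext (col ((\<lambda>x. g x e) ` ext (a e))) = {y \<in> ext M. \<exists>x\<in>ext (a e). y = g x e}"
    unfolding ext_col[OF b(2)] by blast
next
  have "Fdef M (\<lambda>e. g (e 0) (\<lambda>i. e (Suc (Suc i))))"
    using Fdef_ren[OF g, of "case_nat 0 (\<lambda>i. Suc (Suc i))"] by simp
  then show "dfn M (\<lambda>e. \<exists>x\<in>ext (a (\<lambda>i. e (Suc i))). e 0 = g x (\<lambda>i. e (Suc i)))"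
    by (intro dfn_bex dfn_eq Fdef_ren[OF a] Fdef_var)
qed

lemma Fdef_if:
  assumes "dfn M P" and t: "Fdef M t" and u: "Fdef M u"
  shows "Fdef M (\<lambda>e. if P e then t e else u e)"
proof (rule Fdef_ext[where Q = "\<lambda>x e. (P e \<and> x \<in> ext (t e)) \<or> (\<not> P e \<and> x \<in> ext (u e))"])
  show "dfn M (\<lambda>e. (P (\<lambda>i. e (Suc i)) \<and> e 0 \<in> ext (t (\<lambda>i. e (Suc i)))) \<or>
      (\<not> P (\<lambda>i. e (Suc i)) \<and> e 0 \<in> ext (u (\<lambda>i. e (Suc i)))))"
    by (intro dfn_disj dfn_conj dfn_not dfn_ren[OF assms(1)] dfn_mem Fdef_var Fdef_ren[OF t] Fdef_ren[OF u])
next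
  fix e assume "e \<in> env M"
  then have "t e \<in> ext M" "u e \<in> ext M" using Fdef_in t u by blast+
  then show "(if P e then t e else u e) \<in> ext M"
    "ext (if P e then t e else u e) = {x \<in> ext M. P e \<and> x \<in> ext (t e) \<or> \<not> P e \<and> x \<in> ext (u e)}"
    using tmod_trans[of "t e"] tmod_trans[of "u e"] by auto
qed

lemma
  assumes "a \<in> ext M" "dfn M (\<lambda>e. Q (e 0))"
  shows ext_sep: "ext (col {x \<in> ext a. Q x}) = {x \<in> ext a. Q x}"
    and tmod_sep: "col {x \<in> ext a. Q x} \<in> ext M"
proof -
  have "(\<lambda>i. a) \<in> env M" using assms(1) by (simp add: env_def)
  then obtain b where b: "b \<in> ext M" "ext b = {x \<in> ext a. Q x}"
    using sep_ex[OF assms(1), of _ "\<lambda>x e. Q x", OF _ assms(2)] by blast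
  then show "ext (col {x \<in> ext a. Q x}) = {x \<in> ext a. Q x}" "col {x \<in> ext a. Q x} \<in> ext M"
    unfolding b(2)[symmetric] by simp_all
qed

lemma
  assumes "a \<in> ext M" "Fdef M (\<lambda>e. g (e 0))"
  shows ext_repl: "ext (col (g ` ext a)) = g ` ext a"
    and tmod_repl: "col (g ` ext a) \<in> ext M"
proof -
  have "(\<lambda>i. a) \<in> env M" using assms(1) by (simp add: env_def)
  then obtain b where b: "b \<in> ext M" "ext b = g ` ext a"
    using repl_ex[OF assms(1), of _ "\<lambda>x e. g x", OF _ assms(2)] by blast
  then show "ext (col (g ` ext a)) = g ` ext a" "col (g ` ext a) \<in> ext M"
    unfolding b(2)[symmetric] by simp_all
qed

text \<open>Separation in \<open>M\<close> forms the set of counterexamples, and foundation gives a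
  minimal one. The definability premise ensures that this set exists.\<close>

lemma mem_induct:
  assumes a: "a \<in> ext M" "dfn M (\<lambda>e. Q (e 0))" "x \<in> ext a"
    and step: "\<And>x. x \<in> ext a \<Longrightarrow> (\<And>y. y \<in> ext x \<Longrightarrow> y \<in> ext a \<Longrightarrow> Q y) \<Longrightarrow> Q x"
  shows "Q x"
proof (rule ccontr)
  assume "\<not> Q x"
  have eq: "ext (col {x \<in> ext a. \<not> Q x}) = {x \<in> ext a. \<not> Q x}"
    using a by (intro ext_sep dfn_not)
  then have "ext (col {x \<in> ext a. \<not> Q x}) \<noteq> {}" using \<open>\<not> Q x\<close> a(3) by auto
  from regularity[OF this] eq obtain y where "y \<in> ext a" "\<not> Q y" "\<forall>z\<in>ext a. \<not> Q z \<longrightarrow> z \<notin> ext y"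
    by auto
  then show False using step by blast
qed

end

text \<open>Collecting the elements of the value makes \<open>app\<close> total on models: outside the domain of \<open>f\<close> it is \<open>emp\<close>.\<close>

definition app :: "'a \<Rightarrow> 'a \<Rightarrow> 'a" where
  "app f x = col {z. \<exists>y. opair x y \<in> ext f \<and> z \<in> ext y}"

text \<open>The power set in the sense of \<open>M\<close>: \<open>V\<close> need not have one, and
  subsets of \<open>a\<close> outside \<open>M\<close> are left out.\<close>

definition pw :: "'a \<Rightarrow> 'a \<Rightarrow> 'a" where
  "pw M a = col {z \<in> ext M. ext z \<subseteq> ext a}"

definition cart :: "'a \<Rightarrow> 'a \<Rightarrow> 'a" where
  "cart a b = Uni (col ((\<lambda>x. col ((\<lambda>y. opair x y) ` ext b)) ` ext a))"

lemma app_eq: "(\<And>z. opair x z \<in> ext f \<longleftrightarrow> z = y) \<Longrightarrow> app f x = y"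
  unfolding app_def by simp

section \<open>Power sets, products and well-founded recursion in a model\<close>

context
  fixes M :: 'a
  assumes tm: "tmod M"
begin

lemma ext_pw: "a \<in> ext M \<Longrightarrow> ext (pw M a) = {z \<in> ext M. ext z \<subseteq> ext a}"
  and tmod_pw: "a \<in> ext M \<Longrightarrow> pw M a \<in> ext M"
proof -
  assume "a \<in> ext M"
  then obtain y where "y \<in> ext M" "ext y = {z \<in> ext M. ext z \<subseteq> ext a}"
    using tm unfolding tmod_def by blast
  then show "ext (pw M a) = {z \<in> ext M. ext z \<subseteq> ext a}" "pw M a \<in> ext M"
    by (simp_all add: pw_def col_eq)
qed

lemma Fdef_pw:
  assumes t: "Fdef M t" shows "Fdef M (\<lambda>e. pw M (t e))"
proof (rule Fdef_ext[OF tm, where Q = "\<lambda>z e. ext z \<subseteq> ext (t e)"])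
  show "dfn M (\<lambda>e. ext (e 0) \<subseteq> ext (t (\<lambda>i. e (Suc i))))"
    by (intro dfn_subset[OF tm] Fdef_var[OF tm] Fdef_ren[OF t])
qed (use ext_pw tmod_pw Fdef_in[OF t] in auto)

lemma Fdef_app:
  assumes t: "Fdef M t" and u: "Fdef M u" shows "Fdef M (\<lambda>e. app (t e) (u e))"
proof -
  have "Fdef M (\<lambda>e. col {z \<in> ext (Uni (Uni (Uni (t e)))). \<exists>y\<in>ext M. opair (u e) y \<in> ext (t e) \<and> z \<in> ext y})"
    by (intro Fdef_sep[OF tm] Fdef_Uni[OF tm] t dfn_ex dfn_conj dfn_mem[OF tm] Fdef_opair[OF tm]
        Fdef_ren[OF u, of "\<lambda>i. Suc (Suc i)"] Fdef_ren[OF t, of "\<lambda>i. Suc (Suc i)"] Fdef_var[OF tm])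
  moreover have "app (t e) (u e) =
      col {z \<in> ext (Uni (Uni (Uni (t e)))). \<exists>y\<in>ext M. opair (u e) y \<in> ext (t e) \<and> z \<in> ext y}"
    if "e \<in> env M" for e
  proof -
    have "{z. \<exists>y. opair (u e) y \<in> ext (t e) \<and> z \<in> ext y} =
      {z \<in> ext (Uni (Uni (Uni (t e)))). \<exists>y\<in>ext M. opair (u e) y \<in> ext (t e) \<and> z \<in> ext y}"
    proof (intro set_eqI iffI CollectI)
      fix z assume "z \<in> {z. \<exists>y. opair (u e) y \<in> ext (t e) \<and> z \<in> ext y}"
      then obtain y where y: "opair (u e) y \<in> ext (t e)" "z \<in> ext y" by blast
      then have "y \<in> ext M" using tmod_trans[OF tm Fdef_in[OF t that]] tmod_opair[OF tm] by blast
      moreover have "upair (u e) y \<in> ext (Uni (t e))" using y(1) by (force simp: opair_def)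
      then have "y \<in> ext (Uni (Uni (t e)))" by (metis UN_iff ext_Uni ext_upair insertI1 insert_commute)
      ultimately show "z \<in> ext (Uni (Uni (Uni (t e)))) \<and> (\<exists>y\<in>ext M. opair (u e) y \<in> ext (t e) \<and> z \<in> ext y)"
        using y by (metis UN_I ext_Uni)
    qed auto
    then show ?thesis unfolding app_def by simp
  qed
  ultimately show ?thesis by (rule Fdef_cong[rotated])
qed

lemma Fdef_cart:
  assumes t: "Fdef M t" and u: "Fdef M u" shows "Fdef M (\<lambda>e. cart (t e) (u e))"
  unfolding cart_def
  by (intro Fdef_Uni[OF tm] Fdef_repl[OF tm] Fdef_opair[OF tm] Fdef_var[OF tm] t Fdef_ren[OF u])

text \<open>Anything written with bounded quantifiers, quantifiers over \<open>M\<close> and the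
  operations above is shown definable by \<open>intro\<close> with these rules; later definitions
  are phrased to fit them.\<close>

lemmas dfn_intros =
  dfn_all dfn_ex dfn_ball[OF tm] dfn_bex[OF tm] dfn_not dfn_conj dfn_disj dfn_imp dfn_iff
  dfn_mem[OF tm] dfn_eq[OF tm] dfn_subset[OF tm]
  Fdef_var[OF tm] Fdef_emp[OF tm] Fdef_num[OF tm] Fdef_upair[OF tm] Fdef_opair[OF tm] Fdef_Uni[OF tm]
  Fdef_succ[OF tm] Fdef_join[OF tm] Fdef_code[OF tm] Fdef_app Fdef_pw Fdef_cart
  Fdef_sep[OF tm] Fdef_repl[OF tm] Fdef_if[OF tm] Fdef_const[OF tm] dfn_const[OF tmod_ne[OF tm]]

lemma tmod_app: "f \<in> ext M \<Longrightarrow> x \<in> ext M \<Longrightarrow> app f x \<in> ext M"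
  using Fdef_in[OF Fdef_app[OF Fdef_const[OF tm] Fdef_const[OF tm]], of f x "\<lambda>i. f"]
  by (simp add: env_def)

lemma tmod_cart: "a \<in> ext M \<Longrightarrow> b \<in> ext M \<Longrightarrow> cart a b \<in> ext M"
  using Fdef_in[OF Fdef_cart[OF Fdef_const[OF tm] Fdef_const[OF tm]], of a b "\<lambda>i. a"]
  by (simp add: env_def)

lemma ext_cart:
  assumes "a \<in> ext M" "b \<in> ext M"
  shows "ext (cart a b) = {opair x y | x y. x \<in> ext a \<and> y \<in> ext b}"
proof -
  have 1: "ext (col ((\<lambda>y. opair x y) ` ext b)) = (\<lambda>y. opair x y) ` ext b" if "x \<in> ext a" for x
    by (rule ext_repl[OF tm assms(2)])
      (intro dfn_intros tmod_trans[OF tm assms(1) that])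
  have "ext (col ((\<lambda>x. col ((\<lambda>y. opair x y) ` ext b)) ` ext a)) = (\<lambda>x. col ((\<lambda>y. opair x y) ` ext b)) ` ext a"
    by (rule ext_repl[OF tm assms(1)]) (intro dfn_intros assms(2))
  then show ?thesis unfolding cart_def using 1 by auto
qed

text \<open>The classical proof by attempts. They agree where their domains overlap, by
  well-foundedness for sets in \<open>M\<close>; replacement glues them to a single
  \<open>g0\<close>; and \<open>g0\<close> could be extended to any minimal point it misses. The
  premise \<open>dep\<close> says that \<open>G x g\<close> looks at \<open>g\<close> only below
  \<open>x\<close>, so passing from an attempt to \<open>g0\<close> preserves the recursion
  equation.\<close>

theorem recursion:
  assumes D: "D \<in> ext M" and R: "dfn M (\<lambda>e. R (e 0) (e (Suc 0)))"
    and wf: "\<And>Z. Z \<in> ext M \<Longrightarrow> ext Z \<subseteq> ext D \<Longrightarrow> ext Z \<noteq> {} \<Longrightarrow> \<exists>x\<in>ext Z. \<forall>y\<in>ext Z. \<not> R y x"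
    and G: "Fdef M (\<lambda>e. G (e 0) (e (Suc 0)))"
    and dep: "\<And>x g g'. x \<in> ext D \<Longrightarrow> g \<in> ext M \<Longrightarrow> g' \<in> ext M \<Longrightarrow>
      (\<And>y. y \<in> ext D \<Longrightarrow> R y x \<Longrightarrow> app g y = app g' y) \<Longrightarrow> G x g = G x g'"
  shows "\<exists>g\<in>ext M. \<forall>x\<in>ext D. app g x = G x g"
proof -
  note intros = dfn_rel2[OF R] Fdef_comp2[OF G] dfn_intros
  \<comment> \<open>An attempt is correct on a domain \<open>d\<close> closed under predecessors;
    its values elsewhere are arbitrary.\<close>
  define att where "att g d \<longleftrightarrow> ext d \<subseteq> ext D \<and>
    (\<forall>x\<in>ext d. (\<forall>y\<in>ext D. R y x \<longrightarrow> y \<in> ext d) \<and> app g x = G x g)" for g d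
  have uniq: "app g x = app g' x"
    if M: "g \<in> ext M" "g' \<in> ext M" "d \<in> ext M" "d' \<in> ext M"
      and att: "att g d" "att g' d'" and x: "x \<in> ext d" "x \<in> ext d'" for g g' d d' x
  proof (rule ccontr)
    assume ne: "app g x \<noteq> app g' x"
    let ?Q = "\<lambda>x. x \<in> ext d' \<and> app g x \<noteq> app g' x"
    have Q: "dfn M (\<lambda>e. ?Q (e 0))" by (intro dfn_intros M)
    have eq: "ext (col {x \<in> ext d. ?Q x}) = {x \<in> ext d. ?Q x}"
      by (rule ext_sep[OF tm M(3) Q])
    have "\<exists>x\<in>ext (col {x \<in> ext d. ?Q x}). \<forall>y\<in>ext (col {x \<in> ext d. ?Q x}). \<not> R y x"
      by (rule wf) (use tmod_sep[OF tm M(3) Q] att x ne in \<open>auto simp: eq att_def\<close>)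
    then obtain z where z: "z \<in> ext d" "?Q z" and min: "\<And>y. y \<in> ext d \<Longrightarrow> ?Q y \<Longrightarrow> \<not> R y z"
      unfolding eq by blast
    have "z \<in> ext D" using z(1) att(1) unfolding att_def by blast
    then have "G z g = G z g'"
    proof (rule dep[OF _ M(1,2)])
      fix y assume "y \<in> ext D" "R y z"
      then have "y \<in> ext d" "y \<in> ext d'" using z att unfolding att_def by blast+
      then show "app g y = app g' y" using min \<open>R y z\<close> by blast
    qed
    then show False using z att unfolding att_def by metis
  qed
  define Dom where "Dom = col {x \<in> ext D. \<exists>g\<in>ext M. \<exists>d\<in>ext M. att g d \<and> x \<in> ext d}"
  have dom: "dfn M (\<lambda>e. \<exists>g\<in>ext M. \<exists>d\<in>ext M. att g d \<and> e 0 \<in> ext d)"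
    unfolding att_def by (intro intros D)
  have Dom: "ext Dom = {x \<in> ext D. \<exists>g\<in>ext M. \<exists>d\<in>ext M. att g d \<and> x \<in> ext d}" "Dom \<in> ext M"
    unfolding Dom_def by (rule ext_sep[OF tm D dom], rule tmod_sep[OF tm D dom])
  \<comment> \<open>All attempts reaching \<open>x\<close> give the same value, so collecting
    elements over them yields it without choosing one; where no attempt exists the result is
    \<open>emp\<close>.\<close>
  define val where "val x = col {z. \<exists>g\<in>ext M. \<exists>d\<in>ext M. att g d \<and> x \<in> ext d \<and> z \<in> ext (app g x)}" for x
  have val: "val x = app g x" if "g \<in> ext M" "d \<in> ext M" "att g d" "x \<in> ext d" for x g d
  proof -
    have "{z. \<exists>g\<in>ext M. \<exists>d\<in>ext M. att g d \<and> x \<in> ext d \<and> z \<in> ext (app g x)} = ext (app g x)"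
    proof (intro set_eqI iffI CollectI)
      fix z assume "z \<in> {z. \<exists>g\<in>ext M. \<exists>d\<in>ext M. att g d \<and> x \<in> ext d \<and> z \<in> ext (app g x)}"
      then obtain g' d' where "g' \<in> ext M" "d' \<in> ext M" "att g' d'" "x \<in> ext d'" "z \<in> ext (app g' x)"
        by blast
      then show "z \<in> ext (app g x)" using uniq[of g g' d d' x] that by simp
    qed (use that in blast)
    then show ?thesis unfolding val_def by simp
  qed
  have val_emp: "val x = emp" if "\<not> (\<exists>g\<in>ext M. \<exists>d\<in>ext M. att g d \<and> x \<in> ext d)" for x
  proof -
    have "{z. \<exists>g\<in>ext M. \<exists>d\<in>ext M. att g d \<and> x \<in> ext d \<and> z \<in> ext (app g x)} = {}"
      using that by blast
    then show ?thesis unfolding val_def by (simp only: emp_def)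
  qed
  have val_in: "val x \<in> ext M" if "x \<in> ext M" for x
  proof (cases "\<exists>g\<in>ext M. \<exists>d\<in>ext M. att g d \<and> x \<in> ext d")
    case True
    then show ?thesis using val tmod_app[OF _ that] by auto
  qed (use val_emp tmod_emp[OF tm] in auto)
  have val_def': "Fdef M (\<lambda>e. val (e 0))"
  proof (rule Fdef_ext[OF tm, where Q = "\<lambda>z e. \<exists>g\<in>ext M. \<exists>d\<in>ext M. att g d \<and> e 0 \<in> ext d \<and> z \<in> ext (app g (e 0))"])
    show "dfn M (\<lambda>e. \<exists>g\<in>ext M. \<exists>d\<in>ext M. att g d \<and> e (Suc 0) \<in> ext d \<and> e 0 \<in> ext (app g (e (Suc 0))))"
      unfolding att_def by (intro intros D)
    fix e assume "e \<in> env M"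
    then have e: "e 0 \<in> ext M" by (simp add: env_def)
    then show "val (e 0) \<in> ext M" by (rule val_in)
    show "ext (val (e 0)) = {z \<in> ext M. \<exists>g\<in>ext M. \<exists>d\<in>ext M. att g d \<and> e 0 \<in> ext d \<and> z \<in> ext (app g (e 0))}"
    proof (cases "\<exists>g\<in>ext M. \<exists>d\<in>ext M. att g d \<and> e 0 \<in> ext d")
      case True
      then obtain g d where "g \<in> ext M" "d \<in> ext M" "att g d" "e 0 \<in> ext d" by blast
      moreover have "ext (val (e 0)) \<subseteq> ext M" using tmod_trans[OF tm val_in[OF e]] by blast
      ultimately show ?thesis using val by (auto; metis)
    next
      case False
      then show ?thesis by (auto simp: val_emp)
    qed
  qed
  define g0 where "g0 = col ((\<lambda>x. opair x (val x)) ` ext Dom)"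
  have pv: "Fdef M (\<lambda>e. opair (e 0) (val (e 0)))"
    by (intro Fdef_opair[OF tm] Fdef_var[OF tm] val_def')
  have g0: "ext g0 = (\<lambda>x. opair x (val x)) ` ext Dom" "g0 \<in> ext M"
    unfolding g0_def by (rule ext_repl[OF tm Dom(2) pv], rule tmod_repl[OF tm Dom(2) pv])
  have app_g0: "app g0 x = val x" if "x \<in> ext Dom" for x
    by (rule app_eq) (use that in \<open>auto simp: g0\<close>)
  have pred: "y \<in> ext Dom" if "x \<in> ext Dom" "y \<in> ext D" "R y x" for x y
    using that unfolding Dom(1) att_def by blast
  have rec0: "app g0 x = G x g0" if x: "x \<in> ext Dom" for x
  proof -
    obtain g d where gd: "g \<in> ext M" "d \<in> ext M" "att g d" "x \<in> ext d" and xD: "x \<in> ext D"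
      using x unfolding Dom(1) by blast
    have "app g0 x = app g x" using val[OF gd] app_g0[OF x] by simp
    also have "\<dots> = G x g" using gd unfolding att_def by blast
    also have "\<dots> = G x g0"
    proof (rule dep[OF xD gd(1) g0(2)])
      fix y assume y: "y \<in> ext D" "R y x"
      then have "y \<in> ext d" using gd unfolding att_def by blast
      then show "app g y = app g0 y" using val[OF gd(1-3)] app_g0[OF pred[OF x y]] by simp
    qed
    finally show ?thesis .
  qed
  have "ext D \<subseteq> ext Dom"
  proof (rule ccontr)
    assume ne: "\<not> ext D \<subseteq> ext Dom"
    have Q: "dfn M (\<lambda>e. e 0 \<notin> ext Dom)" by (intro dfn_intros Dom)
    have eq: "ext (col {x \<in> ext D. x \<notin> ext Dom}) = {x \<in> ext D. x \<notin> ext Dom}"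
      by (rule ext_sep[OF tm D Q])
    have "\<exists>x\<in>ext (col {x \<in> ext D. x \<notin> ext Dom}). \<forall>y\<in>ext (col {x \<in> ext D. x \<notin> ext Dom}). \<not> R y x"
      by (rule wf) (use tmod_sep[OF tm D Q] ne in \<open>auto simp: eq\<close>)
    then obtain x where x: "x \<in> ext D" "x \<notin> ext Dom"
      and min: "\<And>y. y \<in> ext D \<Longrightarrow> R y x \<Longrightarrow> y \<in> ext Dom"
      unfolding eq by blast
    \<comment> \<open>Adding to \<open>g0\<close> the value prescribed at \<open>x\<close> gives an
      attempt that reaches \<open>x\<close>.\<close>
    define p where "p = opair x (G x g0)"
    have xM: "x \<in> ext M" using tmod_trans[OF tm D x(1)] .
    have GM: "G a b \<in> ext M" if "a \<in> ext M" "b \<in> ext M" for a b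
      using Fdef_in[OF G, of "case_nat a (\<lambda>i. b)"] that by (auto simp: env_def split: nat.split)
    define g1 where "g1 = join g0 (upair p p)"
    define d1 where "d1 = join Dom (upair x x)"
    have M1: "g1 \<in> ext M" "d1 \<in> ext M"
      using xM GM g0(2) Dom(2) by (simp_all add: g1_def d1_def p_def tm)
    have app_x: "app g1 x = G x g0"
      by (rule app_eq) (use x in \<open>auto simp: g1_def p_def g0\<close>)
    have app_y: "app g1 y = app g0 y" if "y \<in> ext Dom" for y
    proof -
      have "app g1 y = val y"
        by (rule app_eq) (use x that in \<open>auto simp: g1_def p_def g0\<close>)
      then show ?thesis using app_g0[OF that] by simp
    qed
    have "att g1 d1" unfolding att_def
    proof (intro conjI ballI impI)
      show "ext d1 \<subseteq> ext D" using x Dom by (auto simp: d1_def)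
      fix z assume z: "z \<in> ext d1"
      show "y \<in> ext d1" if "y \<in> ext D" "R y z" for y
        using z that min pred by (auto simp: d1_def)
      have zD: "z \<in> ext D" using z x Dom by (auto simp: d1_def)
      have "G z g0 = G z g1"
      proof (rule dep[OF zD g0(2) M1(1)])
        fix y assume "y \<in> ext D" "R y z"
        then have "y \<in> ext Dom" using z min pred by (auto simp: d1_def)
        then show "app g0 y = app g1 y" using app_y by simp
      qed
      then show "app g1 z = G z g1"
        using z app_x app_y rec0 by (auto simp: d1_def)
    qed
    moreover have "x \<in> ext d1" by (simp add: d1_def)
    ultimately have "x \<in> ext Dom" unfolding Dom(1) using M1 x by blast
    then show False using x by blast
  qed
  then show ?thesis using rec0 g0(2) by blast
qed

end

end

section \<open>The constructible hierarchy inside transitive models\<close>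

locale lzfc_structure = regular +
  assumes omega_ex: "\<exists>w. isomega w"
    and loc: "\<exists>M. x \<in> ext M \<and> tmod M"
begin

section \<open>The natural numbers of the structure\<close>

lemma ex_tmod:
  assumes "finite X"
  shows "\<exists>M. tmod M \<and> X \<subseteq> ext M"
proof -
  have "\<exists>a. ext a = X" using assms
  proof (induction rule: finite_induct)
    case (insert x X)
    then obtain a where "ext a = X" by blast
    then have "ext (join (upair x x) a) = insert x X" by simp
    then show ?case by blast
  qed (use ext_emp in blast)
  then obtain a where a: "ext a = X" by blast
  obtain M where "a \<in> ext M" "tmod M" using loc by blast
  then show ?thesis using a unfolding tmod_def transv_def by blast
qed

lemma omega_subset:
  assumes w: "isomega w" and x: "emp \<in> ext x" "\<And>y. y \<in> ext x \<Longrightarrow> succ y \<in> ext x"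
  shows "ext w \<subseteq> ext x"
proof
  fix k assume k: "k \<in> ext w"
  obtain N where N: "tmod N" "w \<in> ext N" "x \<in> ext N" using ex_tmod[of "{w, x}"] by auto
  show "k \<in> ext x"
  proof (rule mem_induct[OF N(1,2) _ k])
    show "dfn N (\<lambda>e. e 0 \<in> ext x)" by (intro dfn_intros[OF N(1)] N)
    fix k assume k: "k \<in> ext w" and IH: "\<And>y. y \<in> ext k \<Longrightarrow> y \<in> ext w \<Longrightarrow> y \<in> ext x"
    show "k \<in> ext x"
    proof (cases "k = emp")
      case False
      then obtain y where "y \<in> ext w" "k = succ y" using w k unfolding isomega_def by blast
      then show ?thesis using IH[of y] x(2) by simp
    qed (use x in simp)
  qed
qed

lemma omega_unique: "isomega w \<Longrightarrow> isomega w' \<Longrightarrow> w = w'"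
  by (intro extensional equalityI omega_subset emp_in_omega) (auto simp: isomega_def)

definition om :: 'a where "om = (THE w. isomega w)"

lemma isomega_iff: "isomega w \<longleftrightarrow> w = om"
proof -
  have "\<exists>!w. isomega w" using omega_ex omega_unique by blast
  then show ?thesis unfolding om_def by (metis the1_equality theI')
qed

lemma isomega_om: "isomega om"
  by (simp add: isomega_iff)

lemma emp_om [simp]: "emp \<in> ext om"
  using isomega_om by (rule emp_in_omega)

lemma succ_om [simp]: "k \<in> ext om \<Longrightarrow> succ k \<in> ext om"
  using isomega_om unfolding isomega_def by blast

lemma om_cases: "k \<in> ext om \<Longrightarrow> k = emp \<or> (\<exists>j\<in>ext om. k = succ j)"
  using isomega_om unfolding isomega_def by blast

lemma om_linear: "j \<in> ext om \<Longrightarrow> k \<in> ext om \<Longrightarrow> j \<in> ext k \<or> j = k \<or> k \<in> ext j"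
  using isomega_om unfolding isomega_def isord_def linear_def by blast

lemma om_trans: "j \<in> ext om \<Longrightarrow> i \<in> ext j \<Longrightarrow> i \<in> ext om"
  using isomega_om unfolding isomega_def isord_def transv_def by blast

lemma om_induct [consumes 2, case_names dfn emp succ]:
  assumes N: "tmod N" and om: "k \<in> ext om" "dfn N (\<lambda>e. Q (e 0))"
    and "om \<in> ext N" "Q emp" "\<And>k. k \<in> ext om \<Longrightarrow> Q k \<Longrightarrow> Q (succ k)"
  shows "Q k"
  using N assms(4) om(2,1)
proof (rule mem_induct)
  fix k assume "k \<in> ext om" "\<And>y. y \<in> ext k \<Longrightarrow> y \<in> ext om \<Longrightarrow> Q y"
  then show "Q k" using om_cases[of k] assms(5,6) by auto
qed

text \<open>All quantifiers are bounded, so Separation in a model carves \<open>om\<close> out of any inductive set.\<close>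

definition isnat :: "'a \<Rightarrow> bool" where
  "isnat k \<longleftrightarrow> transv k \<and> (\<forall>j\<in>ext (succ k). j = emp \<or> (\<exists>i\<in>ext j. j = succ i))"

lemma dfn_isnat: "tmod M \<Longrightarrow> dfn M (\<lambda>e. isnat (e 0))"
  unfolding isnat_def transv_def by (intro dfn_intros)

lemma om_isnat:
  assumes "k \<in> ext om" shows "isnat k"
proof -
  obtain N where N: "tmod N" "om \<in> ext N" using ex_tmod[of "{om}"] by auto
  show ?thesis
  proof (rule om_induct[OF N(1) assms dfn_isnat[OF N(1)] N(2)])
    show "isnat emp" by (simp add: isnat_def transv_def)
    show "isnat (succ k)" if "isnat k" for k
      using that unfolding isnat_def transv_def by auto
  qed
qed

text \<open>Induction on membership. A transitive model \<open>M\<close> containing \<open>k\<close>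
  stands in for the transitive closure of \<open>k\<close>, and \<open>N\<close> contains
  \<open>M\<close> so that the induction can run over all of its elements.\<close>

lemma isnat_om:
  assumes "isnat k" shows "k \<in> ext om"
proof -
  obtain M where M: "tmod M" "k \<in> ext M" using ex_tmod[of "{k}"] by auto
  obtain N where N: "tmod N" "om \<in> ext N" "M \<in> ext N" using ex_tmod[of "{om, M}"] by auto
  have "isnat k \<longrightarrow> k \<in> ext om"
  proof (rule mem_induct[OF N(1,3) _ M(2)])
    show "dfn N (\<lambda>e. isnat (e 0) \<longrightarrow> e 0 \<in> ext om)"
      by (intro dfn_imp dfn_isnat dfn_intros[OF N(1)] N)
    fix x assume x: "x \<in> ext M" and IH: "\<And>y. y \<in> ext x \<Longrightarrow> y \<in> ext M \<Longrightarrow> isnat y \<longrightarrow> y \<in> ext om"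
    show "isnat x \<longrightarrow> x \<in> ext om"
    proof
      assume n: "isnat x"
      then consider "x = emp" | i where "i \<in> ext x" "x = succ i" unfolding isnat_def by auto
      then show "x \<in> ext om"
      proof cases
        case 2
        have "transv i" unfolding transv_def
        proof (intro ballI subsetI)
          fix y z assume "y \<in> ext i" "z \<in> ext y"
          moreover then have "z \<in> ext x" using n 2 unfolding isnat_def transv_def by auto
          ultimately show "z \<in> ext i" using 2(2) mem_asym by auto
        qed
        then have "isnat i" using n 2(2) unfolding isnat_def by auto
        then show ?thesis using IH[OF 2(1)] tmod_trans[OF M(1) x 2(1)] 2(2) by simp
      qed simp
    qed
  qed
  then show ?thesis using assms by blast
qed

text \<open>Some inductive set lies in \<open>M\<close>; it includes omega, and \<open>isnat\<close>
  cuts it down to omega. Hence all models share the omega of \<open>V\<close>.\<close>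

lemma tmod_om: "tmod M \<Longrightarrow> om \<in> ext M"
proof -
  assume M: "tmod M"
  then obtain x where x: "x \<in> ext M" "emp \<in> ext x" "\<forall>y\<in>ext x. succ y \<in> ext x"
    unfolding tmod_def by blast
  have "{k \<in> ext x. isnat k} = ext om"
    using omega_subset[OF isomega_om x(2)] x(3) om_isnat isnat_om by blast
  then show ?thesis using tmod_sep[OF M x(1) dfn_isnat[OF M]] by simp
qed

section \<open>Internal formulas and assignments\<close>

definition step_formulas :: "'a \<Rightarrow> 'a \<Rightarrow> 'a" where
  "step_formulas n X = join
     (join (cart (upair (num 0) (num 0)) (cart n n)) (cart (upair (num 1) (num 1)) (cart n n)))
     (join (cart (upair (num 2) (num 2)) (cart X X)) (cart (upair (num 3) (num 3)) (cart n X)))"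

text \<open>A product with the singleton of a tag consists of the codes with that tag. One round of
  formula building thus becomes a definable operation, to which recursion along omega
  applies.\<close>

lemma ext_step_formulas:
  assumes M: "tmod M" "n \<in> ext M" "X \<in> ext M"
  shows "ext (step_formulas n X) =
    {code 0 i j | i j. i \<in> ext n \<and> j \<in> ext n} \<union> {code 1 i j | i j. i \<in> ext n \<and> j \<in> ext n} \<union>
    {code 2 x y | x y. x \<in> ext X \<and> y \<in> ext X} \<union> {code 3 i x | i x. i \<in> ext n \<and> x \<in> ext X}"
proof -
  have "ext (cart (upair (num k) (num k)) (cart a b)) = {code k x y | x y. x \<in> ext a \<and> y \<in> ext b}"
    if "a \<in> ext M" "b \<in> ext M" for a b k
  proof -
    have "upair (num k) (num k) \<in> ext M" "cart a b \<in> ext M"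
      using tmod_num[OF M(1)] tmod_upair[OF M(1)] tmod_cart[OF M(1) that] by blast+
    then show ?thesis unfolding code_def ext_cart[OF M(1) that] ext_cart[OF M(1) \<open>upair (num k) (num k) \<in> ext M\<close> \<open>cart a b \<in> ext M\<close>]
      by auto
  qed
  note * = this
  show ?thesis
    unfolding step_formulas_def ext_join *[OF M(2,2)] *[OF M(3,3)] *[OF M(2,3)] by (rule Un_assoc[symmetric])
qed

lemma formulas_ex:
  assumes M: "tmod M" and n: "n \<in> ext M"
  shows "\<exists>F\<in>ext M. isF n F"
proof -
  note om = tmod_om[OF M]
  \<comment> \<open>Stage \<open>k\<close> is built from the union of all earlier stages, so stage
    \<open>emp\<close> consists of the atomic codes.\<close>
  have "\<exists>g\<in>ext M. \<forall>k\<in>ext om. app g k = step_formulas n (Uni (col (app g ` ext k)))"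
  proof (rule recursion[OF M om, of "\<lambda>x y. x \<in> ext y"])
    show "dfn M (\<lambda>e. e 0 \<in> ext (e (Suc 0)))" by (intro dfn_intros[OF M])
    show "\<exists>x\<in>ext Z. \<forall>y\<in>ext Z. y \<notin> ext x" if "ext Z \<noteq> {}" for Z using regularity[OF that] .
    show "Fdef M (\<lambda>e. step_formulas n (Uni (col (app (e (Suc 0)) ` ext (e 0)))))"
      unfolding step_formulas_def by (intro dfn_intros[OF M] n)
    show "step_formulas n (Uni (col (app g ` ext x))) = step_formulas n (Uni (col (app g' ` ext x)))"
      if "x \<in> ext om" "\<And>y. y \<in> ext om \<Longrightarrow> y \<in> ext x \<Longrightarrow> app g y = app g' y" for x g g'
      using that om_trans by (metis image_cong)
  qed
  then obtain g where g: "g \<in> ext M"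
    "\<And>k. k \<in> ext om \<Longrightarrow> app g k = step_formulas n (Uni (col (app g ` ext k)))" by blast
  have dg: "Fdef M (\<lambda>e. app g (e 0))" by (intro dfn_intros[OF M] g)
  have U: "ext (Uni (col (app g ` ext k))) = (\<Union>j\<in>ext k. ext (app g j))"
    "Uni (col (app g ` ext k)) \<in> ext M" if "k \<in> ext M" for k
    using ext_repl[OF M that dg] tmod_repl[OF M that dg] M by simp_all
  have h: "ext (app g k) = {code 0 i j | i j. i \<in> ext n \<and> j \<in> ext n} \<union>
      {code 1 i j | i j. i \<in> ext n \<and> j \<in> ext n} \<union>
      {code 2 x y | x y. x \<in> (\<Union>j\<in>ext k. ext (app g j)) \<and> y \<in> (\<Union>j\<in>ext k. ext (app g j))} \<union>
      {code 3 i x | i x. i \<in> ext n \<and> x \<in> (\<Union>j\<in>ext k. ext (app g j))}" if "k \<in> ext om" for k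
  proof -
    have k: "k \<in> ext M" using tmod_trans[OF M om that] .
    show ?thesis unfolding g(2)[OF that] ext_step_formulas[OF M n U(2)[OF k]] U(1)[OF k] by (rule refl)
  qed
  define F where "F = Uni (col (app g ` ext om))"
  have F: "ext F = (\<Union>k\<in>ext om. ext (app g k))" "F \<in> ext M"
    unfolding F_def using U[OF om] by simp_all
  have "isF n F" unfolding isF_def
  proof (intro conjI allI impI)
    show "fclosed n (ext F)" unfolding fclosed_def
    proof (intro conjI ballI)
      fix i j assume "i \<in> ext n" "j \<in> ext n"
      then show "code 0 i j \<in> ext F" "code 1 i j \<in> ext F"
        unfolding F(1) using h[OF emp_om] by (auto intro!: bexI[OF _ emp_om])
    next
      fix x y assume "x \<in> ext F" "y \<in> ext F"
      then obtain j k where jk: "j \<in> ext om" "x \<in> ext (app g j)" "k \<in> ext om" "y \<in> ext (app g k)"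
        unfolding F(1) by blast
      \<comment> \<open>By linearity of omega, the successor of the larger of \<open>j\<close> and
        \<open>k\<close> is a stage above both.\<close>
      then obtain m where "m \<in> ext om" "j \<in> ext m" "k \<in> ext m"
        using om_linear[OF jk(1,3)] that[of "succ j"] that[of "succ k"] by auto
      then have "code 2 x y \<in> ext (app g m)" unfolding h[OF \<open>m \<in> ext om\<close>] using jk by blast
      then show "code 2 x y \<in> ext F" unfolding F(1) using \<open>m \<in> ext om\<close> by blast
    next
      fix i x assume "i \<in> ext n" "x \<in> ext F"
      then obtain j where j: "j \<in> ext om" "x \<in> ext (app g j)" unfolding F(1) by blast
      then have "code 3 i x \<in> ext (app g (succ j))" unfolding h[OF succ_om[OF j(1)]] ext_succ using \<open>i \<in> ext n\<close> by blast
      then show "code 3 i x \<in> ext F" unfolding F(1) using succ_om[OF j(1)] by blast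
    qed
    fix G assume G: "fclosed n (ext G)"
    \<comment> \<open>Minimality of \<open>F\<close> is required against every \<open>G\<close> of
      \<open>V\<close>, also outside \<open>M\<close>; a model containing both carries out the
      induction on stages.\<close>
    obtain N where N: "tmod N" "M \<in> ext N" "G \<in> ext N" using ex_tmod[of "{M, G}"] by auto
    have gN: "g \<in> ext N" using tmod_trans[OF N(1,2) g(1)] .
    have "ext (app g k) \<subseteq> ext G" if "k \<in> ext om" for k
    proof (rule mem_induct[OF N(1) tmod_om[OF N(1)] _ that])
      show "dfn N (\<lambda>e. ext (app g (e 0)) \<subseteq> ext G)" by (intro dfn_intros[OF N(1)] gN N)
      fix k assume k: "k \<in> ext om" and IH: "\<And>y. y \<in> ext k \<Longrightarrow> y \<in> ext om \<Longrightarrow> ext (app g y) \<subseteq> ext G"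
      have "(\<Union>j\<in>ext k. ext (app g j)) \<subseteq> ext G" using IH om_trans[OF k] by blast
      then show "ext (app g k) \<subseteq> ext G" unfolding h[OF k] using G unfolding fclosed_def by blast
    qed
    then show "ext F \<subseteq> ext G" unfolding F(1) by blast
  qed
  then show ?thesis using F(2) by blast
qed

text \<open>All quantifiers on the right are bounded by \<open>s\<close>, \<open>n\<close> or
  \<open>A\<close>, the form required by \<open>dfn_intros\<close>.\<close>

lemma isfunto_iff: "isfunto s n A \<longleftrightarrow>
    (\<forall>p\<in>ext s. \<exists>x\<in>ext n. \<exists>y\<in>ext A. p = opair x y) \<and>
    (\<forall>x\<in>ext n. \<exists>y\<in>ext A. opair x y \<in> ext s \<and> (\<forall>z\<in>ext A. opair x z \<in> ext s \<longrightarrow> z = y))"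
proof
  assume "isfunto s n A"
  then show "(\<forall>p\<in>ext s. \<exists>x\<in>ext n. \<exists>y\<in>ext A. p = opair x y) \<and>
    (\<forall>x\<in>ext n. \<exists>y\<in>ext A. opair x y \<in> ext s \<and> (\<forall>z\<in>ext A. opair x z \<in> ext s \<longrightarrow> z = y))"
    unfolding isfunto_def isfun_def by metis
next
  assume r: "(\<forall>p\<in>ext s. \<exists>x\<in>ext n. \<exists>y\<in>ext A. p = opair x y) \<and>
    (\<forall>x\<in>ext n. \<exists>y\<in>ext A. opair x y \<in> ext s \<and> (\<forall>z\<in>ext A. opair x z \<in> ext s \<longrightarrow> z = y))"
  then have "y \<in> ext A" if "opair x y \<in> ext s" for x y using that by fastforce
  then show "isfunto s n A" using r unfolding isfunto_def isfun_def by meson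
qed

text \<open>Each restriction of \<open>s\<close> to an initial segment arises from the previous one
  by adding a pair of elements of \<open>M\<close>. As \<open>n\<close> may be nonstandard, this
  induction runs in a model that contains both \<open>M\<close> and \<open>s\<close>. It makes the
  set of assignments absolute.\<close>

lemma finite_sequence_in:
  assumes M: "tmod M" and n: "n \<in> ext om" and A: "A \<in> ext M" and s: "isfunto s n A"
  shows "s \<in> ext M"
proof -
  obtain N where N: "tmod N" "M \<in> ext N" "s \<in> ext N" using ex_tmod[of "{M, s}"] by auto
  have om: "om \<in> ext M" "om \<in> ext N" using tmod_om M N by blast+
  have nM: "n \<in> ext M" using tmod_trans[OF M om(1) n] .
  have AN: "A \<in> ext N" "n \<in> ext N" using tmod_trans[OF N(1,2)] A nM by blast+
  \<comment> \<open>The restriction of \<open>s\<close> to \<open>k\<close> is an element of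
    \<open>M\<close>; describing it through its members in \<open>M\<close> keeps \<open>?Q\<close>
    definable over \<open>N\<close>.\<close>
  let ?Q = "\<lambda>k. ext k \<subseteq> ext n \<longrightarrow>
    (\<exists>t\<in>ext M. \<forall>p\<in>ext M. p \<in> ext t \<longleftrightarrow> p \<in> ext s \<and> (\<exists>j\<in>ext k. \<exists>y\<in>ext A. p = opair j y))"
  have "?Q n"
  proof (rule om_induct[where Q = ?Q, OF N(1) n _ om(2)])
    show "dfn N (\<lambda>e. ?Q (e 0))" by (intro dfn_intros[OF N(1)] N AN)
    show "?Q emp" by (intro impI bexI[OF _ tmod_emp[OF M]]) simp
    fix k assume "k \<in> ext om" and IH: "?Q k"
    show "?Q (succ k)"
    proof
      assume sub: "ext (succ k) \<subseteq> ext n"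
      then obtain t where t: "t \<in> ext M"
        "\<forall>p\<in>ext M. p \<in> ext t \<longleftrightarrow> p \<in> ext s \<and> (\<exists>j\<in>ext k. \<exists>y\<in>ext A. p = opair j y)"
        using IH by auto
      obtain y where y: "y \<in> ext A" "opair k y \<in> ext s" "\<And>z. z \<in> ext A \<Longrightarrow> opair k z \<in> ext s \<Longrightarrow> z = y"
      proof -
        have "k \<in> ext n" using sub by simp
        then show thesis using s that unfolding isfunto_iff by blast
      qed
      have "k \<in> ext M" using sub tmod_trans[OF M nM] by simp
      then have op: "opair k y \<in> ext M" using tmod_trans[OF M A y(1)] tmod_opair[OF M] by blast
      let ?t = "join t (upair (opair k y) (opair k y))"
      have "?t \<in> ext M" using tmod_join[OF M t(1) tmod_upair[OF M op op]] .
      moreover have "p \<in> ext ?t \<longleftrightarrow> p \<in> ext s \<and> (\<exists>j\<in>ext (succ k). \<exists>y\<in>ext A. p = opair j y)"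
        if "p \<in> ext M" for p
      proof -
        have "p \<in> ext t \<longleftrightarrow> p \<in> ext s \<and> (\<exists>j\<in>ext k. \<exists>y\<in>ext A. p = opair j y)"
          using t(2) that by blast
        then show ?thesis unfolding ext_join ext_upair ext_succ Un_iff using y by blast
      qed
      ultimately show "\<exists>t\<in>ext M. \<forall>p\<in>ext M. p \<in> ext t \<longleftrightarrow>
          p \<in> ext s \<and> (\<exists>j\<in>ext (succ k). \<exists>y\<in>ext A. p = opair j y)" by blast
    qed
  qed
  then obtain t where t: "t \<in> ext M"
    "\<forall>p\<in>ext M. p \<in> ext t \<longleftrightarrow> p \<in> ext s \<and> (\<exists>j\<in>ext n. \<exists>y\<in>ext A. p = opair j y)" by blast
  have sp: "\<exists>j\<in>ext n. \<exists>y\<in>ext A. p = opair j y" if "p \<in> ext s" for p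
    using s that unfolding isfunto_iff by blast
  have sM: "p \<in> ext M" if "p \<in> ext s" for p
    using sp[OF that] tmod_trans[OF M nM] tmod_trans[OF M A] tmod_opair[OF M] by blast
  have "s = t"
  proof (rule extensional, rule set_eqI)
    fix p show "p \<in> ext s \<longleftrightarrow> p \<in> ext t"
      using t(2) sp[of p] sM[of p] tmod_trans[OF M t(1), of p] by blast
  qed
  then show ?thesis using t(1) by simp
qed

lemma assignments_ex:
  assumes M: "tmod M" and n: "n \<in> ext om" and A: "A \<in> ext M"
  shows "\<exists>P\<in>ext M. isP n A P"
proof -
  have nM: "n \<in> ext M" using tmod_trans[OF M tmod_om[OF M] n] .
  have C: "pw M (cart n A) \<in> ext M" using M nM A tmod_pw tmod_cart by simp
  have d: "dfn M (\<lambda>e. isfunto (e 0) n A)"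
    unfolding isfunto_iff by (intro dfn_intros[OF M] nM A)
  have sub: "ext s \<subseteq> ext (cart n A)" if "isfunto s n A" for s
    using that unfolding isfunto_iff ext_cart[OF M nM A] by blast
  have "ext (col {s \<in> ext (pw M (cart n A)). isfunto s n A}) = {s \<in> ext (pw M (cart n A)). isfunto s n A}"
    by (rule ext_sep[OF M C d])
  also have "\<dots> = {s. isfunto s n A}"
    unfolding ext_pw[OF M tmod_cart[OF M nM A]] using sub finite_sequence_in[OF M n A] by blast
  finally show ?thesis unfolding isP_def using tmod_sep[OF M C d] by blast
qed

section \<open>Satisfaction relations: uniqueness, existence and absoluteness\<close>

lemma formulas_induct:
  assumes F: "isF n F" and N: "tmod N" "F \<in> ext N" "dfn N (\<lambda>e. Q (e 0))"
    and "\<And>i j. i \<in> ext n \<Longrightarrow> j \<in> ext n \<Longrightarrow> Q (code 0 i j)"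
    and "\<And>i j. i \<in> ext n \<Longrightarrow> j \<in> ext n \<Longrightarrow> Q (code 1 i j)"
    and "\<And>x y. x \<in> ext F \<Longrightarrow> y \<in> ext F \<Longrightarrow> Q x \<Longrightarrow> Q y \<Longrightarrow> Q (code 2 x y)"
    and "\<And>i x. i \<in> ext n \<Longrightarrow> x \<in> ext F \<Longrightarrow> Q x \<Longrightarrow> Q (code 3 i x)"
    and c: "c \<in> ext F"
  shows "Q c"
proof -
  have eq: "ext (col {c \<in> ext F. Q c}) = {c \<in> ext F. Q c}" by (rule ext_sep[OF N])
  have "fclosed n (ext (col {c \<in> ext F. Q c}))"
    unfolding eq using F assms(5-8) unfolding isF_def fclosed_def by simp
  then have "ext F \<subseteq> {c \<in> ext F. Q c}" using F eq unfolding isF_def by metis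
  then show ?thesis using c by blast
qed

lemma formulas_unique: "isF n F \<Longrightarrow> isF n F' \<Longrightarrow> F = F'"
  unfolding isF_def by (intro extensional equalityI) blast+

lemma assignments_unique: "isP n A P \<Longrightarrow> isP n A P' \<Longrightarrow> P = P'"
  unfolding isP_def by (intro extensional) simp

text \<open>Tarski's clauses determine the relation by induction on formulas, carried out in a model
  containing both candidates. A satisfaction relation found in a model is therefore the one of
  \<open>V\<close>.\<close>

lemma issat_unique:
  assumes S: "issat n A F P S" and S': "issat n A F' P' S'"
  shows "F = F'" "P = P'" "S = S'"
proof -
  show F: "F = F'" using S S' formulas_unique unfolding issat_def by blast
  show P: "P = P'" using S S' assignments_unique unfolding issat_def by blast
  note S' = S'[folded F P]
  obtain N where N: "tmod N" "F \<in> ext N" "P \<in> ext N" "S \<in> ext N" "S' \<in> ext N"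
    using ex_tmod[of "{F, P, S, S'}"] by auto
  have eq: "\<forall>s\<in>ext P. opair c s \<in> ext S \<longleftrightarrow> opair c s \<in> ext S'" if "c \<in> ext F" for c
  proof (rule formulas_induct[OF _ N(1,2) _ _ _ _ _ that])
    show "isF n F" using S unfolding issat_def by blast
    show "dfn N (\<lambda>e. \<forall>s\<in>ext P. opair (e 0) s \<in> ext S \<longleftrightarrow> opair (e 0) s \<in> ext S')"
      by (intro dfn_intros[OF N(1)] N)
    show "\<forall>s\<in>ext P. opair (code 0 i j) s \<in> ext S \<longleftrightarrow> opair (code 0 i j) s \<in> ext S'"
      if "i \<in> ext n" "j \<in> ext n" for i j
      using that by (simp add: issat_T0[OF S] issat_T0[OF S'])
    show "\<forall>s\<in>ext P. opair (code 1 i j) s \<in> ext S \<longleftrightarrow> opair (code 1 i j) s \<in> ext S'"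
      if "i \<in> ext n" "j \<in> ext n" for i j
      using that by (simp add: issat_T1[OF S] issat_T1[OF S'] del: One_nat_def)
    show "\<forall>s\<in>ext P. opair (code 2 x y) s \<in> ext S \<longleftrightarrow> opair (code 2 x y) s \<in> ext S'"
      if "x \<in> ext F" "y \<in> ext F" "\<forall>s\<in>ext P. opair x s \<in> ext S \<longleftrightarrow> opair x s \<in> ext S'"
        "\<forall>s\<in>ext P. opair y s \<in> ext S \<longleftrightarrow> opair y s \<in> ext S'" for x y
      using that by (simp add: issat_T2[OF S] issat_T2[OF S'])
    show "\<forall>s\<in>ext P. opair (code 3 i x) s \<in> ext S \<longleftrightarrow> opair (code 3 i x) s \<in> ext S'"
      if "i \<in> ext n" "x \<in> ext F" "\<forall>s\<in>ext P. opair x s \<in> ext S \<longleftrightarrow> opair x s \<in> ext S'" for i x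
      using that by (simp add: issat_T3[OF S] issat_T3[OF S'])
  qed
  have sub: "\<exists>c\<in>ext F. \<exists>s\<in>ext P. z = opair c s" if "z \<in> ext S \<or> z \<in> ext S'" for z
    using S S' that unfolding issat_def tarski_def by blast
  show "S = S'"
  proof (rule extensional, rule set_eqI)
    fix z show "z \<in> ext S \<longleftrightarrow> z \<in> ext S'" using sub[of z] eq by blast
  qed
qed

text \<open>Recursion along the immediate subformula relation \<open>R\<close>, with
  \<open>app g c\<close> the set of assignments that satisfy \<open>c\<close>; the resulting pairs
  are then collected into \<open>S\<close>.\<close>

lemma satisfaction_ex:
  assumes M: "tmod M" and n: "n \<in> ext om" and A: "A \<in> ext M"
  shows "\<exists>F\<in>ext M. \<exists>P\<in>ext M. \<exists>S\<in>ext M. issat n A F P S"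
proof -
  have nM: "n \<in> ext M" using tmod_trans[OF M tmod_om[OF M] n] .
  obtain F where F: "F \<in> ext M" "isF n F" using formulas_ex[OF M nM] by blast
  obtain P where P: "P \<in> ext M" "isP n A P" using assignments_ex[OF M n A] by blast
  have Fc: "i \<in> ext n \<Longrightarrow> j \<in> ext n \<Longrightarrow> code 0 i j \<in> ext F" "i \<in> ext n \<Longrightarrow> j \<in> ext n \<Longrightarrow> code 1 i j \<in> ext F"
    "x \<in> ext F \<Longrightarrow> y \<in> ext F \<Longrightarrow> code 2 x y \<in> ext F" "i \<in> ext n \<Longrightarrow> x \<in> ext F \<Longrightarrow> code 3 i x \<in> ext F"
    for i j x y
    using F(2) unfolding isF_def fclosed_def by simp_all
  define R where "R d c \<longleftrightarrow> (\<exists>b\<in>ext F. c = code 2 d b \<or> c = code 2 b d) \<or> (\<exists>i\<in>ext n. c = code 3 i d)" for d c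
  \<comment> \<open>Tarski's clauses with all quantifiers bounded; the truth of immediate
    subformulas is looked up in \<open>g\<close>.\<close>
  define C where "C c g s \<longleftrightarrow>
    (\<exists>i\<in>ext n. \<exists>j\<in>ext n. c = code 0 i j \<and>
       (\<exists>x\<in>ext A. \<exists>y\<in>ext A. opair i x \<in> ext s \<and> opair j y \<in> ext s \<and> x \<in> ext y)) \<or>
    (\<exists>i\<in>ext n. \<exists>j\<in>ext n. c = code 1 i j \<and> (\<exists>x\<in>ext A. opair i x \<in> ext s \<and> opair j x \<in> ext s)) \<or>
    (\<exists>d\<in>ext F. \<exists>b\<in>ext F. c = code 2 d b \<and> \<not> (s \<in> ext (app g d) \<and> s \<in> ext (app g b))) \<or>
    (\<exists>i\<in>ext n. \<exists>d\<in>ext F. c = code 3 i d \<and> (\<forall>a\<in>ext A. \<forall>t\<in>ext P.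
       opair i a \<in> ext t \<and> (\<forall>j\<in>ext n. j \<noteq> i \<longrightarrow> (\<forall>x\<in>ext A. opair j x \<in> ext t \<longleftrightarrow> opair j x \<in> ext s))
       \<longrightarrow> t \<in> ext (app g d)))" for c g s
  have "\<exists>g\<in>ext M. \<forall>c\<in>ext F. app g c = col {s \<in> ext P. C c g s}"
  proof (rule recursion[OF M F(1), of R])
    show "dfn M (\<lambda>e. R (e 0) (e (Suc 0)))" unfolding R_def by (intro dfn_intros[OF M] F nM)
    show "Fdef M (\<lambda>e. col {s \<in> ext P. C (e 0) (e (Suc 0)) s})"
      unfolding C_def by (intro dfn_intros[OF M] F nM A P)
    show "\<exists>x\<in>ext Z. \<forall>y\<in>ext Z. \<not> R y x" if Z: "Z \<in> ext M" "ext Z \<subseteq> ext F" "ext Z \<noteq> {}" for Z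
    proof (rule ccontr)
      assume no: "\<not> (\<exists>x\<in>ext Z. \<forall>y\<in>ext Z. \<not> R y x)"
      \<comment> \<open>Every member of \<open>Z\<close> would have an immediate subformula in
        \<open>Z\<close>, so induction on formulas keeps all formulas out of
        \<open>Z\<close>.\<close>
      have "c \<notin> ext Z" if "c \<in> ext F" for c
      proof (rule formulas_induct[OF F(2) M F(1) _ _ _ _ _ that])
        show "dfn M (\<lambda>e. e 0 \<notin> ext Z)" by (intro dfn_intros[OF M] Z)
      qed (use no R_def in auto)
      then show False using Z by blast
    qed
    fix c g g' assume c: "c \<in> ext F" and eq: "\<And>d. d \<in> ext F \<Longrightarrow> R d c \<Longrightarrow> app g d = app g' d"
    have "C c g s \<longleftrightarrow> C c g' s" for s
    proof -
      have "app g d = app g' d \<and> app g b = app g' b" if "d \<in> ext F" "b \<in> ext F" "c = code 2 d b" for d b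
        using that eq unfolding R_def by blast
      moreover have "app g d = app g' d" if "d \<in> ext F" "i \<in> ext n" "c = code 3 i d" for d i
        using that eq unfolding R_def by blast
      ultimately show ?thesis unfolding C_def by (simp cong: conj_cong bex_cong)
    qed
    then show "col {s \<in> ext P. C c g s} = col {s \<in> ext P. C c g' s}" by simp
  qed
  then obtain g where g: "g \<in> ext M" "\<And>c. c \<in> ext F \<Longrightarrow> app g c = col {s \<in> ext P. C c g s}" by blast
  have g': "s \<in> ext (app g c) \<longleftrightarrow> C c g s" if "c \<in> ext F" "s \<in> ext P" for c s
  proof -
    have "dfn M (\<lambda>e. C c g (e 0))"
      unfolding C_def by (intro dfn_intros[OF M] F nM A P g tmod_trans[OF M F(1) that(1)])
    then have "ext (app g c) = {s \<in> ext P. C c g s}"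
      unfolding g(2)[OF that(1)] by (rule ext_sep[OF M P(1)])
    then show ?thesis using that by blast
  qed
  have FP: "cart F P \<in> ext M" using tmod_cart[OF M F(1) P(1)] .
  have dS: "dfn M (\<lambda>e. \<exists>c\<in>ext F. \<exists>s\<in>ext P. e 0 = opair c s \<and> s \<in> ext (app g c))"
    by (intro dfn_intros[OF M] F P g)
  define S where "S = col {z \<in> ext (cart F P). \<exists>c\<in>ext F. \<exists>s\<in>ext P. z = opair c s \<and> s \<in> ext (app g c)}"
  have S: "S \<in> ext M" unfolding S_def by (rule tmod_sep[OF M FP dS])
  have extS: "ext S = {z. \<exists>c\<in>ext F. \<exists>s\<in>ext P. z = opair c s \<and> s \<in> ext (app g c)}"
    using ext_sep[OF M FP dS] ext_cart[OF M F(1) P(1)] unfolding S_def[symmetric] by blast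
  have inS: "opair c s \<in> ext S \<longleftrightarrow> C c g s" if "c \<in> ext F" "s \<in> ext P" for c s
    unfolding extS using that g' by auto
  have fs: "isfunto s n A" if "s \<in> ext P" for s using that P(2) unfolding isP_def by simp
  have sA: "x \<in> ext A" if "s \<in> ext P" "opair i x \<in> ext s" for s i x
    using fs[OF that(1)] that(2) unfolding isfunto_def by blast
  have "tarski n A F P S" unfolding tarski_def
  proof (intro conjI ballI)
    show "\<exists>c\<in>ext F. \<exists>s\<in>ext P. z = opair c s" if "z \<in> ext S" for z
      using that unfolding extS by blast
    fix s assume s: "s \<in> ext P"
    show "opair (code 0 i j) s \<in> ext S \<longleftrightarrow>
        (\<exists>x y. opair i x \<in> ext s \<and> opair j y \<in> ext s \<and> x \<in> ext y)" if "i \<in> ext n" "j \<in> ext n" for i j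
      unfolding inS[OF Fc(1)[OF that] s] using that sA[OF s] by (auto simp: C_def)
    show "opair (code 1 i j) s \<in> ext S \<longleftrightarrow>
        (\<exists>x. opair i x \<in> ext s \<and> opair j x \<in> ext s)" if "i \<in> ext n" "j \<in> ext n" for i j
      unfolding inS[OF Fc(2)[OF that] s] using that sA[OF s] by (auto simp: C_def)
    show "opair (code 2 d c) s \<in> ext S \<longleftrightarrow> \<not> (opair d s \<in> ext S \<and> opair c s \<in> ext S)"
      if "d \<in> ext F" "c \<in> ext F" for d c
      unfolding inS[OF Fc(3)[OF that] s] inS[OF that(1) s] inS[OF that(2) s]
        g'[OF that(1) s, symmetric] g'[OF that(2) s, symmetric]
      using that by (auto simp: C_def)
    show "opair (code 3 i d) s \<in> ext S \<longleftrightarrow>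
        (\<forall>a\<in>ext A. \<forall>t\<in>ext P. isupd n t s i a \<longrightarrow> opair d t \<in> ext S)"
      if "i \<in> ext n" "d \<in> ext F" for i d
    proof -
      have upd: "isupd n t s i a \<longleftrightarrow> opair i a \<in> ext t \<and> (\<forall>j\<in>ext n. j \<noteq> i \<longrightarrow>
          (\<forall>x\<in>ext A. opair j x \<in> ext t \<longleftrightarrow> opair j x \<in> ext s))" if "t \<in> ext P" for t a
        unfolding isupd_def using sA[OF that] sA[OF s] by blast
      have "opair d t \<in> ext S \<longleftrightarrow> t \<in> ext (app g d)" if "t \<in> ext P" for t
        using inS[OF \<open>d \<in> ext F\<close> that] g'[OF \<open>d \<in> ext F\<close> that] by simp
      then show ?thesis
        unfolding inS[OF Fc(4)[OF that] s] using that by (simp add: C_def upd)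
    qed
  qed
  then show ?thesis using F P S unfolding issat_def by blast
qed

text \<open>Satisfaction with all quantifiers bounded, so that it is visibly definable over \<open>M\<close>.\<close>

definition issat_in :: "'a \<Rightarrow> 'a \<Rightarrow> 'a \<Rightarrow> 'a \<Rightarrow> 'a \<Rightarrow> 'a \<Rightarrow> bool" where
  "issat_in M n A F P S \<longleftrightarrow>
     fclosed n (ext F) \<and> (\<forall>G\<in>ext M. fclosed n (ext G) \<longrightarrow> ext F \<subseteq> ext G) \<and>
     (\<forall>s\<in>ext M. s \<in> ext P \<longleftrightarrow> isfunto s n A) \<and>
     (\<forall>z\<in>ext S. \<exists>c\<in>ext F. \<exists>s\<in>ext P. z = opair c s) \<and>
     (\<forall>s\<in>ext P.
       (\<forall>i\<in>ext n. \<forall>j\<in>ext n. opair (code 0 i j) s \<in> ext S \<longleftrightarrow>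
          (\<exists>x\<in>ext A. \<exists>y\<in>ext A. opair i x \<in> ext s \<and> opair j y \<in> ext s \<and> x \<in> ext y)) \<and>
       (\<forall>i\<in>ext n. \<forall>j\<in>ext n. opair (code 1 i j) s \<in> ext S \<longleftrightarrow>
          (\<exists>x\<in>ext A. opair i x \<in> ext s \<and> opair j x \<in> ext s)) \<and>
       (\<forall>d\<in>ext F. \<forall>c\<in>ext F. opair (code 2 d c) s \<in> ext S \<longleftrightarrow>
          \<not> (opair d s \<in> ext S \<and> opair c s \<in> ext S)) \<and>
       (\<forall>i\<in>ext n. \<forall>d\<in>ext F. opair (code 3 i d) s \<in> ext S \<longleftrightarrow>
          (\<forall>a\<in>ext A. \<forall>t\<in>ext P. opair i a \<in> ext t \<and> (\<forall>j\<in>ext n. j \<noteq> i \<longrightarrow>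
             (\<forall>x\<in>ext A. opair j x \<in> ext t \<longleftrightarrow> opair j x \<in> ext s)) \<longrightarrow> opair d t \<in> ext S)))"

text \<open>The unbounded quantifiers of \<open>issat\<close> may be bounded because the true set of
  formulas is in \<open>M\<close> by \<open>formulas_ex\<close>, all assignments are in
  \<open>M\<close> by \<open>finite_sequence_in\<close>, and values of assignments belong to
  \<open>A\<close>.\<close>

lemma issat_in_iff:
  assumes M: "tmod M" and n: "n \<in> ext om" and A: "A \<in> ext M"
    and FPS: "F \<in> ext M" "P \<in> ext M" "S \<in> ext M"
  shows "issat_in M n A F P S \<longleftrightarrow> issat n A F P S"
proof -
  have nM: "n \<in> ext M" using tmod_trans[OF M tmod_om[OF M] n] .
  have F: "isF n F \<longleftrightarrow> fclosed n (ext F) \<and> (\<forall>G\<in>ext M. fclosed n (ext G) \<longrightarrow> ext F \<subseteq> ext G)"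
  proof
    assume r: "fclosed n (ext F) \<and> (\<forall>G\<in>ext M. fclosed n (ext G) \<longrightarrow> ext F \<subseteq> ext G)"
    obtain F0 where F0: "F0 \<in> ext M" "isF n F0" using formulas_ex[OF M nM] by blast
    then have "ext F = ext F0" using r unfolding isF_def by blast
    then show "isF n F" using F0(2) extensional by metis
  qed (simp add: isF_def)
  have P: "isP n A P \<longleftrightarrow> (\<forall>s\<in>ext M. s \<in> ext P \<longleftrightarrow> isfunto s n A)"
    using finite_sequence_in[OF M n A] tmod_trans[OF M FPS(2)] unfolding isP_def by blast
  have T: "tarski n A F P S \<longleftrightarrow> (\<forall>z\<in>ext S. \<exists>c\<in>ext F. \<exists>s\<in>ext P. z = opair c s) \<and>
     (\<forall>s\<in>ext P.
       (\<forall>i\<in>ext n. \<forall>j\<in>ext n. opair (code 0 i j) s \<in> ext S \<longleftrightarrow>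
          (\<exists>x\<in>ext A. \<exists>y\<in>ext A. opair i x \<in> ext s \<and> opair j y \<in> ext s \<and> x \<in> ext y)) \<and>
       (\<forall>i\<in>ext n. \<forall>j\<in>ext n. opair (code 1 i j) s \<in> ext S \<longleftrightarrow>
          (\<exists>x\<in>ext A. opair i x \<in> ext s \<and> opair j x \<in> ext s)) \<and>
       (\<forall>d\<in>ext F. \<forall>c\<in>ext F. opair (code 2 d c) s \<in> ext S \<longleftrightarrow>
          \<not> (opair d s \<in> ext S \<and> opair c s \<in> ext S)) \<and>
       (\<forall>i\<in>ext n. \<forall>d\<in>ext F. opair (code 3 i d) s \<in> ext S \<longleftrightarrow>
          (\<forall>a\<in>ext A. \<forall>t\<in>ext P. opair i a \<in> ext t \<and> (\<forall>j\<in>ext n. j \<noteq> i \<longrightarrow>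
             (\<forall>x\<in>ext A. opair j x \<in> ext t \<longleftrightarrow> opair j x \<in> ext s)) \<longrightarrow> opair d t \<in> ext S)))"
    if "isP n A P"
  proof -
    have sA: "x \<in> ext A" if "s \<in> ext P" "opair i x \<in> ext s" for s i x
      using \<open>isP n A P\<close> that unfolding isP_def isfunto_def by blast
    have 0: "(\<exists>x y. opair i x \<in> ext s \<and> opair j y \<in> ext s \<and> x \<in> ext y) \<longleftrightarrow>
        (\<exists>x\<in>ext A. \<exists>y\<in>ext A. opair i x \<in> ext s \<and> opair j y \<in> ext s \<and> x \<in> ext y)"
      if "s \<in> ext P" for s i j
      using sA[OF that] by blast
    have 1: "(\<exists>x. opair i x \<in> ext s \<and> opair j x \<in> ext s) \<longleftrightarrow>
        (\<exists>x\<in>ext A. opair i x \<in> ext s \<and> opair j x \<in> ext s)" if "s \<in> ext P" for s i j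
      using sA[OF that] by blast
    have 2: "isupd n t s i a \<longleftrightarrow> opair i a \<in> ext t \<and> (\<forall>j\<in>ext n. j \<noteq> i \<longrightarrow>
             (\<forall>x\<in>ext A. opair j x \<in> ext t \<longleftrightarrow> opair j x \<in> ext s))"
      if "s \<in> ext P" "t \<in> ext P" for s t i a
      unfolding isupd_def using sA[OF that(1)] sA[OF that(2)] by blast
    show ?thesis unfolding tarski_def by (simp only: 0 1 2 cong: ball_cong)
  qed
  show ?thesis
  proof (cases "isP n A P")
    case True
    show ?thesis unfolding issat_in_def issat_def T[OF True] F P[symmetric] by (simp only: conj_assoc True)
  next
    case False
    then show ?thesis unfolding issat_in_def issat_def P[symmetric] by simp
  qed
qed

section \<open>The definable power set as computed in a model\<close>

definition DefM :: "'a \<Rightarrow> 'a \<Rightarrow> 'a" where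
  "DefM M A = col {X \<in> ext (pw M A). \<exists>n\<in>ext om. \<exists>F\<in>ext M. \<exists>P\<in>ext M. \<exists>S\<in>ext M.
     issat_in M (succ n) A F P S \<and> (\<exists>c\<in>ext F. \<exists>s\<in>ext M. isfunto s n A \<and>
       (\<forall>x\<in>ext A. x \<in> ext X \<longleftrightarrow> sat1 P S c n s x))}"

lemma Fdef_DefM:
  assumes M: "tmod M" and t: "Fdef M t"
  shows "Fdef M (\<lambda>e. DefM M (t e))"
proof (rule Fdef_comp2[of M "\<lambda>x y. DefM M x", OF _ t t])
  show "Fdef M (\<lambda>e. DefM M (e 0))"
    unfolding DefM_def issat_in_def fclosed_def isfunto_iff sat1_def
    by (intro dfn_intros[OF M] tmod_om[OF M])
qed

text \<open>The decisive absoluteness. A witness in \<open>V\<close> for the definability of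
  \<open>X\<close> consists of a satisfaction relation, which lies in \<open>M\<close> by existence
  there and uniqueness in \<open>V\<close>, and of a finite parameter sequence, which lies in
  \<open>M\<close> as well. Separation in \<open>M\<close> then yields \<open>X\<close>.\<close>

lemma ext_DefM:
  assumes M: "tmod M" and A: "A \<in> ext M"
  shows "ext (DefM M A) = {X. defin A X}"
proof -
  let ?Q = "\<lambda>X. \<exists>n\<in>ext om. \<exists>F\<in>ext M. \<exists>P\<in>ext M. \<exists>S\<in>ext M.
     issat_in M (succ n) A F P S \<and> (\<exists>c\<in>ext F. \<exists>s\<in>ext M. isfunto s n A \<and>
       (\<forall>x\<in>ext A. x \<in> ext X \<longleftrightarrow> sat1 P S c n s x))"
  have d: "dfn M (\<lambda>e. ?Q (e 0))"
    unfolding issat_in_def fclosed_def isfunto_iff sat1_def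
    by (intro dfn_intros[OF M] tmod_om[OF M] A)
  have ext: "ext (DefM M A) = {X \<in> ext (pw M A). ?Q X}"
    unfolding DefM_def by (rule ext_sep[OF M tmod_pw[OF M A] d])
  show ?thesis
  proof (intro set_eqI iffI)
    fix X assume "X \<in> ext (DefM M A)"
    then have "X \<in> ext (pw M A)" "?Q X" unfolding ext by blast+
    then have sub: "ext X \<subseteq> ext A" unfolding ext_pw[OF M A] by blast
    obtain n F P S c s where n: "n \<in> ext om" and FPS: "F \<in> ext M" "P \<in> ext M" "S \<in> ext M"
      "issat_in M (succ n) A F P S" and c: "c \<in> ext F" "isfunto s n A"
      "\<forall>x\<in>ext A. x \<in> ext X \<longleftrightarrow> sat1 P S c n s x" using \<open>?Q X\<close> by blast
    have X: "ext X = {x \<in> ext A. sat1 P S c n s x}" using sub c(3) by blast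
    have S: "issat (succ n) A F P S"
      using issat_in_iff[OF M succ_om[OF n] A FPS(1-3)] FPS(4) by simp
    have "defin A X" unfolding defin_def
      by (rule exI[of _ om], rule conjI[OF isomega_om], rule bexI[OF _ n], rule conjI[OF succ_om[OF n]],
          rule exI[of _ F], rule exI[of _ P], rule exI[of _ S], rule conjI[OF S],
          rule bexI[OF _ c(1)], rule exI[of _ s], rule conjI[OF c(2) X])
    then show "X \<in> {X. defin A X}" by simp
  next
    fix X assume "X \<in> {X. defin A X}"
    then obtain n F P S c s where n: "n \<in> ext om" and S: "issat (succ n) A F P S"
      and c: "c \<in> ext F" and s: "isfunto s n A" and X: "ext X = {x \<in> ext A. sat1 P S c n s x}"
      unfolding defin_def isomega_iff by blast
    obtain F' P' S' where M': "F' \<in> ext M" "P' \<in> ext M" "S' \<in> ext M" "issat (succ n) A F' P' S'"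
      using satisfaction_ex[OF M succ_om[OF n] A] by blast
    have eq: "F' = F" "P' = P" "S' = S" using issat_unique[OF M'(4) S] by blast+
    note M' = M'[unfolded eq]
    have sM: "s \<in> ext M" by (rule finite_sequence_in[OF M n A s])
    have "n \<in> ext M" using tmod_trans[OF M tmod_om[OF M] n] .
    then have ds: "dfn M (\<lambda>e. sat1 P S c n s (e 0))"
      unfolding sat1_def by (intro dfn_intros[OF M] M' sM tmod_trans[OF M M'(1) c])
    have "X = col {x \<in> ext A. sat1 P S c n s x}" unfolding X[symmetric] by simp
    then have "X \<in> ext M" using tmod_sep[OF M A ds] by simp
    then have "X \<in> ext (pw M A)" unfolding ext_pw[OF M A] using X by blast
    moreover have "issat_in M (succ n) A F P S"
      using issat_in_iff[OF M succ_om[OF n] A M'(1-3)] S by blast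
    moreover have "\<forall>x\<in>ext A. x \<in> ext X \<longleftrightarrow> sat1 P S c n s x" using X by blast
    ultimately show "X \<in> ext (DefM M A)"
      unfolding ext using n M'(1-3) c s sM by blast
  qed
qed

section \<open>Ordinals\<close>

lemma isord_iff: "isord x \<longleftrightarrow> transv x \<and> linear x"
  unfolding isord_def using regularity eq_emp_iff by blast

lemma isord_elem:
  assumes "isord a" "b \<in> ext a" shows "isord b"
proof -
  have a: "transv a" "linear a" using assms(1) isord_iff by blast+
  have sub: "ext b \<subseteq> ext a" using a(1) assms(2) unfolding transv_def by blast
  have "transv b" unfolding transv_def
  proof (intro ballI subsetI)
    fix y z assume yz: "y \<in> ext b" "z \<in> ext y"
    then have "z \<in> ext a" using sub a(1) unfolding transv_def by blast
    then consider "b \<in> ext z" | "b = z" | "z \<in> ext b"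
      using a(2) assms(2) unfolding linear_def by blast
    then show "z \<in> ext b"
    proof cases
      case 1
      \<comment> \<open>Here \<open>b\<close>, \<open>y\<close> and \<open>z\<close> form a
        membership cycle, which foundation excludes.\<close>
      then show ?thesis
        using regularity[of "join (upair b y) (upair z z)"] yz by auto
    next
      case 2
      then show ?thesis using yz mem_asym by blast
    qed
  qed
  moreover have "linear b" using a(2) sub unfolding linear_def by blast
  ultimately show ?thesis using isord_iff by blast
qed

text \<open>A minimal element \<open>m\<close> of \<open>b\<close> outside \<open>I\<close> equals
  \<open>I\<close>: linearity and transitivity put each element of \<open>I\<close> below
  \<open>m\<close>, and minimality puts each element of \<open>m\<close> into
  \<open>I\<close>.\<close>

lemma transitive_subset_ord:
  assumes b: "isord b" and I: "transv I" "ext I \<subseteq> ext b" "I \<noteq> b"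
  shows "I \<in> ext b"
proof -
  obtain N where N: "tmod N" "b \<in> ext N" "I \<in> ext N" using ex_tmod[of "{b, I}"] by auto
  have "dfn N (\<lambda>e. e 0 \<notin> ext I)" by (intro dfn_intros[OF N(1)] N)
  then have D: "ext (col {x \<in> ext b. x \<notin> ext I}) = {x \<in> ext b. x \<notin> ext I}"
    by (rule ext_sep[OF N(1,2)])
  have "{x \<in> ext b. x \<notin> ext I} \<noteq> {}" using I(2,3) extensional by blast
  then obtain m where m: "m \<in> ext b" "m \<notin> ext I" "\<And>z. z \<in> ext b \<Longrightarrow> z \<notin> ext I \<Longrightarrow> z \<notin> ext m"
    using regularity[of "col {x \<in> ext b. x \<notin> ext I}"] unfolding D by blast
  have "ext I = ext m"
  proof (intro equalityI subsetI)
    fix i assume i: "i \<in> ext I"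
    then have "i \<in> ext m \<or> i = m \<or> m \<in> ext i"
      using b m(1) I(2) unfolding isord_def linear_def by blast
    then show "i \<in> ext m" using m(2) i I(1) unfolding transv_def by blast
  next
    fix z assume "z \<in> ext m"
    moreover then have "z \<in> ext b" using m(1) b unfolding isord_def transv_def by blast
    ultimately show "z \<in> ext I" using m(3) by blast
  qed
  then show ?thesis using m(1) extensional by metis
qed

text \<open>The intersection \<open>?I\<close> is a transitive subset of both ordinals; if it
  differed from both, it would belong to both and hence to itself.\<close>

lemma isord_comparable:
  assumes a: "isord a" and b: "isord b"
  shows "a \<in> ext b \<or> a = b \<or> b \<in> ext a"
proof -
  obtain N where N: "tmod N" "a \<in> ext N" "b \<in> ext N" using ex_tmod[of "{a, b}"] by auto
  have "dfn N (\<lambda>e. e 0 \<in> ext b)" by (intro dfn_intros[OF N(1)] N)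
  then have I: "ext (col {x \<in> ext a. x \<in> ext b}) = {x \<in> ext a. x \<in> ext b}" (is "ext ?I = _")
    by (rule ext_sep[OF N(1,2)])
  have tr: "transv ?I" using a b unfolding isord_def transv_def I by blast
  have sub: "ext ?I \<subseteq> ext a" "ext ?I \<subseteq> ext b" unfolding I by blast+
  have "?I = a \<or> ?I = b"
  proof (rule ccontr)
    assume "\<not> (?I = a \<or> ?I = b)"
    then have "?I \<in> ext a" "?I \<in> ext b"
      using transitive_subset_ord[OF a tr sub(1)] transitive_subset_ord[OF b tr sub(2)] by blast+
    then have "?I \<in> ext ?I" unfolding I by blast
    then show False by simp
  qed
  then show ?thesis
    using transitive_subset_ord[OF a tr sub(1)] transitive_subset_ord[OF b tr sub(2)] by metis
qed

text \<open>\<open>M\<close> runs the recursion for the levels up to \<open>d\<close> itself, by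
  means of \<open>DefM\<close>, which agrees with the true definable power set. The given sequence
  \<open>f\<close> need not belong to \<open>M\<close>; it is compared with the result by induction
  in a model containing \<open>M\<close> and \<open>f\<close>.\<close>

lemma L_subset_model:
  assumes M: "tmod M" and d: "isord d" "d \<in> ext M"
    and f: "isLseq f d" "opair d y \<in> ext f"
  shows "y \<in> ext M"
proof -
  define D where "D = succ d"
  \<comment> \<open>\<open>Uni b\<close> recovers the predecessor of a successor ordinal
    \<open>b\<close>. The union branch covers limits and also \<open>b = emp\<close>, where it
    yields \<open>emp\<close>.\<close>
  define G where "G b g = (if \<exists>c\<in>ext b. b = succ c then DefM M (app g (Uni b)) else
      Uni (col (app g ` ext b)))" for b g
  have D: "D \<in> ext M" using d(2) M by (simp add: D_def)
  have ordD: "isord b" if "b \<in> ext D" for b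
    using that isord_elem[OF d(1)] d(1) unfolding D_def by auto
  have Uni_succ: "Uni (succ c) = c" if "isord (succ c)" for c
  proof (rule extensional)
    have "transv c" using isord_elem[OF that, of c] unfolding isord_def by simp
    then show "ext (Uni (succ c)) = ext c" unfolding transv_def by auto
  qed
  have trD: "c \<in> ext D" if "b \<in> ext D" "c \<in> ext b" for b c
    using that d(1) unfolding D_def isord_def transv_def by auto
  have "\<exists>g\<in>ext M. \<forall>b\<in>ext D. app g b = G b g"
  proof (rule recursion[OF M D, of "\<lambda>x y. x \<in> ext y"])
    show "dfn M (\<lambda>e. e 0 \<in> ext (e (Suc 0)))" by (intro dfn_intros[OF M])
    show "\<exists>x\<in>ext Z. \<forall>y\<in>ext Z. y \<notin> ext x" if "ext Z \<noteq> {}" for Z using regularity[OF that] .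
    show "Fdef M (\<lambda>e. G (e 0) (e (Suc 0)))" unfolding G_def
      by (intro Fdef_DefM[OF M] dfn_intros[OF M])
    show "G b g = G b g'"
      if b: "b \<in> ext D" and eq: "\<And>c. c \<in> ext D \<Longrightarrow> c \<in> ext b \<Longrightarrow> app g c = app g' c" for b g g'
    proof (cases "\<exists>c\<in>ext b. b = succ c")
      case True
      then obtain c where c: "c \<in> ext b" "b = succ c" by blast
      then have "app g (Uni b) = app g' (Uni b)"
        using Uni_succ[of c] ordD[OF b] eq trD[OF b c(1)] by simp
      then show ?thesis using True by (simp add: G_def)
    next
      case False
      have "app g ` ext b = app g' ` ext b" using eq trD[OF b] by (intro image_cong) auto
      then show ?thesis using False by (simp add: G_def)
    qed
  qed
  then obtain g where g: "g \<in> ext M" "\<And>b. b \<in> ext D \<Longrightarrow> app g b = G b g" by blast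
  have dg: "Fdef M (\<lambda>e. app g (e 0))" by (intro dfn_intros[OF M] g)
  obtain N where N: "tmod N" "M \<in> ext N" "f \<in> ext N" using ex_tmod[of "{M, f}"] by auto
  have gN: "g \<in> ext N" "D \<in> ext N" using tmod_trans[OF N(1,2)] g(1) D by blast+
  have fN: "y \<in> ext N" if "opair b y \<in> ext f" for b y
    using tmod_trans[OF N(1,3) that] tmod_opair[OF N(1)] by blast
  have tot: "\<exists>y. opair b y \<in> ext f" if "b \<in> ext D" for b
  proof -
    have "isfun f D" using f(1) unfolding isLseq_def D_def by (rule conjunct1)
    then show ?thesis using that unfolding isfun_def by blast
  qed
  have "\<forall>y\<in>ext N. opair b y \<in> ext f \<longrightarrow> y = app g b" if "b \<in> ext D" for b
  proof (rule mem_induct[OF N(1) gN(2) _ that])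
    show "dfn N (\<lambda>e. \<forall>y\<in>ext N. opair (e 0) y \<in> ext f \<longrightarrow> y = app g (e 0))"
      by (intro dfn_intros[OF N(1)] N gN)
    fix b assume b: "b \<in> ext D"
      and IH: "\<And>c. c \<in> ext b \<Longrightarrow> c \<in> ext D \<Longrightarrow> \<forall>y\<in>ext N. opair c y \<in> ext f \<longrightarrow> y = app g c"
    have IH': "opair c z \<in> ext f \<longleftrightarrow> z = app g c" if "c \<in> ext b" for c z
      using IH[OF that trD[OF b that]] tot[OF trD[OF b that]] fN by metis
    have bM: "b \<in> ext M" using tmod_trans[OF M D b] .
    show "\<forall>y\<in>ext N. opair b y \<in> ext f \<longrightarrow> y = app g b"
    proof (intro ballI impI)
      fix y assume y: "opair b y \<in> ext f"
      have L: "b = emp \<Longrightarrow> y = emp"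
        "\<And>c z. c \<in> ext b \<Longrightarrow> b = succ c \<Longrightarrow> opair c z \<in> ext f \<Longrightarrow> ext y = {X. defin z X}"
        "b \<noteq> emp \<Longrightarrow> \<not> (\<exists>c\<in>ext b. b = succ c) \<Longrightarrow>
          ext y = {x. \<exists>c\<in>ext b. \<exists>z. opair c z \<in> ext f \<and> x \<in> ext z}"
        using f(1) b y unfolding isLseq_def D_def by blast+
      show "y = app g b"
      proof (cases "\<exists>c\<in>ext b. b = succ c")
        case True
        then obtain c where c: "c \<in> ext b" "b = succ c" by blast
        have z: "app g c \<in> ext M" using tmod_app[OF M g(1)] tmod_trans[OF M bM c(1)] by blast
        have "ext y = {X. defin (app g c) X}" using L(2)[OF c] IH'[OF c(1)] by blast
        then have "y = DefM M (app g c)" using ext_DefM[OF M z] extensional by metis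
        moreover have "app g b = DefM M (app g c)"
          using g(2)[OF b] True Uni_succ[of c] ordD[OF b] c by (simp add: G_def)
        ultimately show ?thesis by simp
      next
        case False
        have "ext (app g b) = (\<Union>c\<in>ext b. ext (app g c))"
          using g(2)[OF b] False ext_repl[OF M bM dg] by (simp add: G_def)
        moreover have "ext y = (\<Union>c\<in>ext b. ext (app g c))"
        proof (cases "b = emp")
          case True
          then show ?thesis using L(1) by simp
        next
          case b: False
          show ?thesis unfolding L(3)[OF b False] by (simp add: IH' set_eq_iff cong: bex_cong)
        qed
        ultimately show ?thesis using extensional by metis
      qed
    qed
  qed
  then have "y = app g d" using f(2) fN by (simp add: D_def)
  then show ?thesis using tmod_app[OF M g(1) d(2)] by simp
qed

text \<open>The Schroeder-Bernstein theorem for \<open>k \<subseteq> a\<close>: the bijection \<open>h\<close> from \<open>a\<close> to \<open>k\<close> applies \<open>f\<close> on the least set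
  containing \<open>a - k\<close> and closed under \<open>f\<close>, and is the identity elsewhere.\<close>

lemma schroeder_bernstein:
  assumes sub: "ext k \<subseteq> ext a" and f: "isinj f a k"
  shows "\<exists>g. isbij g k a"
proof -
  obtain N where N: "tmod N" "f \<in> ext N" "k \<in> ext N" "a \<in> ext N"
    using ex_tmod[of "{f, k, a}"] by auto
  have val: "opair x y \<in> ext f \<longleftrightarrow> y = app f x" if "x \<in> ext a" for x y
  proof -
    obtain y0 where "\<And>z. opair x z \<in> ext f \<longleftrightarrow> z = y0"
      using f \<open>x \<in> ext a\<close> unfolding isinj_def isfunto_def isfun_def by metis
    then show ?thesis using app_eq by metis
  qed
  have fk: "app f x \<in> ext k" if "x \<in> ext a" for x
    using f val[OF that] unfolding isinj_def isfunto_def by blast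
  have f_inj: "x = y" if "x \<in> ext a" "y \<in> ext a" "app f x = app f y" for x y
    using f val[OF that(1)] val[OF that(2)] that(3) unfolding isinj_def by metis
  define good where "good X \<longleftrightarrow> (\<forall>x\<in>ext a. x \<notin> ext k \<longrightarrow> x \<in> ext X) \<and> (\<forall>x\<in>ext X. app f x \<in> ext X)" for X
  \<comment> \<open>Instead of iterating \<open>f\<close> along omega, the least \<open>good\<close>
    subset of \<open>a\<close> is obtained as an intersection inside \<open>N\<close>.\<close>
  define C where "C = col {x \<in> ext a. \<forall>X\<in>ext (pw N a). good X \<longrightarrow> x \<in> ext X}"
  have dC: "dfn N (\<lambda>e. \<forall>X\<in>ext (pw N a). good X \<longrightarrow> e 0 \<in> ext X)"
    unfolding good_def by (intro dfn_intros[OF N(1)] N)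
  have extC: "ext C = {x \<in> ext a. \<forall>X\<in>ext (pw N a). good X \<longrightarrow> x \<in> ext X}"
    unfolding C_def by (rule ext_sep[OF N(1,4) dC])
  have CN: "C \<in> ext N" unfolding C_def by (rule tmod_sep[OF N(1,4) dC])
  have C1: "x \<in> ext C" if "x \<in> ext a" "x \<notin> ext k" for x
    using that unfolding extC good_def by blast
  have C2: "app f x \<in> ext C" if "x \<in> ext C" for x
    using that fk sub unfolding extC good_def by blast
  \<comment> \<open>Otherwise \<open>z\<close> could be removed from \<open>C\<close>: being in
    \<open>k\<close> and not a value of \<open>f\<close> on \<open>C\<close>, it leaves a
    \<open>good\<close> set behind.\<close>
  have C3: "\<exists>x\<in>ext C. app f x = z" if z: "z \<in> ext C" "z \<in> ext k" for z
  proof (rule ccontr)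
    assume no: "\<not> (\<exists>x\<in>ext C. app f x = z)"
    have zN: "z \<in> ext N" using tmod_trans[OF N(1) CN z(1)] .
    have dX: "dfn N (\<lambda>e. e 0 \<noteq> z)" by (intro dfn_intros[OF N(1)] zN)
    have X: "ext (col {x \<in> ext C. x \<noteq> z}) = {x \<in> ext C. x \<noteq> z}" (is "ext ?X = _")
      by (rule ext_sep[OF N(1) CN dX])
    have "?X \<in> ext N" by (rule tmod_sep[OF N(1) CN dX])
    then have "?X \<in> ext (pw N a)" unfolding ext_pw[OF N(1,4)] using X extC by blast
    moreover have "good ?X" unfolding good_def X using C1 C2 no z(2) by blast
    ultimately have "z \<in> ext ?X" using z(1) unfolding extC by blast
    then show False unfolding X by blast
  qed
  define h where "h x = (if x \<in> ext C then app f x else x)" for x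
  have hk: "h x \<in> ext k" if "x \<in> ext a" for x using fk[OF that] C1[OF that] by (auto simp: h_def)
  have Ca: "ext C \<subseteq> ext a" unfolding extC by blast
  have h_inj: "x = y" if "x \<in> ext a" "y \<in> ext a" "h x = h y" for x y
    using that f_inj C2 by (auto simp: h_def split: if_splits)
  have h_surj: "\<exists>x\<in>ext a. h x = z" if "z \<in> ext k" for z
  proof (cases "z \<in> ext C")
    case True
    then obtain x where "x \<in> ext C" "app f x = z" using C3 \<open>z \<in> ext k\<close> by blast
    then show ?thesis using Ca by (auto simp: h_def)
  next
    case False
    then show ?thesis using sub that by (auto simp: h_def)
  qed
  define g where "g = col ((\<lambda>x. opair (h x) x) ` ext a)"
  have "Fdef N (\<lambda>e. opair (h (e 0)) (e 0))"
    unfolding h_def by (intro dfn_intros[OF N(1)] N CN)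
  then have g: "ext g = (\<lambda>x. opair (h x) x) ` ext a"
    unfolding g_def by (rule ext_repl[OF N(1,4)])
  have gx: "opair u x \<in> ext g \<longleftrightarrow> x \<in> ext a \<and> u = h x" for u x
    unfolding g by auto
  have "isfun g k" unfolding isfun_def
  proof (intro conjI ballI)
    show "\<exists>x\<in>ext k. \<exists>y. p = opair x y" if "p \<in> ext g" for p
      using that hk unfolding g by blast
    show "\<exists>y. opair x y \<in> ext g \<and> (\<forall>z. opair x z \<in> ext g \<longrightarrow> z = y)" if "x \<in> ext k" for x
      using h_surj[OF that] h_inj unfolding gx by blast
  qed
  then have "isbij g k a"
    unfolding isbij_def isinj_def isfunto_def gx using hk by blast
  then show ?thesis by blast
qed

section \<open>Refutation of TMA in a structure\<close>

theorem no_tall_models: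
  assumes VL: "\<And>x. \<exists>d. isord d \<and> (\<exists>f y. isLseq f d \<and> opair d y \<in> ext f \<and> x \<in> ext y)"
    and GC: "\<And>y. \<exists>f. isinj f y k"
    and a: "isord a" "k \<in> ext a"
    and tall: "\<And>d. isord d \<Longrightarrow> a \<in> ext d \<or> a = d \<Longrightarrow>
      \<exists>M. tmod M \<and> d \<in> ext M \<and> \<not> (\<exists>f\<in>ext M. isbij f k a)"
  shows False
proof -
  obtain f where f: "isinj f a k" using GC by blast
  have "ext k \<subseteq> ext a" using a unfolding isord_def transv_def by blast
  then obtain g where g: "isbij g k a" using schroeder_bernstein f by blast
  obtain d f y where d: "isord d" and L: "isLseq f d" "opair d y \<in> ext f" "g \<in> ext y"
    using VL by blast
  \<comment> \<open>TMA speaks only of ordinals from \<open>a\<close> on, so \<open>d\<close> is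
    replaced by the larger of the two.\<close>
  define m where "m = (if a \<in> ext d then d else a)"
  have m: "isord m" "a \<in> ext m \<or> a = m" using a(1) d by (auto simp: m_def)
  have dm: "d = m \<or> d \<in> ext m" using isord_comparable[OF a(1) d] by (auto simp: m_def)
  obtain M where M: "tmod M" "m \<in> ext M" "\<not> (\<exists>f\<in>ext M. isbij f k a)"
    using tall[OF m] by blast
  have "d \<in> ext M" using dm M(2) tmod_trans[OF M(1,2)] by blast
  then have "y \<in> ext M" by (rule L_subset_model[OF M(1) d _ L(1,2)])
  then have "g \<in> ext M" using tmod_trans[OF M(1)] L(3) by blast
  then show False using M(3) g by blast
qed

lemma no_TMA:
  assumes VL: "holdsE UNIV e r n V_eq_L" and GC: "holdsE UNIV e r n GC"
    and model: "\<And>r n A. holdsE UNIV e r n (model A) \<Longrightarrow> A < n \<Longrightarrow> tmod (r A)"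
  shows "\<not> holdsE UNIV e r n TMA"
proof
  assume TMA: "holdsE UNIV e r n TMA"
  obtain k where k: "isord k" "\<And>y. \<exists>f. isinj f y k"
    using GC unfolding GC_def card_le_def by auto
  obtain a where a: "isord a" "k \<in> ext a" and
    tall: "\<And>d. isord d \<Longrightarrow> a \<in> ext d \<or> a = d \<Longrightarrow> \<exists>M. holdsE UNIV e (r(n := k, Suc n := a,
      Suc (Suc n) := d, Suc (Suc (Suc n)) := M)) (Suc (Suc (Suc (Suc n)))) (model (Suc (Suc (Suc n)))) \<and>
      d \<in> ext M \<and> holdsE (ext M) e (r(n := k, Suc n := a,
      Suc (Suc n) := d, Suc (Suc (Suc n)) := M)) (Suc (Suc (Suc (Suc n)))) (card_less n (Suc n))"
  proof -
    have "\<forall>k. isord k \<longrightarrow> (\<exists>a. isord a \<and> k \<in> ext a \<and> (\<forall>d. isord d \<and> (a \<in> ext d \<or> a = d) \<longrightarrow>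
      (\<exists>M. holdsE UNIV e (r(n := k, Suc n := a,
      Suc (Suc n) := d, Suc (Suc (Suc n)) := M)) (Suc (Suc (Suc (Suc n)))) (model (Suc (Suc (Suc n)))) \<and>
      d \<in> ext M \<and> holdsE (ext M) e (r(n := k, Suc n := a,
      Suc (Suc n) := d, Suc (Suc (Suc n)) := M)) (Suc (Suc (Suc (Suc n)))) (card_less n (Suc n)))))"
      using TMA unfolding TMA_def by simp
    then show thesis using k(1) that by blast
  qed
  show False
  proof (rule no_tall_models[OF _ k(2) a])
    show "\<exists>d. isord d \<and> (\<exists>f y. isLseq f d \<and> opair d y \<in> ext f \<and> x \<in> ext y)" for x
      using VL unfolding V_eq_L_def by auto
    fix d assume d: "isord d" "a \<in> ext d \<or> a = d"
    obtain M where M: "holdsE UNIV e (r(n := k, Suc n := a,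
      Suc (Suc n) := d, Suc (Suc (Suc n)) := M)) (Suc (Suc (Suc (Suc n)))) (model (Suc (Suc (Suc n))))"
      "d \<in> ext M" "holdsE (ext M) e (r(n := k, Suc n := a,
      Suc (Suc n) := d, Suc (Suc (Suc n)) := M)) (Suc (Suc (Suc (Suc n)))) (card_less n (Suc n))"
      using tall[OF d] by blast
    have tm: "tmod M" using model[OF M(1)] by simp
    have aM: "a \<in> ext M" using d(2) M(2) tmod_trans[OF tm M(2)] by blast
    have kM: "k \<in> ext M" using tmod_trans[OF tm aM a(2)] .
    \<comment> \<open>This is the negated conjunct of \<open>card_less\<close>; its quantifier over
      bijections ranges over \<open>M\<close>, and being a bijection is absolute.\<close>
    have "\<not> (\<exists>f\<in>ext M. isbij f k a)"
      using M(3) holds_card_eq[OF tmod_transU[OF tm], of n "Suc (Suc (Suc (Suc n)))" "Suc n"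
        "r(n := k, Suc n := a, Suc (Suc n) := d, Suc (Suc (Suc n)) := M)" e] aM kM
      unfolding card_less_def by simp
    then show "\<exists>M. tmod M \<and> d \<in> ext M \<and> \<not> (\<exists>f\<in>ext M. isbij f k a)" using tm M(2) by blast
  qed
qed

text \<open>Omega is an ordinal by definition, so it serves as the greatest cardinality.\<close>

lemma countable_GC: "holdsE UNIV e r n every_set_countable \<Longrightarrow> holdsE UNIV e r n GC"
  unfolding every_set_countable_def GC_def card_le_def by (auto simp: isomega_def)

end

section \<open>From first-order models to structures\<close>

context membership
begin

lemma pair_unionI:
  assumes "holdsE UNIV e r n Ax_extensionality" "holdsE UNIV e r n Ax_empty"
    "holdsE UNIV e r n Ax_pair" "holdsE UNIV e r n Ax_union"
  shows "pair_union E"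
proof
  show "a = b" if "ext a = ext b" for a b
    using assms(1) that unfolding Ax_extensionality_def by simp
  show "\<exists>a. ext a = {}"
    using assms(2) unfolding Ax_empty_def is_empty_def by auto
  show "\<exists>a. ext a = {x, y}" for x y
    using assms(3) unfolding Ax_pair_def is_upair_def by (auto simp: set_eq_iff)
  show "\<exists>a. ext a = (\<Union>y\<in>ext x. ext y)" for x
    using assms(4) unfolding Ax_union_def by (simp add: set_eq_iff Bex_def)
qed

end

context pair_union
begin

lemma Loc_ZFC_model:
  assumes "holdsE UNIV e r n Loc_ZFC"
  obtains M where "x \<in> ext M" "transv M"
    "holdsE UNIV e (r(n := x, Suc n := M)) (Suc (Suc n)) (sat_ZFC (Suc n))"
  using assms unfolding Loc_ZFC_def by auto

text \<open>Foundation reaches \<open>V\<close> through its models: a nonempty set lies in a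
  transitive model together with its elements, and foundation there gives a minimal one.\<close>

lemma regularI:
  assumes "holdsE UNIV e r n Loc_ZFC"
  shows "regular E"
proof
  fix a assume a: "ext a \<noteq> {}"
  obtain M where M: "a \<in> ext M" "transv M"
    "holdsE UNIV e (r(n := a, Suc n := M)) (Suc (Suc n)) (sat_ZFC (Suc n))"
    using Loc_ZFC_model[OF assms] by blast
  have sub: "ext a \<subseteq> ext M" using M(1,2) unfolding transv_def by blast
  have fnd: "\<forall>x\<in>ext M. \<not> (\<forall>z\<in>ext M. z \<notin> ext x) \<longrightarrow> (\<exists>y\<in>ext M. y \<in> ext x \<and> (\<forall>z\<in>ext M. z \<in> ext x \<longrightarrow> z \<notin> ext y))"
    using M(3) unfolding sat_ZFC_def Ax_foundation_def is_empty_def by simp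
  show "\<exists>y\<in>ext a. \<forall>z\<in>ext a. z \<notin> ext y"
    using bspec[OF fnd M(1)] a sub by blast
qed

end

context regular
begin

text \<open>Members of elements of \<open>A\<close> are again in \<open>A\<close>, so each
  relativized axiom describes a true extension. Pairing precedes power set and infinity because
  reading their formulas inside \<open>A\<close> relies on \<open>transU\<close>.\<close>

lemma tmodI:
  assumes tr: "transv (r A)" and A: "A < n" and ZFC: "holdsE UNIV e r n (sat_ZFC A)"
  shows "tmod (r A)"
proof -
  let ?M = "r A"
  have sub: "y \<in> ext ?M" if "x \<in> ext ?M" "y \<in> ext x" for x y
    using that tr unfolding transv_def by blast
  have emp: "emp \<in> ext ?M"
  proof -
    have "\<exists>x\<in>ext ?M. \<forall>z\<in>ext ?M. z \<notin> ext x"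
      using ZFC A unfolding sat_ZFC_def Ax_empty_def is_empty_def by simp
    then obtain x where "x \<in> ext ?M" "ext x = {}" using sub by blast
    then show ?thesis using eq_emp_iff by metis
  qed
  have pair: "upair x y \<in> ext ?M" if "x \<in> ext ?M" "y \<in> ext ?M" for x y
  proof -
    have "\<exists>p\<in>ext ?M. \<forall>z\<in>ext ?M. z \<in> ext p \<longleftrightarrow> z = x \<or> z = y"
      using ZFC A that unfolding sat_ZFC_def Ax_pair_def is_upair_def by simp
    then obtain p where p: "p \<in> ext ?M" "\<forall>z\<in>ext ?M. z \<in> ext p \<longleftrightarrow> z = x \<or> z = y" by blast
    then have "ext p = {x, y}" using sub[OF p(1)] that by blast
    then show ?thesis using p(1) by (metis ext_upair extensional)
  qed
  have tU: "transU (ext ?M)" using sub pair unfolding transU_def by blast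
  have union: "Uni x \<in> ext ?M" if "x \<in> ext ?M" for x
  proof -
    have "\<exists>u\<in>ext ?M. \<forall>z\<in>ext ?M. z \<in> ext u \<longleftrightarrow> (\<exists>y\<in>ext ?M. y \<in> ext x \<and> z \<in> ext y)"
      using ZFC A that unfolding sat_ZFC_def Ax_union_def by simp
    then obtain u where u: "u \<in> ext ?M"
      "\<forall>z\<in>ext ?M. z \<in> ext u \<longleftrightarrow> (\<exists>y\<in>ext ?M. y \<in> ext x \<and> z \<in> ext y)" by blast
    have "ext u = ext (Uni x)" unfolding ext_Uni using u sub that by blast
    then show ?thesis using u(1) extensional by metis
  qed
  have power: "\<exists>y\<in>ext ?M. ext y = {z \<in> ext ?M. ext z \<subseteq> ext x}" if "x \<in> ext ?M" for x
  proof -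
    have "\<exists>y\<in>ext ?M. \<forall>z\<in>ext ?M. z \<in> ext y \<longleftrightarrow> ext z \<subseteq> ext x"
      using ZFC A that unfolding sat_ZFC_def Ax_power_def by (simp add: holds_subset[OF tU])
    then show ?thesis using sub by blast
  qed
  have infinity: "\<exists>x\<in>ext ?M. emp \<in> ext x \<and> (\<forall>y\<in>ext x. succ y \<in> ext x)"
  proof -
    have "\<exists>x\<in>ext ?M. (\<exists>y\<in>ext ?M. y \<in> ext x \<and> y = emp) \<and>
        (\<forall>y\<in>ext ?M. y \<in> ext x \<longrightarrow> (\<exists>z\<in>ext ?M. z \<in> ext x \<and> z = succ y))"
      using ZFC A unfolding sat_ZFC_def Ax_infinity_def
      by (simp add: holds_is_empty[OF tU] holds_is_succ[OF tU])
    then show ?thesis using sub by blast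
  qed
  have "sep_holds ?M" "repl_holds ?M"
    using ZFC A holds_sat_separation holds_sat_replacement unfolding sat_ZFC_def by simp_all
  then show ?thesis unfolding tmod_def using tr emp pair union power infinity by blast
qed

lemma lzfc_structureI:
  assumes "holdsE UNIV e r n Loc_ZFC" "holdsE UNIV e r n Ax_omega"
  shows "lzfc_structure E"
proof
  show "\<exists>w. isomega w" using assms(2) unfolding Ax_omega_def by auto
  fix x
  obtain M where M: "x \<in> ext M" "transv M"
    "holdsE UNIV e (r(n := x, Suc n := M)) (Suc (Suc n)) (sat_ZFC (Suc n))"
    using Loc_ZFC_model[OF assms(1)] by blast
  have "tmod M" using tmodI[OF _ _ M(3)] M(2) by simp
  then show "\<exists>M. x \<in> ext M \<and> tmod M" using M(1) by blast
qed

end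

lemma LZFC_refutes_TMA:
  assumes LZFC: "\<And>p. p \<in> LZFC \<Longrightarrow> sat UNIV E e p"
    and GC: "sat UNIV E e (GC 0) \<or> sat UNIV E e (every_set_countable 0)"
    and VL: "sat UNIV E e (V_eq_L 0)"
  shows "\<not> sat UNIV E e (TMA 0)"
proof -
  have ax: "holds UNIV E e e 0 p"
    if "p \<in> {Ax_empty, Ax_extensionality, Ax_pair, Ax_union, Ax_omega, Loc_ZFC}" for p
  proof -
    have "p 0 \<in> LZFC" using that unfolding LZFC_def BST_def by auto
    then show ?thesis using LZFC by (simp add: holds_0)
  qed
  interpret membership E .
  interpret pair_union E by (rule pair_unionI) (rule ax, simp)+
  interpret regular E by (rule regularI) (rule ax, simp)
  interpret lzfc_structure E by (rule lzfc_structureI) (rule ax, simp)+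
  have "holds UNIV E e e 0 GC"
    using GC countable_GC[of e e 0] by (auto simp: holds_0)
  moreover have "tmod (r A)" if "holds UNIV E e r n (model A)" "A < n" for r n A
    using that tmodI[of r A n e] unfolding model_def by simp
  ultimately have "\<not> holds UNIV E e e 0 TMA"
    using VL by (intro no_TMA) (auto simp: holds_0)
  then show ?thesis by (simp add: holds_0)
qed

text \<open>The argument so far has a whole type as its domain, while completeness yields a set of
  natural numbers; a bijection carries one structure to the other.\<close>

lemma sat_bij:
  assumes "bij_betw g UNIV U"
  shows "sat UNIV (\<lambda>x y. E (g x) (g y)) e p \<longleftrightarrow> sat U E (\<lambda>i. g (e i)) p"
proof (induction p arbitrary: e)
  case (Equal i j)
  show ?case using assms by (simp add: bij_betw_def inj_eq)
next
  case (Forall p)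
  have "(\<lambda>i. g (case_nat x e i)) = case_nat (g x) (\<lambda>i. g (e i))" for x
    by (auto split: nat.split)
  then show ?case using Forall assms by (auto simp: bij_betw_def)
qed auto

text \<open>The map \<open>x \<mapsto> {x}\<close> is injective and misses \<open>\<emptyset>\<close>.\<close>

lemma infinite_model:
  assumes "sat U E e (Ax_empty 0)" "sat U E e (Ax_pair 0)"
  shows "infinite U"
proof
  assume fin: "finite U"
  interpret membership E .
  have "\<forall>x\<in>U. \<exists>p\<in>U. \<forall>z\<in>U. E z p \<longleftrightarrow> z = x"
    using assms(2) unfolding holds_0[symmetric, of U E e _ e] Ax_pair_def is_upair_def
    by (fastforce simp: ext_def)
  then obtain s where s: "\<And>x. x \<in> U \<Longrightarrow> s x \<in> U" "\<And>x z. x \<in> U \<Longrightarrow> z \<in> U \<Longrightarrow> E z (s x) \<longleftrightarrow> z = x"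
    by metis
  have "inj_on s U" by (rule inj_onI) (metis s(2))
  then have "s ` U = U" using fin s(1) by (intro endo_inj_surj) auto
  obtain z where z: "z \<in> U" "\<And>y. y \<in> U \<Longrightarrow> \<not> E y z"
    using assms(1) unfolding holds_0[symmetric, of U E e _ e] Ax_empty_def is_empty_def
    by (auto simp: ext_def)
  obtain x where "x \<in> U" "z = s x" using z(1) \<open>s ` U = U\<close> by blast
  then show False using s(2)[of x x] z(2)[of x] by simp
qed

lemma proves_not_TMA:
  assumes "LZFC \<subseteq> T" "V_eq_L 0 \<in> T" "GC 0 \<in> T \<or> every_set_countable 0 \<in> T"
  shows "T \<turnstile> (\<^bold>\<not> TMA) 0"
proof (rule ccontr)
  assume "\<not> T \<turnstile> (\<^bold>\<not> TMA) 0"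
  then obtain U :: "nat set" and E e where U: "range e \<subseteq> U" "\<And>q. q \<in> T \<Longrightarrow> sat U E e q"
    "\<not> sat U E e ((\<^bold>\<not> TMA) 0)"
    by (rule completeness) (rule that)
  have "Ax_empty 0 \<in> T" "Ax_pair 0 \<in> T" using assms(1) unfolding LZFC_def BST_def by auto
  then have "infinite U" using infinite_model U(2) by blast
  then have bij: "bij_betw (enumerate U) UNIV U" by (rule bij_enumerate)
  define e' where "e' i = inv_into UNIV (enumerate U) (e i)" for i
  have e': "(\<lambda>i. enumerate U (e' i)) = e"
  proof
    fix i
    have "e i \<in> range (enumerate U)" using U(1) bij by (auto simp: bij_betw_def)
    then show "enumerate U (e' i) = e i" unfolding e'_def by (rule f_inv_into_f)
  qed
  have sat: "sat UNIV (\<lambda>x y. E (enumerate U x) (enumerate U y)) e' p \<longleftrightarrow> sat U E e p" for p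
    using sat_bij[OF bij, of E e' p] unfolding e' .
  have "\<not> sat UNIV (\<lambda>x y. E (enumerate U x) (enumerate U y)) e' (TMA 0)"
    by (rule LZFC_refutes_TMA) (use assms U(2) sat in auto)
  then show False using U(3) unfolding sat by (simp add: fneg_def)
qed

theorem proposition5p9:
  shows "LZFC \<union> {GC 0, V_eq_L 0} \<turnstile> (\<^bold>\<not> TMA) 0 \<and>
    LZFC \<union> {every_set_countable 0, V_eq_L 0} \<turnstile> (\<^bold>\<not> TMA) 0"
  by (intro conjI proves_not_TMA) auto

end
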